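(* Let $n\geq 1$ be an integer and let $\sigma\geq 0$ be real. There is an (explicit) constant $C(n,\sigma)$, depending only on $n$ and $\sigma$, with the following property. Let $f:\mathbf{C}\to\mathbf{P}^n$ be a holomorphic curve omitting $n$ hyperplanes in general position, and suppose that for some constant $K$ with $0\leq K<\infty$ the Fubini--Study derivative of $f$ satisfies $$\limsup_{z\to\infty}|z|^{-\sigma}\|f'\|(z)\leq K.$$ Then $$\limsup_{r\to\infty}\frac{T(r,f)}{r^{\sigma+1}}\leq K\,C(n,\sigma).$$
   Context: $\mathbf{P}^n$ is complex projective space of dimension $n$. A holomorphic curve $f:\mathbf{C}\to\mathbf{P}^n$ has a homogeneous representation $(f_0,\ldots,f_n)$, where the $f_j$ are entire functions that never simultaneously vanish. Put $\|f\|^2=\sum_{j=0}^n|f_j|^2$. The Fubini--Study (spherical) derivative $\|f'\|$ is defined by $$\|f'\|^2=\|f\|^{-4}\sum_{i<j}|f_i'f_j-f_if_j'|^2$$ (independent of the homogeneous representation). The Nevanlinna--Cartan characteristic is $$T(r,f)=\int_0^r\frac{dt}{t}\left(\frac1\pi\int_{|z|\leq t}\|f'\|^2(z)\,dm(z)\right),$$ where $dm$ is the area element in $\mathbf{C}$. A collection of $n$ hyperplanes in $\mathbf{P}^n$ is in general position if the linear forms defining them are linearly independent. The curve $f$ omits a hyperplane if its image is disjoint from it. *)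

theory Defs
  imports "HOL-Complex_Analysis.Complex_Analysis"
begin

text \<open>
  Vectors of \<open>\<complex>\<^sup>n\<^sup>+\<^sup>1\<close> are functions on \<open>nat\<close> of which only the
  coordinates \<open>0, \<dots>, n\<close> count.  A point of projective space is a line through the origin,
  with the irrelevant coordinates set to 0.
\<close>

type_synonym proj_pt = "(nat \<Rightarrow> complex) set"

definition proj_point :: "nat \<Rightarrow> (nat \<Rightarrow> complex) \<Rightarrow> proj_pt" where
  "proj_point n v = {(\<lambda>j. if j \<le> n then c * v j else 0) | c. True}"

definition proj_space :: "nat \<Rightarrow> proj_pt set" where
  "proj_space n = {proj_point n v | v. \<exists>j\<le>n. v j \<noteq> 0}"

definition linear_form :: "nat \<Rightarrow> (nat \<Rightarrow> complex) \<Rightarrow> (nat \<Rightarrow> complex) \<Rightarrow> complex" where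
  "linear_form n a v = (\<Sum>j\<le>n. a j * v j)"

text \<open>This is a genuine hyperplane only for a nonzero form, which linear independence enforces.\<close>

definition proj_hyperplane :: "nat \<Rightarrow> (nat \<Rightarrow> complex) \<Rightarrow> proj_pt set" where
  "proj_hyperplane n a = {p \<in> proj_space n. \<forall>v\<in>p. linear_form n a v = 0}"

definition lin_indep_forms :: "nat \<Rightarrow> nat \<Rightarrow> (nat \<Rightarrow> nat \<Rightarrow> complex) \<Rightarrow> bool" where
  "lin_indep_forms n m a \<longleftrightarrow>
     (\<forall>c :: nat \<Rightarrow> complex. (\<forall>j\<le>n. (\<Sum>i<m. c i * a i j) = 0) \<longrightarrow> (\<forall>i<m. c i = 0))"

definition homogeneous_rep ::
    "nat \<Rightarrow> (complex \<Rightarrow> proj_pt) \<Rightarrow> (nat \<Rightarrow> complex \<Rightarrow> complex) \<Rightarrow> bool" where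
  "homogeneous_rep n F f \<longleftrightarrow>
     (\<forall>j\<le>n. f j holomorphic_on UNIV) \<and>
     (\<forall>z. \<exists>j\<le>n. f j z \<noteq> 0) \<and>
     (\<forall>z. F z = proj_point n (\<lambda>j. f j z))"

definition holomorphic_curve :: "nat \<Rightarrow> (complex \<Rightarrow> proj_pt) \<Rightarrow> bool" where
  "holomorphic_curve n F \<longleftrightarrow> (\<exists>f. homogeneous_rep n F f)"

definition rep_norm :: "nat \<Rightarrow> (nat \<Rightarrow> complex \<Rightarrow> complex) \<Rightarrow> complex \<Rightarrow> real" where
  "rep_norm n f z = sqrt (\<Sum>j\<le>n. (cmod (f j z))\<^sup>2)"

definition fs_deriv_rep :: "nat \<Rightarrow> (nat \<Rightarrow> complex \<Rightarrow> complex) \<Rightarrow> complex \<Rightarrow> real" where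
  "fs_deriv_rep n f z =
     sqrt ((\<Sum>j\<le>n. \<Sum>i<j. (cmod (deriv (f i) z * f j z - f i z * deriv (f j) z))\<^sup>2)
           / rep_norm n f z ^ 4)"

text \<open>
  The choice of representation is immaterial, see \<open>fs_deriv_eq_rep\<close> below.
\<close>

definition fs_deriv :: "nat \<Rightarrow> (complex \<Rightarrow> proj_pt) \<Rightarrow> complex \<Rightarrow> real" where
  "fs_deriv n F = fs_deriv_rep n (SOME f. homogeneous_rep n F f)"

definition cartan_char :: "nat \<Rightarrow> (complex \<Rightarrow> proj_pt) \<Rightarrow> real \<Rightarrow> real" where
  "cartan_char n F r =
     (LINT t:{0<..r}|lborel.
        (1 / t) * ((1 / pi) * (LINT z:cball (0::complex) t|lborel. (fs_deriv n F z)\<^sup>2)))"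

lemma homogeneous_rep_in_proj_space: "homogeneous_rep n F f \<Longrightarrow> F z \<in> proj_space n"
  unfolding homogeneous_rep_def proj_space_def by blast

lemma proj_point_eqD:
  assumes "proj_point n v = proj_point n w"
  obtains c where "\<And>j. j \<le> n \<Longrightarrow> v j = c * w j"
proof -
  have "(\<lambda>j. if j \<le> n then 1 * v j else 0) \<in> proj_point n v"
    unfolding proj_point_def by blast
  then obtain c where c: "(\<lambda>j. if j \<le> n then 1 * v j else 0) = (\<lambda>j. if j \<le> n then c * w j else 0)"
    using assms unfolding proj_point_def by blast
  show ?thesis
    by (rule that[of c]) (use fun_cong[OF c] in \<open>metis mult_1\<close>)
qed

lemma fs_deriv_rep_unique:
  assumes f: "homogeneous_rep n F f" and g: "homogeneous_rep n F g"
  shows "fs_deriv_rep n g z = fs_deriv_rep n f z"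
proof -
  have fh: "f j holomorphic_on UNIV" and gh: "g j holomorphic_on UNIV" if "j \<le> n" for j
    using that f g by (auto simp: homogeneous_rep_def)
  have fd: "(f j has_field_derivative deriv (f j) w) (at w)"
    and gd: "(g j has_field_derivative deriv (g j) w) (at w)" if "j \<le> n" for j w
    using fh gh that holomorphic_derivI by blast+
  have "\<exists>c. \<forall>j\<le>n. g j w = c * f j w" for w
  proof -
    have "proj_point n (\<lambda>j. g j w) = proj_point n (\<lambda>j. f j w)"
      using f g by (simp add: homogeneous_rep_def)
    then obtain c where "\<And>j. j \<le> n \<Longrightarrow> g j w = c * f j w"
      by (rule proj_point_eqD) blast
    then show ?thesis by blast
  qed
  then obtain h where h: "\<And>w j. j \<le> n \<Longrightarrow> g j w = h w * f j w"
    by metis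
  have h0: "h z \<noteq> 0"
    using g h[of _ z] unfolding homogeneous_rep_def by (metis mult_zero_left)
  obtain k where k: "k \<le> n" "f k z \<noteq> 0"
    using f unfolding homogeneous_rep_def by blast
  have cross: "g i w * f k w = g k w * f i w" if "i \<le> n" for i w
    using h[OF that] h[OF k(1)] by simp
  have dcross: "deriv (g i) z * f k z + g i z * deriv (f k) z =
                deriv (g k) z * f i z + g k z * deriv (f i) z" if i: "i \<le> n" for i
  proof (rule DERIV_unique)
    show "((\<lambda>w. g i w * f k w) has_field_derivative
            deriv (g i) z * f k z + g i z * deriv (f k) z) (at z)"
      by (rule derivative_eq_intros gd[OF i] fd[OF k(1)] | simp)+
    have "((\<lambda>w. g k w * f i w) has_field_derivative
            deriv (g k) z * f i z + g k z * deriv (f i) z) (at z)"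
      by (rule derivative_eq_intros fd[OF i] gd[OF k(1)] | simp)+
    then show "((\<lambda>w. g i w * f k w) has_field_derivative
            deriv (g k) z * f i z + g k z * deriv (f i) z) (at z)"
      by (simp add: cross[OF i])
  qed
  define e where "e = (deriv (g k) z - h z * deriv (f k) z) / f k z"
  have dg: "deriv (g i) z = e * f i z + h z * deriv (f i) z" if i: "i \<le> n" for i
    using dcross[OF i] k(2) by (simp add: e_def h[OF i] h[OF k(1)] field_simps)
  have W: "deriv (g i) z * g j z - g i z * deriv (g j) z =
           (h z)\<^sup>2 * (deriv (f i) z * f j z - f i z * deriv (f j) z)" if "i \<le> n" "j \<le> n" for i j
    using that by (simp add: dg h algebra_simps power2_eq_square)
  have N: "rep_norm n g z = cmod (h z) * rep_norm n f z"
  proof -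
    have "(\<Sum>j\<le>n. (cmod (g j z))\<^sup>2) = (cmod (h z))\<^sup>2 * (\<Sum>j\<le>n. (cmod (f j z))\<^sup>2)"
      by (simp add: h norm_mult power_mult_distrib sum_distrib_left)
    then show ?thesis
      by (simp add: rep_norm_def real_sqrt_mult)
  qed
  have "(\<Sum>j\<le>n. \<Sum>i<j. (cmod (deriv (g i) z * g j z - g i z * deriv (g j) z))\<^sup>2)
      = (\<Sum>j\<le>n. \<Sum>i<j. cmod (h z) ^ 4 * (cmod (deriv (f i) z * f j z - f i z * deriv (f j) z))\<^sup>2)"
    by (intro sum.cong refl) (simp add: W norm_mult norm_power power_mult_distrib)
  also have "\<dots> = cmod (h z) ^ 4 *
      (\<Sum>j\<le>n. \<Sum>i<j. (cmod (deriv (f i) z * f j z - f i z * deriv (f j) z))\<^sup>2)"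
    by (simp add: sum_distrib_left)
  finally show ?thesis
    unfolding fs_deriv_rep_def N using h0 by (simp add: power_mult_distrib)
qed

lemma fs_deriv_eq_rep:
  assumes "homogeneous_rep n F f"
  shows "fs_deriv n F = fs_deriv_rep n f"
  unfolding fs_deriv_def
  using fs_deriv_rep_unique[OF assms someI[of "homogeneous_rep n F", OF assms]] by blast

end

(*
  Normalise the representation so that the omitted forms are exp P_0 = 1, exp P_1, ..., exp P_(n-1),
  and let e be a unit vector in their common kernel, so that f is determined by f0 = <f, e> and the
  exp P_j.  Put A = d/dz log |f|^2; then |c(f)' - A c(f)| <= |c| |f'| |f| for every linear form c,
  where |f'| is the Fubini-Study derivative, and N(z) = min_j |A - P_j'| measures how far f is
  from a single exponential.  On E = {|f0|^2 <= |f|^2 / 2} some exp P_j is comparable to |f|; away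
  from E, a Hopf-type boundary estimate for c(f)/f0 gives N(a) <= 18 |f'|(z1) + 2 |f'|(a) + C / dist(a, E)
  with z1 in E nearest to a, where C depends on the hyperplanes.

  That dependence is removed by rescaling: if limsup N / |z|^sigma were large compared with K, a
  normal families limit would be an entire curve with small spherical derivative whose omitted
  forms are exponential sums with frequencies mu_j, and with A within distance 1 of some mu_j
  everywhere but at distance at least 1 from all mu_j at the origin.  Such a curve does not exist.

  Hence A - P_j' = O(K |z|^sigma) with a fixed j near infinity, because A moves continuously.
  Then log |f| - Re P_j = O(K |z|^(sigma+1)), and T(r, f) is the circular mean of log |f| up to a
  constant, while the mean of Re P_j is constant.  The same argument with larger sigma and K = 0
  shows that the polynomials P_j have degree at most sigma + 1.
*)

theory Submission
  imports
    Defs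
    "HOL-Real_Asymp.Real_Asymp"
begin

section \<open>Integration in polar coordinates\<close>

text \<open>The constant is (4 n + 3) (18 * 3 powr (2 \<sigma> + 1) + 2 + 1 / t), with
  \<open>t\<close> from \<open>brody_gap\<close>. The 18 and the 2 are the coefficients of the
  boundary estimate. The power of 3 appears because a nearest point of \<open>E\<close> has modulus
  at most 3 |z|; its exponent belongs to f(z^2), which replaces f to make the growth exponent
  positive. 1 / t is the price of the compactness argument, 4 n + 3 that of one exponent for all
  large z instead of the nearest one at each z. The hyperplanes enter through C / dist(a, E), which
  is negligible once dist(a, E) |z|^\<sigma> is large. So a violation of the bound can only occur
  close to \<open>E\<close>, and after rescaling a point of \<open>E\<close> stays at bounded
  distance. The limit curve inherits a point where f0 does not dominate, and this excludes it: where
  f0 dominates, f0'/f0 is holomorphic and almost equal to A, and the product of the f0'/f0 - mu_j is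
  tiny on the boundary of that domain but not at the origin, against the maximum principle. No
  assumption makes the P_j polynomials; a crude bound T(r, f) = O(r^(2 \<sigma> + 2)) has to supply
  that first.\<close>

lemma borel_measurable_Complex_pair [measurable]:
  "(\<lambda>(x::real, y::real). Complex x y) \<in> borel_measurable (lborel \<Otimes>\<^sub>M lborel)"
proof -
  have "(\<lambda>p::real\<times>real. complex_of_real (fst p) + \<i> * complex_of_real (snd p)) \<in> borel_measurable (lborel \<Otimes>\<^sub>M lborel)"
    by measurable
  moreover have "(\<lambda>(x::real, y::real). Complex x y) = (\<lambda>p. complex_of_real (fst p) + \<i> * complex_of_real (snd p))"
    by (rule ext) (simp add: complex_eq_iff case_prod_unfold)
  ultimately show ?thesis by simp
qed

lemma lborel_complex_eq_distr:
  "(lborel :: complex measure) = distr (lborel \<Otimes>\<^sub>M lborel) borel (\<lambda>(x::real, y::real). Complex x y)"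
proof (rule lborel_eqI)
  have m: "(\<lambda>(x::real, y::real). Complex x y) \<in> borel_measurable (lborel \<Otimes>\<^sub>M lborel)"
  by (rule borel_measurable_Complex_pair)
  fix l u :: complex
  assume le: "\<And>b. b \<in> Basis \<Longrightarrow> l \<bullet> b \<le> u \<bullet> b"
  then have l1: "Re l \<le> Re u" "Im l \<le> Im u"
    using le[of 1] le[of \<i>] by (auto simp: Basis_complex_def inner_complex_def)
  have "(\<lambda>(x::real, y::real). Complex x y) -` box l u \<inter> space (lborel \<Otimes>\<^sub>M lborel)
     = box (Re l) (Re u) \<times> box (Im l) (Im u)"
    by (auto simp: in_box_complex_iff space_pair_measure)
  then show "emeasure (distr (lborel \<Otimes>\<^sub>M lborel) borel (\<lambda>(x::real, y::real). Complex x y)) (box l u)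
     = ennreal (\<Prod>b\<in>Basis. (u - l) \<bullet> b)"
    using m l1 by (simp add: emeasure_distr lborel.emeasure_pair_measure_Times Basis_complex_def ennreal_mult)
qed simp

lemma nn_integral_complex_Fubini:
  assumes [measurable]: "h \<in> borel_measurable (borel :: complex measure)"
  shows "(\<integral>\<^sup>+z. h z \<partial>lborel) = (\<integral>\<^sup>+x. \<integral>\<^sup>+y. h (Complex x y) \<partial>lborel \<partial>lborel)"
    and "(\<integral>\<^sup>+z. h z \<partial>lborel) = (\<integral>\<^sup>+y. \<integral>\<^sup>+x. h (Complex x y) \<partial>lborel \<partial>lborel)"
proof -
  have m[measurable]: "(\<lambda>(x::real, y::real). Complex x y) \<in> borel_measurable (lborel \<Otimes>\<^sub>M lborel)"
  by (rule borel_measurable_Complex_pair)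
  have hm[measurable]: "(\<lambda>(x,y). h (Complex x y)) \<in> borel_measurable (lborel \<Otimes>\<^sub>M lborel)"
    using measurable_compose[OF m assms] by (simp add: case_prod_unfold)
  have e: "(\<integral>\<^sup>+z. h z \<partial>lborel) = (\<integral>\<^sup>+p. (\<lambda>(x,y). h (Complex x y)) p \<partial>(lborel \<Otimes>\<^sub>M lborel))"
    by (subst lborel_complex_eq_distr) (simp add: nn_integral_distr case_prod_unfold)
  show "(\<integral>\<^sup>+z. h z \<partial>lborel) = (\<integral>\<^sup>+x. \<integral>\<^sup>+y. h (Complex x y) \<partial>lborel \<partial>lborel)"
    unfolding e using lborel.nn_integral_fst[OF hm] by simp
  show "(\<integral>\<^sup>+z. h z \<partial>lborel) = (\<integral>\<^sup>+y. \<integral>\<^sup>+x. h (Complex x y) \<partial>lborel \<partial>lborel)"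
    unfolding e using lborel_pair.nn_integral_snd[OF hm] by simp
qed

text \<open>A shear translates each horizontal (or vertical) line by an amount that is constant on
  that line, so Fubini reduces the claim to translation invariance on the real line.\<close>

lemma nn_integral_shear:
  assumes [measurable]: "h \<in> borel_measurable (borel :: complex measure)"
  shows "(\<integral>\<^sup>+z. h (z + of_real (a * Im z)) \<partial>lborel) = (\<integral>\<^sup>+z. h z \<partial>lborel)"
    and "(\<integral>\<^sup>+z. h (z + \<i> * of_real (a * Re z)) \<partial>lborel) = (\<integral>\<^sup>+z. h z \<partial>lborel)"
proof -
  have hc: "(\<lambda>x. h (Complex x y)) \<in> borel_measurable borel" "(\<lambda>y. h (Complex x y)) \<in> borel_measurable borel" for x y
    by (rule measurable_compose[OF _ assms], rule borel_measurable_continuous_onI,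
        intro continuous_intros)+
  have "(\<integral>\<^sup>+z. h (z + of_real (a * Im z)) \<partial>lborel) = (\<integral>\<^sup>+y. \<integral>\<^sup>+x. h (Complex x y + of_real (a * y)) \<partial>lborel \<partial>lborel)"
    by (subst nn_integral_complex_Fubini(2)) simp_all
  also have "\<dots> = (\<integral>\<^sup>+y. \<integral>\<^sup>+x. h (Complex x y) \<partial>lborel \<partial>lborel)"
  proof (rule nn_integral_cong)
    fix y :: real
    show "(\<integral>\<^sup>+x. h (Complex x y + of_real (a * y)) \<partial>lborel) = (\<integral>\<^sup>+x. h (Complex x y) \<partial>lborel)"
    proof -
      have "Complex x y + of_real (a * y) = Complex (a * y + x) y" for x
        by (simp add: complex_eq_iff)
      then show ?thesis using nn_integral_real_affine[OF hc(1), of 1 y "a * y"] by simp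
    qed
  qed
  finally show "(\<integral>\<^sup>+z. h (z + of_real (a * Im z)) \<partial>lborel) = (\<integral>\<^sup>+z. h z \<partial>lborel)"
    by (simp add: nn_integral_complex_Fubini(2))
  have "(\<integral>\<^sup>+z. h (z + \<i> * of_real (a * Re z)) \<partial>lborel) = (\<integral>\<^sup>+x. \<integral>\<^sup>+y. h (Complex x y + \<i> * of_real (a * x)) \<partial>lborel \<partial>lborel)"
    by (subst nn_integral_complex_Fubini(1)) simp_all
  also have "\<dots> = (\<integral>\<^sup>+x. \<integral>\<^sup>+y. h (Complex x y) \<partial>lborel \<partial>lborel)"
  proof (rule nn_integral_cong)
    fix x :: real
    have "Complex x y + \<i> * of_real (a * x) = Complex x (a * x + y)" for y
      by (simp add: complex_eq_iff)
    then show "(\<integral>\<^sup>+y. h (Complex x y + \<i> * of_real (a * x)) \<partial>lborel) = (\<integral>\<^sup>+y. h (Complex x y) \<partial>lborel)"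
      using nn_integral_real_affine[OF hc(2), of 1 x "a * x"] by simp
  qed
  finally show "(\<integral>\<^sup>+z. h (z + \<i> * of_real (a * Re z)) \<partial>lborel) = (\<integral>\<^sup>+z. h z \<partial>lborel)"
    by (simp add: nn_integral_complex_Fubini(1))
qed

text \<open>A rotation is a product of three shears.\<close>

lemma nn_integral_rotate:
  assumes [measurable]: "h \<in> borel_measurable (borel :: complex measure)" and \<theta>: "- pi < \<theta>" "\<theta> < pi"
  shows "(\<integral>\<^sup>+z. h (cis \<theta> * z) \<partial>lborel) = (\<integral>\<^sup>+z. h z \<partial>lborel)"
proof -
  \<comment> \<open>Rotation by \<theta> is \<open>X\<close> after \<open>Y\<close> after
    \<open>X\<close>, with \<open>X\<close> the horizontal shear of slope -tan(\<theta>/2) and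
    \<open>Y\<close> the vertical shear of slope sin \<theta>. The half angle is why \<theta> = pi
    is excluded.\<close>
  define t where "t = tan (\<theta>/2)"
  define s where "s = sin \<theta>"
  have c0: "cos (\<theta>/2) \<noteq> 0" using \<theta> cos_gt_zero_pi[of "\<theta>/2"] by auto
  have s2: "s = 2 * sin (\<theta>/2) * cos (\<theta>/2)" using sin_double[of "\<theta>/2"] by (simp add: s_def)
  have c2: "cos \<theta> = 1 - 2 * (sin (\<theta>/2))\<^sup>2" using cos_double_sin[of "\<theta>/2"] by simp
  have ts: "cos \<theta> = 1 - t * s"
    using c0 by (simp add: t_def s2 c2 tan_def power2_eq_square)
  have "2 * t - t\<^sup>2 * s = t * (2 - t * s)" by (simp add: power2_eq_square algebra_simps)
  also have "\<dots> = t * (1 + cos \<theta>)" using ts by simp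
  also have "\<dots> = t * (2 * (cos (\<theta>/2))\<^sup>2)" using cos_double_cos[of "\<theta>/2"] by simp
  also have "\<dots> = s" using c0 by (simp add: t_def s2 tan_def power2_eq_square)
  finally have tts: "2 * t - t\<^sup>2 * s = s" .
  define X where "X = (\<lambda>z::complex. z + of_real (- t * Im z))"
  define Y where "Y = (\<lambda>z::complex. z + \<i> * of_real (s * Re z))"
  have [measurable]: "X \<in> borel_measurable borel" "Y \<in> borel_measurable borel"
    unfolding X_def Y_def by measurable
  have eq: "cis \<theta> * z = X (Y (X z))" for z
  proof -
    have "Re (X (Y (X z))) = (1 - t * s) * Re z - (2 * t - t\<^sup>2 * s) * Im z"
      by (simp add: X_def Y_def power2_eq_square algebra_simps)
    moreover have "Im (X (Y (X z))) = s * Re z + (1 - t * s) * Im z"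
      by (simp add: X_def Y_def algebra_simps)
    ultimately show ?thesis
      using ts tts by (simp add: complex_eq_iff s_def)
  qed
  have "(\<integral>\<^sup>+z. h (cis \<theta> * z) \<partial>lborel) = (\<integral>\<^sup>+z. h (X (Y (X z))) \<partial>lborel)"
    by (simp add: eq)
  also have "\<dots> = (\<integral>\<^sup>+z. h (X (Y z)) \<partial>lborel)"
    using nn_integral_shear(1)[of "\<lambda>z. h (X (Y z))" "-t"] by (simp add: X_def)
  also have "\<dots> = (\<integral>\<^sup>+z. h (X z) \<partial>lborel)"
    using nn_integral_shear(2)[of "\<lambda>z. h (X z)" "s"] by (simp add: Y_def)
  also have "\<dots> = (\<integral>\<^sup>+z. h z \<partial>lborel)"
    using nn_integral_shear(1)[of "\<lambda>z. h z" "-t"] by (simp add: X_def)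
  finally show ?thesis .
qed

lemma lborel_rotate:
  assumes "- pi < \<theta>" "\<theta> < pi"
  shows "distr lborel borel ((*) (cis \<theta>)) = (lborel :: complex measure)"
proof (rule measure_eqI)
  fix A assume "A \<in> sets (distr lborel borel ((*) (cis \<theta>)))"
  then have [measurable]: "A \<in> sets borel" by simp
  have "emeasure (distr lborel borel ((*) (cis \<theta>))) A = (\<integral>\<^sup>+z. indicator A z \<partial>distr lborel borel ((*) (cis \<theta>)))"
    by simp
  also have "\<dots> = (\<integral>\<^sup>+z. indicator A (cis \<theta> * z) \<partial>lborel)"
    by (rule nn_integral_distr) auto
  also have "\<dots> = emeasure lborel A"
    using nn_integral_rotate[OF _ assms, of "indicator A"] by simp
  finally show "emeasure (distr lborel borel ((*) (cis \<theta>))) A = emeasure lborel A" .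
qed simp

lemma set_integral_cball_rotate:
  fixes H :: "complex \<Rightarrow> real"
  assumes "- pi < \<theta>" "\<theta> < pi" and H: "continuous_on UNIV H"
  shows "(LINT z:cball 0 t|lborel. H (cis \<theta> * z)) = (LINT z:cball 0 t|lborel. H z)"
proof -
  have [measurable]: "H \<in> borel_measurable borel"
    using H by (rule borel_measurable_continuous_onI)
  have "(LINT z:cball 0 t|lborel. H z) = (LINT z:cball 0 t|distr lborel borel ((*) (cis \<theta>)). H z)"
    by (simp add: lborel_rotate[OF assms(1,2)])
  also have "\<dots> = (LINT z|lborel. indicator (cball 0 t) (cis \<theta> * z) *\<^sub>R H (cis \<theta> * z))"
    unfolding set_lebesgue_integral_def
    by (rule integral_distr) (auto intro!: borel_measurable_times borel_measurable_indicator)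
  also have "\<dots> = (LINT z:cball 0 t|lborel. H (cis \<theta> * z))"
    unfolding set_lebesgue_integral_def
    by (intro Bochner_Integration.integral_cong) (auto simp: indicator_def norm_mult)
  finally show ?thesis by simp
qed

text \<open>Writing z as |z| cis (Arg z) only shifts the angle; by 2 pi-periodicity the piece pushed
  past one end of the interval is returned at the other. So averaging a function over rotations
  produces a radial function.\<close>

lemma integral_circle_shift:
  fixes H :: "complex \<Rightarrow> real"
  assumes H: "continuous_on UNIV H"
  shows "integral {-pi..pi} (\<lambda>\<theta>. H (cis \<theta> * z)) = integral {-pi..pi} (\<lambda>\<theta>. H (cis \<theta> * of_real (cmod z)))"
proof -
  define \<alpha> where "\<alpha> = Arg z"
  define h where "h = (\<lambda>\<theta>. H (cis \<theta> * of_real (cmod z)))"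
  have z: "z = of_real (cmod z) * cis \<alpha>"
    by (simp add: \<alpha>_def rcis_cmod_Arg flip: rcis_def)
  have hc: "continuous_on A h" for A
    unfolding h_def by (intro continuous_on_compose2[OF H] continuous_intros) auto
  have hi: "h integrable_on {a..b}" for a b
    by (rule integrable_continuous_real[OF hc])
  have per: "h (\<theta> + 2 * pi) = h \<theta>" for \<theta>
    by (simp add: h_def cis_mult flip: cis_mult)
  have \<alpha>: "- pi < \<alpha>" "\<alpha> \<le> pi" using Arg_bounded[of z] by (auto simp: \<alpha>_def)
  have sh: "integral {a+c..b+c} h = integral {a..b} (\<lambda>\<theta>. h (\<theta> + c))" for a b c
    using integral_shift[OF hc, of a b c] by (simp add: o_def add.commute)
  have "integral {-pi..pi} (\<lambda>\<theta>. H (cis \<theta> * z)) = integral {-pi..pi} (\<lambda>\<theta>. h (\<theta> + \<alpha>))"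
    by (subst z) (simp add: h_def cis_mult mult_ac flip: cis_mult)
  also have "\<dots> = integral {-pi + \<alpha>..pi + \<alpha>} h"
    by (rule sh[symmetric])
  also have "\<dots> = integral {-pi..pi} h"
  proof (cases "\<alpha> \<ge> 0")
    case True
    have "integral {-pi..-pi+\<alpha>} h + integral {-pi+\<alpha>..pi} h = integral {-pi..pi} h"
      using True \<alpha> by (intro Henstock_Kurzweil_Integration.integral_combine hi) auto
    moreover have "integral {-pi+\<alpha>..pi} h + integral {pi..pi+\<alpha>} h = integral {-pi+\<alpha>..pi+\<alpha>} h"
      using True \<alpha> by (intro Henstock_Kurzweil_Integration.integral_combine hi) auto
    moreover have "integral {pi..pi+\<alpha>} h = integral {-pi..-pi+\<alpha>} h"
      using sh[of "-pi" "2*pi" "-pi+\<alpha>"] by (simp add: per add.commute)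
    ultimately show ?thesis by simp
  next
    case False
    have "integral {-pi+\<alpha>..-pi} h + integral {-pi..pi+\<alpha>} h = integral {-pi+\<alpha>..pi+\<alpha>} h"
      using False \<alpha> by (intro Henstock_Kurzweil_Integration.integral_combine hi) auto
    moreover have "integral {-pi..pi+\<alpha>} h + integral {pi+\<alpha>..pi} h = integral {-pi..pi} h"
      using False \<alpha> by (intro Henstock_Kurzweil_Integration.integral_combine hi) auto
    moreover have "integral {pi+\<alpha>..pi} h = integral {-pi+\<alpha>..-pi} h"
      using sh[of "-pi+\<alpha>" "2*pi" "-pi"] by (simp add: per add.commute)
    ultimately show ?thesis by simp
  qed
  finally show ?thesis by (simp add: h_def)
qed

lemma content_complex_cball: "t \<ge> 0 \<Longrightarrow> measure lborel (cball (0::complex) t) = pi * t\<^sup>2"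
  using content_cball[of t "0::complex"] by (simp add: unit_ball_vol_2)

lemma set_integrable_continuous_compact:
  fixes H :: "'a::euclidean_space \<Rightarrow> real"
  assumes "continuous_on UNIV H" "compact K"
  shows "set_integrable lborel K H"
  using borel_integrable_compact[of K H] assms continuous_on_subset by (auto simp: set_integrable_def)

text \<open>The disc integral is differentiated in the radius. The annulus between radii a and b has
  area pi (b^2 - a^2), and \<open>M\<close> is almost constant on a thin annulus, so the derivative
  is 2 pi s M(s); the fundamental theorem of calculus finishes.\<close>

lemma set_integral_cball_radial:
  fixes M :: "real \<Rightarrow> real"
  assumes M: "continuous_on UNIV M" and t: "0 \<le> t"
  shows "((\<lambda>s. 2 * pi * s * M s) has_integral (LINT z:cball (0::complex) t|lborel. M (cmod z))) {0..t}"
proof -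
  define G where "G = (\<lambda>t. (LINT z:cball (0::complex) t|lborel. M (cmod z)))"
  have Mc: "continuous_on UNIV (\<lambda>z::complex. M (cmod z))"
    by (intro continuous_on_compose2[OF M] continuous_intros) auto
  have fin: "emeasure lborel (cball (0::complex) y) < \<infinity>" for y
    using emeasure_bounded_finite[of "cball (0::complex) y"] by simp
  have key: "\<bar>G b - G a - m * pi * (b\<^sup>2 - a\<^sup>2)\<bar> \<le> e * pi * (b\<^sup>2 - a\<^sup>2)"
    if ab: "0 \<le> a" "a \<le> b" and e: "\<And>s. a \<le> s \<Longrightarrow> s \<le> b \<Longrightarrow> \<bar>M s - m\<bar> \<le> e" for a b m e
  proof -
    have int: "set_integrable lborel (cball 0 y) (\<lambda>z::complex. M (cmod z))" for y
      by (intro set_integrable_continuous_compact Mc) auto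
    have U: "cball (0::complex) b = cball 0 a \<union> (cball 0 b - cball 0 a)" using ab by auto
    have intD: "set_integrable lborel (cball 0 b - cball 0 a) (\<lambda>z::complex. M (cmod z))"
      by (rule set_integrable_subset[OF int[of b]]) auto
    have 1: "G b - G a = (LINT z:cball (0::complex) b - cball 0 a|lborel. M (cmod z))"
      unfolding G_def by (subst U, subst set_integral_Un) (auto intro: int intD)
    have fD: "emeasure lborel (cball (0::complex) b - cball 0 a) < \<infinity>"
      by (rule emeasure_bounded_finite) (auto intro: bounded_subset[OF bounded_cball])
    have mD: "measure lborel (cball (0::complex) b - cball 0 a) = pi * (b\<^sup>2 - a\<^sup>2)"
      using fin ab by (subst measure_Diff) (auto simp: content_complex_cball algebra_simps less_top)
    have cint: "set_integrable lborel (cball (0::complex) b - cball 0 a) (\<lambda>z. c::real)" for c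
      using fD by (simp add: set_integrable_def)
    have lc: "(LINT z:cball (0::complex) b - cball 0 a|lborel. c::real) = c * pi * (b\<^sup>2 - a\<^sup>2)" for c
      using set_integral_const[of "cball (0::complex) b - cball 0 a" lborel c] fD mD by simp
    have eD: "\<bar>M (cmod z) - m\<bar> \<le> e" if "z \<in> cball 0 b - cball 0 a" for z :: complex
      using that by (intro e) auto
    have "(LINT z:cball (0::complex) b - cball 0 a|lborel. M (cmod z)) \<le> (LINT z:cball (0::complex) b - cball 0 a|lborel. m + e)"
      by (intro set_integral_mono intD cint) (drule eD, simp add: abs_le_iff)
    moreover have "(LINT z:cball (0::complex) b - cball 0 a|lborel. M (cmod z)) \<ge> (LINT z:cball (0::complex) b - cball 0 a|lborel. m - e)"
      by (intro set_integral_mono intD cint) (drule eD, simp add: abs_le_iff)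
    ultimately show ?thesis unfolding 1 lc by (simp add: abs_le_iff algebra_simps)
  qed
  have key2: "\<bar>G y - G x - M x * pi * (y\<^sup>2 - x\<^sup>2)\<bar> \<le> e * pi * \<bar>y\<^sup>2 - x\<^sup>2\<bar>"
    if "0 \<le> x" "0 \<le> y" and e: "\<And>s. \<bar>s - x\<bar> \<le> \<bar>y - x\<bar> \<Longrightarrow> \<bar>M s - M x\<bar> \<le> e" for x y e
  proof (cases "x \<le> y")
    case True
    then have "x\<^sup>2 \<le> y\<^sup>2" using that by (simp add: power_mono)
    then show ?thesis using key[of x y "M x" e] True that by auto
  next
    case False
    then have "y\<^sup>2 \<le> x\<^sup>2" using that by (simp add: power_mono)
    moreover have "\<bar>G x - G y - M x * pi * (x\<^sup>2 - y\<^sup>2)\<bar> \<le> e * pi * (x\<^sup>2 - y\<^sup>2)"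
      using key[of y x "M x" e] False that by auto
    moreover have "G y - G x - M x * pi * (y\<^sup>2 - x\<^sup>2) = - (G x - G y - M x * pi * (x\<^sup>2 - y\<^sup>2))"
      by (simp add: algebra_simps)
    ultimately show ?thesis by simp
  qed
  have der: "(G has_vector_derivative 2 * pi * x * M x) (at x within {0..t})" if x: "x \<in> {0..t}" for x
    unfolding has_vector_derivative_def has_derivative_within_alt
  proof (intro conjI allI impI)
    show "bounded_linear (\<lambda>h. h *\<^sub>R (2 * pi * x * M x))" by (rule bounded_linear_scaleR_left)
    fix e :: real assume e: "e > 0"
    \<comment> \<open>Two errors share e equally. The oscillation of \<open>M\<close> costs e1 pi
      |y^2 - x^2|, where y + x is at most 2 t + 1 (the 1 keeps the divisor positive for t = 0).
      Replacing y^2 - x^2 by 2 x (y - x) costs |M x| pi (y - x)^2, which \<open>d2\<close>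
      controls.\<close>
    define e1 where "e1 = e / (2 * pi * (2 * t + 1))"
    have e1: "e1 > 0" using e t by (simp add: e1_def)
    have "isCont M x" using M by (simp add: continuous_on_eq_continuous_at)
    then obtain d where d: "d > 0" "\<And>s. \<bar>s - x\<bar> < d \<Longrightarrow> \<bar>M s - M x\<bar> < e1"
      using e1 unfolding continuous_at_eps_delta dist_real_def by blast
    define d2 where "d2 = min d (e / (2 * (\<bar>M x\<bar> * pi + 1)))"
    have d2: "d2 > 0" using d e by (simp add: d2_def add_nonneg_pos)
    show "\<exists>d>0. \<forall>y\<in>{0..t}. norm (y - x) < d \<longrightarrow>
             norm (G y - G x - (y - x) *\<^sub>R (2 * pi * x * M x)) \<le> e * norm (y - x)"
    proof (intro exI conjI ballI impI)
      fix y assume y: "y \<in> {0..t}" "norm (y - x) < d2"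
      have "\<bar>G y - G x - M x * pi * (y\<^sup>2 - x\<^sup>2)\<bar> \<le> e1 * pi * \<bar>y\<^sup>2 - x\<^sup>2\<bar>"
        using x y d by (intro key2) (auto simp: d2_def intro!: less_imp_le)
      also have "\<bar>y\<^sup>2 - x\<^sup>2\<bar> = \<bar>y - x\<bar> * (y + x)"
        using x y by (simp add: power2_eq_square square_diff_square_factored abs_mult mult.commute)
      also have "e1 * pi * (\<bar>y - x\<bar> * (y + x)) \<le> e1 * pi * (\<bar>y - x\<bar> * (2 * t + 1))"
        using x y e1 by (intro mult_left_mono) auto
      also have "\<dots> = e / 2 * \<bar>y - x\<bar>"
      proof -
        have "2 * t + 1 \<noteq> 0" using t by linarith
        then have "e1 * pi * (2 * t + 1) = e / 2" by (simp add: e1_def divide_simps)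
        moreover have "e1 * pi * (\<bar>y - x\<bar> * (2 * t + 1)) = (e1 * pi * (2 * t + 1)) * \<bar>y - x\<bar>" by simp
        ultimately show ?thesis by (simp only:)
      qed
      finally have 1: "\<bar>G y - G x - M x * pi * (y\<^sup>2 - x\<^sup>2)\<bar> \<le> e / 2 * \<bar>y - x\<bar>" .
      have "\<bar>M x * pi * (y - x)\<^sup>2\<bar> = (\<bar>M x\<bar> * pi * \<bar>y - x\<bar>) * \<bar>y - x\<bar>"
        by (simp add: abs_mult power2_eq_square)
      also have "\<dots> \<le> (e / 2) * \<bar>y - x\<bar>"
      proof (rule mult_right_mono)
        have pos: "\<bar>M x\<bar> * pi + 1 > 0" by (simp add: add_nonneg_pos)
        have "\<bar>M x\<bar> * pi * \<bar>y - x\<bar> \<le> (\<bar>M x\<bar> * pi + 1) * (e / (2 * (\<bar>M x\<bar> * pi + 1)))"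
          using y pos by (intro mult_mono) (auto simp: d2_def)
        moreover have "c * (e / (2 * c)) = e / 2" if "c > 0" for c using that by simp
        ultimately show "\<bar>M x\<bar> * pi * \<bar>y - x\<bar> \<le> e / 2" using pos by metis
      qed simp
      finally have 2: "\<bar>M x * pi * (y - x)\<^sup>2\<bar> \<le> e / 2 * \<bar>y - x\<bar>" .
      have "G y - G x - (y - x) *\<^sub>R (2 * pi * x * M x) = (G y - G x - M x * pi * (y\<^sup>2 - x\<^sup>2)) + M x * pi * (y - x)\<^sup>2"
        by (simp add: power2_eq_square algebra_simps)
      then show "norm (G y - G x - (y - x) *\<^sub>R (2 * pi * x * M x)) \<le> e * norm (y - x)"
        using 1 2 unfolding real_norm_def by linarith
    qed (use d2 in auto)
  qed
  have "G 0 = 0"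
    unfolding G_def set_lebesgue_integral_def
    by (rule integral_eq_zero_AE) (rule AE_I[of _ _ "{0}"], auto simp: indicator_def)
  with fundamental_theorem_of_calculus[OF t der] show ?thesis
    by (simp add: G_def)
qed

text \<open>By rotation invariance \<open>H\<close> may be replaced by its average over rotations
  without changing the disc integral. Fubini moves that average inside, where it is the radial
  function \<open>M (cmod z)\<close>, and the radial case applies.\<close>

lemma set_integral_cball_polar:
  fixes H :: "complex \<Rightarrow> real"
  assumes H: "continuous_on UNIV H" and t: "0 \<le> t"
  shows "((\<lambda>s. s * integral {-pi..pi} (\<lambda>\<theta>. H (cis \<theta> * of_real s))) has_integral
           (LINT z:cball (0::complex) t|lborel. H z)) {0..t}"
proof -
  define M where "M = (\<lambda>s. integral {-pi..pi} (\<lambda>\<theta>. H (cis \<theta> * of_real s)))"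
  have Hc: "continuous_on UNIV (\<lambda>p::complex \<times> real. H (cis (snd p) * fst p))"
    by (intro continuous_on_compose2[OF H] continuous_intros) auto
  have Mc: "continuous_on UNIV M"
  proof -
    have "continuous_on (UNIV \<times> cbox (-pi) pi) (\<lambda>(s::real, \<theta>). H (cis \<theta> * of_real s))"
      by (auto simp: case_prod_unfold intro!: continuous_on_compose2[OF H] continuous_intros)
    from integral_continuous_on_param[OF this] show ?thesis by (simp add: M_def)
  qed
  have circ: "integral {-pi..pi} (\<lambda>\<theta>. H (cis \<theta> * z)) = M (cmod z)" for z
    unfolding M_def by (rule integral_circle_shift[OF H])
  let ?F = "\<lambda>p::complex \<times> real. indicator (cball 0 t \<times> {-pi..pi}) p *\<^sub>R H (cis (snd p) * fst p)"
  have intF: "integrable (lborel \<Otimes>\<^sub>M lborel) ?F"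
    using set_integrable_continuous_compact[OF Hc compact_Times[OF compact_cball compact_Icc], of 0 t "-pi" pi]
    by (simp add: lborel_prod set_integrable_def)
  have intF': "integrable (lborel \<Otimes>\<^sub>M lborel) (\<lambda>(z, \<theta>). ?F (z, \<theta>))"
    using intF by (simp add: case_prod_unfold)
  have "2 * pi * (LINT z:cball (0::complex) t|lborel. H z)
      = (LINT \<theta>:{-pi..pi}|lborel. (LINT z:cball (0::complex) t|lborel. H z))"
    by (simp add: set_integral_const)
  also have "\<dots> = (LINT \<theta>:{-pi..pi}|lborel. (LINT z:cball (0::complex) t|lborel. H (cis \<theta> * z)))"
    unfolding set_lebesgue_integral_def[of lborel "{-pi..pi}"]
  proof (rule integral_cong_AE)
    \<comment> \<open>Rotation invariance was shown for the open interval of angles; the two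
      endpoints form a null set.\<close>
    have "AE \<theta> in lborel. \<theta> \<notin> {-pi, pi}"
      by (rule AE_not_in) (rule countable_imp_null_set_lborel, simp)
    then show "AE \<theta> in lborel. indicat_real {-pi..pi} \<theta> *\<^sub>R (LINT z:cball (0::complex) t|lborel. H z)
       = indicat_real {-pi..pi} \<theta> *\<^sub>R (LINT z:cball (0::complex) t|lborel. H (cis \<theta> * z))"
    proof eventually_elim
      case (elim \<theta>)
      show ?case
      proof (cases "\<theta> \<in> {-pi..pi}")
        case True
        then show ?thesis using elim set_integral_cball_rotate[OF _ _ H, of \<theta> t] by auto
      qed simp
    qed
    have "(\<lambda>\<theta>. LINT z|lborel. ?F (z, \<theta>)) \<in> borel_measurable lborel"
      by (rule borel_measurable_integrable[OF lborel_pair.integrable_snd[OF intF']])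
    moreover have "(LINT z|lborel. ?F (z, \<theta>)) = indicat_real {-pi..pi} \<theta> *\<^sub>R (LINT z:cball (0::complex) t|lborel. H (cis \<theta> * z))" for \<theta>
      by (auto simp: indicator_def set_lebesgue_integral_def intro!: Bochner_Integration.integral_cong)
    ultimately show "(\<lambda>\<theta>. indicat_real {-pi..pi} \<theta> *\<^sub>R (LINT z:cball (0::complex) t|lborel. H (cis \<theta> * z))) \<in> borel_measurable lborel"
      by simp
  qed simp
  also have "\<dots> = (LINT \<theta>|lborel. (LINT z|lborel. ?F (z, \<theta>)))"
    unfolding set_lebesgue_integral_def
    by (intro Bochner_Integration.integral_cong) (auto simp: indicator_def intro!: Bochner_Integration.integral_cong)
  also have "\<dots> = (LINT z|lborel. (LINT \<theta>|lborel. ?F (z, \<theta>)))"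
    by (rule lborel_pair.Fubini_integral[OF intF'])
  also have "\<dots> = (LINT z:cball (0::complex) t|lborel. M (cmod z))"
    unfolding set_lebesgue_integral_def
  proof (intro Bochner_Integration.integral_cong refl)
    fix z :: complex
    have c: "continuous_on {-pi..pi} (\<lambda>\<theta>. H (cis \<theta> * z))"
      by (intro continuous_on_compose2[OF H] continuous_intros) auto
    have "M (cmod z) = (LINT \<theta>:{-pi..pi}|lborel. H (cis \<theta> * z))"
      unfolding circ[symmetric]
      by (rule set_borel_integral_eq_integral(2)[symmetric])
         (use borel_integrable_atLeastAtMost'[OF c] in auto)
    then show "(LINT \<theta>|lborel. ?F (z, \<theta>)) = indicat_real (cball 0 t) z *\<^sub>R M (cmod z)"
      by (auto simp: indicator_def set_lebesgue_integral_def intro!: Bochner_Integration.integral_cong)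
  qed
  finally have "(LINT z:cball (0::complex) t|lborel. M (cmod z)) = 2 * pi * (LINT z:cball (0::complex) t|lborel. H z)"
    by simp
  with has_integral_mult_right[OF set_integral_cball_radial[OF Mc t], of "1 / (2*pi)"]
  show ?thesis by (simp add: M_def field_simps)
qed

section \<open>Entire curves and the Jensen formula\<close>

lemma has_derivative_cmod_power2:
  assumes "(F has_field_derivative F') (at z)"
  shows "((\<lambda>w. (cmod (F w))\<^sup>2) has_derivative (\<lambda>h. 2 * Re (F' * cnj (F z) * h))) (at z)"
proof -
  have d: "(F has_derivative (\<lambda>h. F' * h)) (at z)" using assms by (simp add: has_field_derivative_def)
  have "((\<lambda>w. F w \<bullet> F w) has_derivative (\<lambda>h. F z \<bullet> (F' * h) + (F' * h) \<bullet> F z)) (at z)"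
    by (rule has_derivative_inner[OF d d])
  moreover have "(\<lambda>h. F z \<bullet> (F' * h) + (F' * h) \<bullet> F z) = (\<lambda>h. 2 * Re (F' * cnj (F z) * h))"
    by (auto simp: fun_eq_iff inner_complex_def algebra_simps)
  ultimately show ?thesis by (simp add: power2_norm_eq_inner)
qed

lemma cmod_sum_mult_le_L2:
  fixes c v :: "'i \<Rightarrow> complex"
  shows "cmod (\<Sum>i\<in>I. c i * v i) \<le> sqrt (\<Sum>i\<in>I. (cmod (c i))\<^sup>2) * sqrt (\<Sum>i\<in>I. (cmod (v i))\<^sup>2)"
proof -
  have "cmod (\<Sum>i\<in>I. c i * v i) \<le> (\<Sum>i\<in>I. \<bar>cmod (c i)\<bar> * \<bar>cmod (v i)\<bar>)"
    by (rule order_trans[OF norm_sum]) (simp add: norm_mult)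
  also have "\<dots> \<le> L2_set (\<lambda>i. cmod (c i)) I * L2_set (\<lambda>i. cmod (v i)) I"
    by (rule L2_set_mult_ineq)
  finally show ?thesis by (simp add: L2_set_def)
qed

lemma Re_of_real_times: "Re (of_real a * w) = a * Re w" "Re (w * of_real a) = Re w * a"
  by simp_all

lemma of_real_cmod_power2: "(complex_of_real (cmod z))\<^sup>2 = z * cnj z"
  using complex_norm_square[of z] by simp

section \<open>Linear forms, connection and Fubini-Study length along a curve\<close>

locale curve =
  fixes I :: "'i set" and f :: "'i \<Rightarrow> complex \<Rightarrow> complex"
  assumes fin: "finite I"
    and hol: "\<And>i. i \<in> I \<Longrightarrow> f i holomorphic_on UNIV"
    and nz: "\<And>z. \<exists>i\<in>I. f i z \<noteq> 0"
begin

definition S :: "complex \<Rightarrow> real" where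
  "S z = (\<Sum>i\<in>I. (cmod (f i z))\<^sup>2)"

text \<open>\<open>conn\<close> is the logarithmic derivative of \<open>S\<close>.  By Lagrange's identity the length \<open>kap\<close> of the
  component of the derivative orthogonal to \<open>f\<close> is the Fubini--Study derivative.\<close>

definition conn :: "complex \<Rightarrow> complex" where
  "conn z = (\<Sum>i\<in>I. deriv (f i) z * cnj (f i z)) / of_real (S z)"

definition kap :: "complex \<Rightarrow> real" where
  "kap z = sqrt ((\<Sum>i\<in>I. (cmod (deriv (f i) z - conn z * f i z))\<^sup>2) / S z)"

definition app :: "('i \<Rightarrow> complex) \<Rightarrow> complex \<Rightarrow> complex" where
  "app c z = (\<Sum>i\<in>I. c i * f i z)"

definition nrm :: "('i \<Rightarrow> complex) \<Rightarrow> real" where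
  "nrm c = sqrt (\<Sum>i\<in>I. (cmod (c i))\<^sup>2)"

definition lognorm :: "complex \<Rightarrow> real" where
  "lognorm z = ln (S z) / 2"

lemma S_pos: "S z > 0"
proof -
  obtain i where "i \<in> I" "f i z \<noteq> 0" using nz by blast
  then show ?thesis unfolding S_def by (intro sum_pos2[OF fin]) auto
qed

lemma S_nonneg [simp]: "S z \<ge> 0" and S_nz [simp]: "S z \<noteq> 0"
  using S_pos[of z] by auto

lemma fd: "i \<in> I \<Longrightarrow> (f i has_field_derivative deriv (f i) z) (at z)"
  using hol holomorphic_derivI by blast

lemma hol_deriv: "i \<in> I \<Longrightarrow> deriv (f i) holomorphic_on UNIV"
  using hol holomorphic_deriv by blast

lemma cont_f: "i \<in> I \<Longrightarrow> continuous_on B (f i)"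
  using hol holomorphic_on_imp_continuous_on continuous_on_subset by blast

lemma cont_deriv: "i \<in> I \<Longrightarrow> continuous_on B (deriv (f i))"
  using hol_deriv holomorphic_on_imp_continuous_on continuous_on_subset by blast

lemma cont_S: "continuous_on B S"
  unfolding S_def by (intro continuous_intros cont_f)

lemma cont_conn: "continuous_on B conn"
  unfolding conn_def by (intro continuous_intros cont_f cont_deriv cont_S) auto

lemma cont_kap: "continuous_on B kap"
  unfolding kap_def by (intro continuous_intros cont_f cont_deriv cont_S cont_conn) auto

lemma cont_lognorm: "continuous_on B lognorm"
  unfolding lognorm_def using S_pos by (intro continuous_intros cont_S) auto

lemma kap_nonneg: "kap z \<ge> 0"
  unfolding kap_def by (simp add: sum_nonneg)

lemma nrm_nonneg: "nrm c \<ge> 0"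
  unfolding nrm_def by (simp add: sum_nonneg)

lemma sum_conn: "(\<Sum>i\<in>I. deriv (f i) z * cnj (f i z)) = conn z * of_real (S z)"
  by (simp add: conn_def)

text \<open>Pythagoras: \<open>conn z\<close> times f(z) is the orthogonal projection of f'(z) onto
  f(z), so the squared length of the orthogonal part is a difference of squared lengths.\<close>

lemma kap_sq: "(kap z)\<^sup>2 = (\<Sum>i\<in>I. (cmod (deriv (f i) z))\<^sup>2) / S z - (cmod (conn z))\<^sup>2"
proof -
  define a where "a = conn z"
  have "complex_of_real (\<Sum>i\<in>I. (cmod (deriv (f i) z - a * f i z))\<^sup>2)
    = (\<Sum>i\<in>I. (deriv (f i) z - a * f i z) * cnj (deriv (f i) z - a * f i z))"
    by (simp add: of_real_cmod_power2 del: complex_cnj_diff)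
  also have "\<dots> = (\<Sum>i\<in>I. deriv (f i) z * cnj (deriv (f i) z)) - a * cnj (\<Sum>i\<in>I. deriv (f i) z * cnj (f i z))
      - cnj a * (\<Sum>i\<in>I. deriv (f i) z * cnj (f i z)) + a * cnj a * (\<Sum>i\<in>I. f i z * cnj (f i z))"
    by (simp add: algebra_simps sum.distrib sum_subtractf sum_distrib_left)
  also have "(\<Sum>i\<in>I. f i z * cnj (f i z)) = of_real (S z)"
    by (simp add: S_def of_real_cmod_power2)
  also have "(\<Sum>i\<in>I. deriv (f i) z * cnj (deriv (f i) z)) = of_real (\<Sum>i\<in>I. (cmod (deriv (f i) z))\<^sup>2)"
    by (simp add: of_real_cmod_power2)
  also have "(\<Sum>i\<in>I. deriv (f i) z * cnj (f i z)) = a * of_real (S z)"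
    by (simp add: sum_conn a_def)
  also have "of_real (\<Sum>i\<in>I. (cmod (deriv (f i) z))\<^sup>2) - a * cnj (a * of_real (S z)) - cnj a * (a * of_real (S z)) + a * cnj a * of_real (S z)
    = complex_of_real ((\<Sum>i\<in>I. (cmod (deriv (f i) z))\<^sup>2) - (cmod a)\<^sup>2 * S z)"
    by (simp add: of_real_cmod_power2 algebra_simps)
  finally have "(\<Sum>i\<in>I. (cmod (deriv (f i) z - a * f i z))\<^sup>2) = (\<Sum>i\<in>I. (cmod (deriv (f i) z))\<^sup>2) - (cmod a)\<^sup>2 * S z"
    using of_real_eq_iff by blast
  moreover have "(kap z)\<^sup>2 = (\<Sum>i\<in>I. (cmod (deriv (f i) z - a * f i z))\<^sup>2) / S z"
    unfolding kap_def a_def by (intro real_sqrt_pow2) (simp add: sum_nonneg)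
  ultimately show ?thesis
    by (simp add: a_def field_simps)
qed

lemma app_hol: "app c holomorphic_on UNIV"
  unfolding app_def by (intro holomorphic_intros hol)

lemma app_fd: "(app c has_field_derivative deriv (app c) z) (at z)"
  using app_hol holomorphic_derivI by blast

lemma deriv_app: "deriv (app c) z = (\<Sum>i\<in>I. c i * deriv (f i) z)"
proof (rule DERIV_imp_deriv)
  show "(app c has_field_derivative (\<Sum>i\<in>I. c i * deriv (f i) z)) (at z)"
    unfolding app_def by (intro DERIV_sum DERIV_cmult fd)
qed

lemma app_le: "cmod (app c z) \<le> nrm c * sqrt (S z)"
  unfolding app_def nrm_def S_def by (rule cmod_sum_mult_le_L2)

text \<open>A linear form commutes with differentiation, so the left side is the form applied to the
  component of f' orthogonal to f, whose length is \<open>kap z * sqrt (S z)\<close>; Cauchy-Schwarz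
  does the rest.\<close>

lemma app_conn_le: "cmod (deriv (app c) z - conn z * app c z) \<le> nrm c * kap z * sqrt (S z)"
proof -
  have "deriv (app c) z - conn z * app c z = (\<Sum>i\<in>I. c i * (deriv (f i) z - conn z * f i z))"
    by (simp add: deriv_app app_def algebra_simps sum_subtractf sum_distrib_left)
  also have "cmod \<dots> \<le> nrm c * sqrt (\<Sum>i\<in>I. (cmod (deriv (f i) z - conn z * f i z))\<^sup>2)"
    unfolding nrm_def by (rule cmod_sum_mult_le_L2)
  also have "sqrt (\<Sum>i\<in>I. (cmod (deriv (f i) z - conn z * f i z))\<^sup>2) = kap z * sqrt (S z)"
    unfolding kap_def by (simp flip: real_sqrt_mult)
  finally show ?thesis by (simp add: mult.assoc)
qed

lemma S_has_derivative: "(S has_derivative (\<lambda>h. 2 * S z * Re (conn z * h))) (at z)"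
proof -
  have "(S has_derivative (\<lambda>h. \<Sum>i\<in>I. 2 * Re (deriv (f i) z * cnj (f i z) * h))) (at z)"
    unfolding S_def by (intro has_derivative_sum has_derivative_cmod_power2 fd)
  moreover have "(\<Sum>i\<in>I. 2 * Re (deriv (f i) z * cnj (f i z) * h)) = 2 * S z * Re (conn z * h)" for h
  proof -
    have "(\<Sum>i\<in>I. 2 * Re (deriv (f i) z * cnj (f i z) * h)) = 2 * Re ((\<Sum>i\<in>I. deriv (f i) z * cnj (f i z)) * h)"
      by (simp only: sum_distrib_left sum_distrib_right Re_sum)
    also have "\<dots> = 2 * Re (of_real (S z) * (conn z * h))"
      unfolding sum_conn by (simp only: mult_ac)
    finally show ?thesis by simp
  qed
  ultimately show ?thesis by simp
qed

lemma lognorm_has_derivative: "(lognorm has_derivative (\<lambda>h. Re (conn z * h))) (at z)"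
proof -
  have "((\<lambda>w. ln (S w)) has_derivative (\<lambda>h. (2 * S z * Re (conn z * h)) * inverse (S z))) (at z)"
    by (rule has_derivative_ln[OF S_pos S_has_derivative])
  from has_derivative_mult_right[OF this, of "1/2"]
  have "((\<lambda>w. ln (S w) / 2) has_derivative (\<lambda>h. (2 * S z * Re (conn z * h)) * inverse (S z) / 2)) (at z)"
    by simp
  moreover have "(\<lambda>h. (2 * S z * Re (conn z * h)) * inverse (S z) / 2) = (\<lambda>h. Re (conn z * h))"
    by (auto simp: fun_eq_iff field_simps)
  ultimately show ?thesis unfolding lognorm_def[abs_def] by simp
qed

text \<open>The derivative of \<open>S\<close> subtracts from c(f)' exactly the term
  \<open>conn z\<close> times c(f). Only the covariant derivative of c(f) remains, which
  \<open>app_conn_le\<close> bounds by \<open>kap\<close>.\<close>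

lemma ratio_has_derivative:
  "((\<lambda>z. (cmod (app c z))\<^sup>2 / S z) has_derivative
     (\<lambda>h. 2 * Re ((deriv (app c) z - conn z * app c z) * cnj (app c z) * h) / S z)) (at z)"
proof -
  define F where "F = (\<lambda>h. 2 * Re (deriv (app c) z * cnj (app c z) * h))"
  have 1: "((\<lambda>z. (cmod (app c z))\<^sup>2) has_derivative F) (at z)"
    unfolding F_def by (rule has_derivative_cmod_power2[OF app_fd])
  have "((\<lambda>z. (cmod (app c z))\<^sup>2 / S z) has_derivative
     (\<lambda>h. (F h * S z - (cmod (app c z))\<^sup>2 * (2 * S z * Re (conn z * h))) / (S z * S z))) (at z)"
    by (rule has_derivative_divide'[OF 1 S_has_derivative]) simp
  moreover have "(F h * S z - (cmod (app c z))\<^sup>2 * (2 * S z * Re (conn z * h))) / (S z * S z)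
     = 2 * Re ((deriv (app c) z - conn z * app c z) * cnj (app c z) * h) / S z" for h
  proof -
    have "Re ((conn z * app c z) * cnj (app c z) * h) = Re (of_real ((cmod (app c z))\<^sup>2) * (conn z * h))"
      by (simp only: complex_norm_square mult_ac)
    then have "Re ((conn z * app c z) * cnj (app c z) * h) = (cmod (app c z))\<^sup>2 * Re (conn z * h)"
      by simp
    then have E: "2 * Re ((deriv (app c) z - conn z * app c z) * cnj (app c z) * h) = F h - 2 * (cmod (app c z))\<^sup>2 * Re (conn z * h)"
      unfolding F_def left_diff_distrib by simp
    show ?thesis unfolding E using S_nz[of z] by (simp add: divide_simps) (simp add: algebra_simps)
  qed
  ultimately show ?thesis by simp
qed

text \<open>The ratio depends only on the point of projective space, so its speed is controlled by
  \<open>kap\<close>. The later statements that a form stays comparable with f, or stays dominated,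
  on a disc or a segment rest on this.\<close>

lemma ratio_lipschitz:
  assumes C: "convex C" "a \<in> C" "b \<in> C" and k: "\<And>z. z \<in> C \<Longrightarrow> kap z \<le> k"
  shows "\<bar>(cmod (app c b))\<^sup>2 / S b - (cmod (app c a))\<^sup>2 / S a\<bar> \<le> 2 * (nrm c)\<^sup>2 * k * cmod (b - a)"
proof -
  have k0: "k \<ge> 0" using k[OF C(2)] kap_nonneg[of a] by linarith
  have "norm ((cmod (app c b))\<^sup>2 / S b - (cmod (app c a))\<^sup>2 / S a) \<le> (2 * (nrm c)\<^sup>2 * k) * norm (b - a)"
  proof (rule differentiable_bound[OF C(1) _ _ C(3,2)])
    fix z assume z: "z \<in> C"
    show "((\<lambda>z. (cmod (app c z))\<^sup>2 / S z) has_derivative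
     (\<lambda>h. 2 * Re ((deriv (app c) z - conn z * app c z) * cnj (app c z) * h) / S z)) (at z within C)"
      by (rule has_derivative_at_withinI[OF ratio_has_derivative])
    show "onorm (\<lambda>h. 2 * Re ((deriv (app c) z - conn z * app c z) * cnj (app c z) * h) / S z) \<le> 2 * (nrm c)\<^sup>2 * k"
    proof (rule onorm_bound)
      fix h :: complex
      have "\<bar>Re ((deriv (app c) z - conn z * app c z) * cnj (app c z) * h)\<bar>
          \<le> cmod (deriv (app c) z - conn z * app c z) * cmod (app c z) * cmod h"
        using abs_Re_le_cmod[of "(deriv (app c) z - conn z * app c z) * cnj (app c z) * h"]
        by (simp add: norm_mult)
      also have "\<dots> \<le> (nrm c * k * sqrt (S z)) * (nrm c * sqrt (S z)) * cmod h"
      proof (intro mult_right_mono mult_mono app_le)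
        show "cmod (deriv (app c) z - conn z * app c z) \<le> nrm c * k * sqrt (S z)"
          by (rule order_trans[OF app_conn_le])
             (intro mult_right_mono mult_left_mono k z nrm_nonneg; simp)
      qed (auto simp: nrm_nonneg k0)
      also have "\<dots> = (nrm c)\<^sup>2 * k * S z * cmod h"
        by (simp add: power2_eq_square mult_ac flip: real_sqrt_mult)
      finally show "norm (2 * Re ((deriv (app c) z - conn z * app c z) * cnj (app c z) * h) / S z) \<le> 2 * (nrm c)\<^sup>2 * k * norm h"
        using S_pos[of z] by (simp add: abs_mult field_simps)
    qed (use k0 in auto)
  qed
  then show ?thesis by simp
qed

lemma lognorm_lipschitz:
  assumes C: "convex C" "a \<in> C" "b \<in> C" and k: "\<And>z. z \<in> C \<Longrightarrow> cmod (conn z) \<le> k"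
  shows "\<bar>lognorm b - lognorm a\<bar> \<le> k * cmod (b - a)"
proof -
  have "norm (lognorm b - lognorm a) \<le> k * norm (b - a)"
  proof (rule differentiable_bound[OF C(1) _ _ C(3,2)])
    fix z assume z: "z \<in> C"
    show "(lognorm has_derivative (\<lambda>h. Re (conn z * h))) (at z within C)"
      by (rule has_derivative_at_withinI[OF lognorm_has_derivative])
    show "onorm (\<lambda>h. Re (conn z * h)) \<le> k"
    proof (rule onorm_bound)
      show "0 \<le> k" using k[OF z] norm_ge_zero order_trans by blast
      fix h
      show "norm (Re (conn z * h)) \<le> k * norm h"
        using abs_Re_le_cmod[of "conn z * h"] mult_right_mono[OF k[OF z], of "cmod h"]
        by (simp add: norm_mult)
    qed
  qed
  then show ?thesis by simp
qed

text \<open>Since \<open>conn\<close> is the d/dz derivative of log S, its derivative in the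
  conjugate variable is a quarter of the Laplacian of log S, which is \<open>kap\<close> squared:
  the curvature form of the Fubini-Study metric. Of the complex-linear part \<open>a\<close> only
  continuity matters, because it cancels on integrating over circles.\<close>

lemma conn_has_derivative:
  "\<exists>a. continuous_on UNIV a \<and>
     (\<forall>z. (conn has_derivative (\<lambda>h. a z * h + of_real ((kap z)\<^sup>2) * cnj h)) (at z))"
proof -
  define X where "X = (\<lambda>z. \<Sum>i\<in>I. deriv (f i) z * cnj (f i z))"
  define X2 where "X2 = (\<lambda>z. \<Sum>i\<in>I. deriv (deriv (f i)) z * cnj (f i z))"
  define a where "a = (\<lambda>z. X2 z / of_real (S z) - (conn z)\<^sup>2)"
  have hd2: "deriv (deriv (f i)) holomorphic_on UNIV" if "i \<in> I" for i
    using hol_deriv[OF that] holomorphic_deriv by blast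
  have cX2: "continuous_on UNIV X2"
    unfolding X2_def using hd2 holomorphic_on_imp_continuous_on by (intro continuous_intros cont_f) auto
  have "continuous_on UNIV a"
    unfolding a_def by (intro continuous_intros cX2 cont_S cont_conn) auto
  moreover have "(conn has_derivative (\<lambda>h. a z * h + of_real ((kap z)\<^sup>2) * cnj h)) (at z)" for z
  proof -
    have dX: "(X has_derivative (\<lambda>h. \<Sum>i\<in>I. deriv (f i) z * cnj (deriv (f i) z * h) + (deriv (deriv (f i)) z * h) * cnj (f i z))) (at z)"
      unfolding X_def
    proof (intro has_derivative_sum has_derivative_mult)
      fix i assume i: "i \<in> I"
      show "(deriv (f i) has_derivative (\<lambda>h. deriv (deriv (f i)) z * h)) (at z)"
        using holomorphic_derivI[OF hol_deriv[OF i]] by (simp add: has_field_derivative_def)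
      have "(f i has_derivative (\<lambda>h. deriv (f i) z * h)) (at z)"
        using fd[OF i] by (simp add: has_field_derivative_def)
      then show "((\<lambda>x. cnj (f i x)) has_derivative (\<lambda>h. cnj (deriv (f i) z * h))) (at z)"
        by (rule has_derivative_cnj)
    qed
    have dS: "((\<lambda>w. complex_of_real (S w)) has_derivative (\<lambda>h. of_real (2 * S z * Re (conn z * h)))) (at z)"
      by (rule has_derivative_of_real[OF S_has_derivative])
    let ?D = "\<lambda>h. ((\<Sum>i\<in>I. deriv (f i) z * cnj (deriv (f i) z * h) + (deriv (deriv (f i)) z * h) * cnj (f i z)) * of_real (S z)
          - X z * of_real (2 * S z * Re (conn z * h))) / (of_real (S z) * of_real (S z))"
    have conn_eq: "conn = (\<lambda>z. X z / of_real (S z))"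
      by (rule ext) (simp add: conn_def X_def)
    have "((\<lambda>z. X z / of_real (S z)) has_derivative ?D) (at z)"
      by (rule has_derivative_divide'[OF dX dS]) simp
    then have D: "(conn has_derivative ?D) (at z)"
      unfolding conn_eq[symmetric] .
    have "?D h = a z * h + of_real ((kap z)\<^sup>2) * cnj h" for h
    proof -
      have 1: "(\<Sum>i\<in>I. deriv (f i) z * cnj (deriv (f i) z * h) + (deriv (deriv (f i)) z * h) * cnj (f i z))
         = cnj h * of_real (\<Sum>i\<in>I. (cmod (deriv (f i) z))\<^sup>2) + X2 z * h"
        by (simp add: X2_def of_real_cmod_power2 sum.distrib sum_distrib_left sum_distrib_right mult_ac)
      have 2: "X z = conn z * of_real (S z)" by (simp add: X_def sum_conn)
      have 3: "complex_of_real (2 * S z * Re (conn z * h)) = of_real (S z) * (conn z * h + cnj (conn z) * cnj h)"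
        using complex_add_cnj[of "conn z * h"] by (simp add: mult_ac)
      have 4: "complex_of_real (\<Sum>i\<in>I. (cmod (deriv (f i) z))\<^sup>2) = of_real (S z) * (of_real ((kap z)\<^sup>2) + conn z * cnj (conn z))"
      proof -
        have "(\<Sum>i\<in>I. (cmod (deriv (f i) z))\<^sup>2) = S z * ((kap z)\<^sup>2 + (cmod (conn z))\<^sup>2)"
          by (simp add: kap_sq)
        then show ?thesis by (simp add: of_real_cmod_power2)
      qed
      show ?thesis unfolding 1 2 3 4 a_def
        by (simp add: field_simps power2_eq_square)
    qed
    with D show ?thesis by (simp add: has_derivative_eq_rhs)
  qed
  ultimately show ?thesis by blast
qed

text \<open>This prepares Stokes' theorem on a disc. The function \<open>conn z * z\<close> is
  differentiated along the radius and along the circle; the unknown \<alpha> enters both derivatives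
  through the same real part, while \<open>kap\<close> squared enters with opposite signs.\<close>

lemma conn_polar_derivatives:
  "\<exists>\<alpha>. continuous_on UNIV \<alpha> \<and>
    (\<forall>s \<theta>. ((\<lambda>s. Re (conn (cis \<theta> * of_real s) * (cis \<theta> * of_real s))) has_real_derivative
        Re (\<alpha> (cis \<theta> * of_real s) * cis \<theta>) + s * (kap (cis \<theta> * of_real s))\<^sup>2) (at s)) \<and>
    (\<forall>s \<theta>. ((\<lambda>\<theta>. Im (conn (cis \<theta> * of_real s) * (cis \<theta> * of_real s))) has_real_derivative
        s * (Re (\<alpha> (cis \<theta> * of_real s) * cis \<theta>) - s * (kap (cis \<theta> * of_real s))\<^sup>2)) (at \<theta>))"
proof -
  obtain a where a: "continuous_on UNIV a"
    and da: "\<And>z. (conn has_derivative (\<lambda>h. a z * h + of_real ((kap z)\<^sup>2) * cnj h)) (at z)"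
    using conn_has_derivative by blast
  define \<alpha> where "\<alpha> = (\<lambda>z. conn z + z * a z)"
  have dp: "((\<lambda>z. conn z * z) has_derivative (\<lambda>h. \<alpha> z * h + z * of_real ((kap z)\<^sup>2) * cnj h)) (at z)" for z
    by (rule has_derivative_eq_rhs[OF has_derivative_mult[OF da has_derivative_ident]])
       (auto simp: \<alpha>_def algebra_simps)
  show ?thesis
  proof (intro exI[of _ \<alpha>] conjI allI)
    show "continuous_on UNIV \<alpha>" unfolding \<alpha>_def by (intro continuous_intros cont_conn a)
  next
    fix s \<theta> :: real
    let ?z = "cis \<theta> * complex_of_real s"
    have d1: "((\<lambda>s. cis \<theta> * complex_of_real s) has_derivative (\<lambda>h. cis \<theta> * of_real h)) (at s)"
      by (auto intro!: derivative_eq_intros)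
    have "((\<lambda>s. Re (conn (cis \<theta> * of_real s) * (cis \<theta> * of_real s))) has_derivative
       (\<lambda>h. Re (\<alpha> ?z * (cis \<theta> * of_real h) + ?z * of_real ((kap ?z)\<^sup>2) * cnj (cis \<theta> * of_real h)))) (at s)"
      by (rule has_derivative_Re[OF has_derivative_compose[OF d1 dp]])
    moreover have "Re (\<alpha> ?z * (cis \<theta> * of_real h) + ?z * of_real ((kap ?z)\<^sup>2) * cnj (cis \<theta> * of_real h))
        = (Re (\<alpha> ?z * cis \<theta>) + s * (kap ?z)\<^sup>2) * h" for h
    proof -
      have c: "cis \<theta> * cnj (cis \<theta>) = 1" by (simp add: cis_mult cis_cnj)
      have "\<alpha> ?z * (cis \<theta> * of_real h) + ?z * of_real ((kap ?z)\<^sup>2) * cnj (cis \<theta> * of_real h)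
        = of_real h * (\<alpha> ?z * cis \<theta>) + (cis \<theta> * cnj (cis \<theta>)) * of_real (s * (kap ?z)\<^sup>2 * h)"
        by (simp add: algebra_simps)
      also have "Re \<dots> = h * Re (\<alpha> ?z * cis \<theta>) + s * (kap ?z)\<^sup>2 * h"
        unfolding c by (simp only: mult_1 Re_complex_of_real plus_complex.sel Re_of_real_times)
      finally show ?thesis by (simp add: algebra_simps)
    qed
    ultimately show "((\<lambda>s. Re (conn (cis \<theta> * of_real s) * (cis \<theta> * of_real s))) has_real_derivative
        Re (\<alpha> (cis \<theta> * of_real s) * cis \<theta>) + s * (kap (cis \<theta> * of_real s))\<^sup>2) (at s)"
      by (simp add: has_field_derivative_def)
    have d2: "((\<lambda>\<theta>. cis \<theta> * complex_of_real s) has_derivative (\<lambda>h. \<i> * ?z * of_real h)) (at \<theta>)"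
    proof -
      have "((\<lambda>z. exp (\<i> * z)) has_field_derivative exp (\<i> * of_real \<theta>) * \<i>) (at (of_real \<theta>))"
        by (auto intro!: derivative_eq_intros)
      then have "((\<lambda>\<theta>. exp (\<i> * of_real \<theta>)) has_vector_derivative exp (\<i> * of_real \<theta>) * \<i>) (at \<theta>)"
        by (rule has_vector_derivative_real_field)
      then have "((\<lambda>\<theta>. exp (\<i> * of_real \<theta>)) has_derivative (\<lambda>h. h *\<^sub>R (exp (\<i> * of_real \<theta>) * \<i>))) (at \<theta>)"
        by (simp add: has_vector_derivative_def)
      from has_derivative_mult_left[OF this, of "of_real s"] show ?thesis
        by (simp add: cis_conv_exp scaleR_conv_of_real mult_ac)
    qed
    have "((\<lambda>\<theta>. Im (conn (cis \<theta> * of_real s) * (cis \<theta> * of_real s))) has_derivative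
       (\<lambda>h. Im (\<alpha> ?z * (\<i> * ?z * of_real h) + ?z * of_real ((kap ?z)\<^sup>2) * cnj (\<i> * ?z * of_real h)))) (at \<theta>)"
      by (rule has_derivative_Im[OF has_derivative_compose[OF d2 dp]])
    moreover have "Im (\<alpha> ?z * (\<i> * ?z * of_real h) + ?z * of_real ((kap ?z)\<^sup>2) * cnj (\<i> * ?z * of_real h))
        = (s * (Re (\<alpha> ?z * cis \<theta>) - s * (kap ?z)\<^sup>2)) * h" for h
    proof -
      have c: "cis \<theta> * cnj (cis \<theta>) = 1" by (simp add: cis_mult cis_cnj)
      have "\<alpha> ?z * (\<i> * ?z * of_real h) + ?z * of_real ((kap ?z)\<^sup>2) * cnj (\<i> * ?z * of_real h)
        = \<i> * (of_real (s * h) * (\<alpha> ?z * cis \<theta>) - (cis \<theta> * cnj (cis \<theta>)) * of_real (s * s * (kap ?z)\<^sup>2 * h))"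
        by (simp add: algebra_simps)
      also have "Im \<dots> = Re (of_real (s * h) * (\<alpha> ?z * cis \<theta>) - of_real (s * s * (kap ?z)\<^sup>2 * h))"
        unfolding c by (simp only: mult_1 Im_i_times)
      also have "\<dots> = (s * h) * Re (\<alpha> ?z * cis \<theta>) - s * s * (kap ?z)\<^sup>2 * h"
        by (simp only: minus_complex.sel Re_complex_of_real Re_of_real_times)
      finally show ?thesis by (simp add: algebra_simps)
    qed
    ultimately show "((\<lambda>\<theta>. Im (conn (cis \<theta> * of_real s) * (cis \<theta> * of_real s))) has_real_derivative
        s * (Re (\<alpha> (cis \<theta> * of_real s) * cis \<theta>) - s * (kap (cis \<theta> * of_real s))\<^sup>2)) (at \<theta>)"
      by (simp add: has_field_derivative_def)
  qed
qed

definition area :: "real \<Rightarrow> real" where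
  "area t = (LINT z:cball (0::complex) t|lborel. (kap z)\<^sup>2)"

lemma circle_conn_eq_area:
  assumes t: "0 \<le> t"
  shows "integral {-pi..pi} (\<lambda>\<theta>. Re (conn (cis \<theta> * of_real t) * (cis \<theta> * of_real t))) = 2 * area t"
proof -
  obtain \<alpha> where \<alpha>: "continuous_on UNIV \<alpha>"
    and d1: "\<And>s \<theta>. ((\<lambda>s. Re (conn (cis \<theta> * of_real s) * (cis \<theta> * of_real s))) has_real_derivative
        Re (\<alpha> (cis \<theta> * of_real s) * cis \<theta>) + s * (kap (cis \<theta> * of_real s))\<^sup>2) (at s)"
    and d2: "\<And>s \<theta>. ((\<lambda>\<theta>. Im (conn (cis \<theta> * of_real s) * (cis \<theta> * of_real s))) has_real_derivative
        s * (Re (\<alpha> (cis \<theta> * of_real s) * cis \<theta>) - s * (kap (cis \<theta> * of_real s))\<^sup>2)) (at \<theta>)"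
    using conn_polar_derivatives by blast
  define J where "J = (\<lambda>s. integral (cbox (-pi) pi) (\<lambda>\<theta>. Re (conn (cis \<theta> * of_real s) * (cis \<theta> * of_real s))))"
  define k2 where "k2 = (\<lambda>s. integral (cbox (-pi) pi) (\<lambda>\<theta>. (kap (cis \<theta> * of_real s))\<^sup>2))"
  have kc: "continuous_on UNIV (\<lambda>z. (kap z)\<^sup>2)" by (intro continuous_intros cont_kap)
  have dJ0: "(J has_real_derivative integral (cbox (-pi) pi) (\<lambda>\<theta>. Re (\<alpha> (cis \<theta> * of_real s) * cis \<theta>) + s * (kap (cis \<theta> * of_real s))\<^sup>2)) (at s)" for s
    unfolding J_def
  proof (rule leibniz_rule_field_derivative[of UNIV, simplified])
    show "((\<lambda>s. Re (conn (cis \<theta> * of_real s) * (cis \<theta> * of_real s))) has_real_derivative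
        Re (\<alpha> (cis \<theta> * of_real s) * cis \<theta>) + s * (kap (cis \<theta> * of_real s))\<^sup>2) (at s)" for s \<theta> by (rule d1)
    show "(\<lambda>\<theta>. Re (conn (cis \<theta> * of_real s) * (cis \<theta> * of_real s))) integrable_on cbox (-pi) pi" for s
      unfolding box_real by (intro integrable_continuous_real continuous_intros continuous_on_compose2[OF cont_conn[of UNIV]]) auto
    show "continuous_on (UNIV \<times> cbox (-pi) pi) (\<lambda>(s, \<theta>). Re (\<alpha> (cis \<theta> * of_real s) * cis \<theta>) + s * (kap (cis \<theta> * of_real s))\<^sup>2)"
      unfolding case_prod_unfold
      by (intro continuous_intros continuous_on_compose2[OF \<alpha>] continuous_on_compose2[OF cont_kap[of UNIV]]) auto
  qed
  have dJ: "(J has_real_derivative 2 * s * k2 s) (at s)" if s: "s > 0" for s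
  proof -
    let ?Q = "\<lambda>\<theta>. Re (\<alpha> (cis \<theta> * of_real s) * cis \<theta>)" and ?K = "\<lambda>\<theta>. (kap (cis \<theta> * of_real s))\<^sup>2"
    \<comment> \<open>The imaginary part returns to its initial value after a full turn, so its
      angular derivative has integral zero. This exchanges the unknown integral of \<open>?Q\<close>
      for that of \<open>s * ?K\<close>.\<close>
    have "((\<lambda>\<theta>. s * (?Q \<theta> - s * ?K \<theta>)) has_integral
       Im (conn (cis pi * of_real s) * (cis pi * of_real s)) - Im (conn (cis (-pi) * of_real s) * (cis (-pi) * of_real s))) {-pi..pi}"
      using d2 by (intro fundamental_theorem_of_calculus)
        (auto simp: has_real_derivative_iff_has_vector_derivative[symmetric] intro: has_field_derivative_at_within)
    then have "((\<lambda>\<theta>. s * (?Q \<theta> - s * ?K \<theta>)) has_integral 0) {-pi..pi}"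
      by (simp add: complex_eq_iff cis.ctr)
    from has_integral_mult_right[OF this, of "1/s"] have Q0: "((\<lambda>\<theta>. ?Q \<theta> - s * ?K \<theta>) has_integral 0) {-pi..pi}"
      using s by simp
    have "(?K has_integral k2 s) {-pi..pi}"
      unfolding k2_def box_real
      by (intro integrable_integral integrable_continuous_real continuous_on_compose2[OF kc] continuous_intros) auto
    from has_integral_mult_right[OF this, of "2 * s"]
    have "((\<lambda>\<theta>. 2 * s * ?K \<theta>) has_integral 2 * s * k2 s) {-pi..pi}" .
    from has_integral_add[OF Q0 this]
    have "((\<lambda>\<theta>. ?Q \<theta> + s * ?K \<theta>) has_integral 2 * s * k2 s) {-pi..pi}"
      by (simp add: algebra_simps)
    with dJ0[of s] show ?thesis by (simp add: integral_unique)
  qed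
  have "((\<lambda>s. 2 * s * k2 s) has_integral J t - J 0) {0..t}"
  proof (rule fundamental_theorem_of_calculus_interior[OF t])
    show "continuous_on {0..t} J"
      using dJ0 by (meson DERIV_continuous continuous_at_imp_continuous_on)
    show "(J has_vector_derivative 2 * s * k2 s) (at s)" if "s \<in> {0<..<t}" for s
      using dJ that by (simp add: has_real_derivative_iff_has_vector_derivative[symmetric])
  qed
  moreover have "((\<lambda>s. 2 * s * k2 s) has_integral 2 * area t) {0..t}"
    using has_integral_mult_right[OF set_integral_cball_polar[OF kc t], of 2]
    by (simp add: k2_def area_def mult.assoc)
  ultimately have "J t - J 0 = 2 * area t" by (rule has_integral_unique)
  then show ?thesis by (simp add: J_def)
qed

definition circle_mean :: "real \<Rightarrow> real" where
  "circle_mean r = integral {-pi..pi} (\<lambda>\<theta>. lognorm (cis \<theta> * of_real r)) / (2 * pi)"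

text \<open>The radial derivative of the circle integral of \<open>lognorm\<close> is the circle
  integral of Re (conn cis \<theta>); times the radius, this is twice \<open>area\<close> by
  \<open>circle_conn_eq_area\<close>. In particular the integrand with the factor 1 / t agrees away
  from 0 with a continuous function.\<close>

lemma jensen:
  assumes r: "0 \<le> r"
  shows "(LINT t:{0<..r}|lborel. (1 / t) * ((1 / pi) * area t)) = circle_mean r - lognorm 0"
proof -
  define I1 where "I1 = (\<lambda>s. integral (cbox (-pi) pi) (\<lambda>\<theta>. lognorm (cis \<theta> * of_real s)))"
  define j where "j = (\<lambda>s. integral (cbox (-pi) pi) (\<lambda>\<theta>. Re (conn (cis \<theta> * of_real s) * cis \<theta>)))"
  have jc: "continuous_on UNIV j"
  proof -
    have "continuous_on (UNIV \<times> cbox (-pi) pi) (\<lambda>(s::real, \<theta>). Re (conn (cis \<theta> * of_real s) * cis \<theta>))"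
      unfolding case_prod_unfold
      by (intro continuous_intros continuous_on_compose2[OF cont_conn[of UNIV]]) auto
    from integral_continuous_on_param[OF this] show ?thesis by (simp add: j_def)
  qed
  have dI: "(I1 has_real_derivative j s) (at s)" for s
    unfolding I1_def j_def
  proof (rule leibniz_rule_field_derivative[of UNIV, simplified])
    show "((\<lambda>s. lognorm (cis \<theta> * of_real s)) has_real_derivative Re (conn (cis \<theta> * of_real s) * cis \<theta>)) (at s)" for s \<theta>
    proof -
      have d1: "((\<lambda>s. cis \<theta> * complex_of_real s) has_derivative (\<lambda>h. cis \<theta> * of_real h)) (at s)"
        by (auto intro!: derivative_eq_intros)
      have "((\<lambda>s. lognorm (cis \<theta> * of_real s)) has_derivative (\<lambda>h. Re (conn (cis \<theta> * of_real s) * (cis \<theta> * of_real h)))) (at s)"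
        by (rule has_derivative_compose[OF d1 lognorm_has_derivative])
      moreover have "Re (conn (cis \<theta> * of_real s) * (cis \<theta> * of_real h)) = Re (conn (cis \<theta> * of_real s) * cis \<theta>) * h" for h
        by (simp only: mult.assoc[symmetric] Re_of_real_times) 
      ultimately show ?thesis by (simp add: has_field_derivative_def)
    qed
    show "(\<lambda>\<theta>. lognorm (cis \<theta> * of_real s)) integrable_on cbox (-pi) pi" for s
      unfolding box_real by (intro integrable_continuous_real continuous_intros continuous_on_compose2[OF cont_lognorm[of UNIV]]) auto
    show "continuous_on (UNIV \<times> cbox (-pi) pi) (\<lambda>(s, \<theta>). Re (conn (cis \<theta> * of_real s) * cis \<theta>))"
      unfolding case_prod_unfold
      by (intro continuous_intros continuous_on_compose2[OF cont_conn[of UNIV]]) auto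
  qed
  have "(j has_integral I1 r - I1 0) {0..r}"
    using dI by (intro fundamental_theorem_of_calculus r)
      (auto simp: has_real_derivative_iff_has_vector_derivative[symmetric] intro: has_field_derivative_at_within)
  moreover have int: "set_integrable lborel {0..r} j"
    by (intro set_integrable_continuous_compact jc) auto
  ultimately have "(LINT t:{0..r}|lborel. j t) = I1 r - I1 0"
    using set_borel_integral_eq_integral(2)[OF int] by (simp add: integral_unique)
  moreover have "(LINT t:{0..r}|lborel. j t) = 2 * pi * (LINT t:{0<..r}|lborel. (1 / t) * ((1 / pi) * area t))"
  proof -
    have "(LINT t:{0..r}|lborel. j t) = (LINT t:{0<..r}|lborel. 2 * pi * ((1 / t) * ((1 / pi) * area t)))"
      unfolding set_lebesgue_integral_def
    proof (rule integral_discrete_difference[of "{0}"])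
      fix t :: real assume "t \<notin> {0}"
      show "indicator {0..r} t *\<^sub>R j t = indicator {0<..r} t *\<^sub>R (2 * pi * ((1 / t) * ((1 / pi) * area t)))"
      proof (cases "t \<in> {0<..r}")
        case True
        have "2 * area t = integral {-pi..pi} (\<lambda>\<theta>. t * Re (conn (cis \<theta> * of_real t) * cis \<theta>))"
          using True by (subst circle_conn_eq_area[symmetric])
            (auto simp only: mult.assoc[symmetric] Re_of_real_times mult.commute[of _ t] greaterThanAtMost_iff)
        then have "2 * area t = t * j t" by (simp add: j_def)
        then show ?thesis using True by (simp add: field_simps)
      qed (use \<open>t \<notin> {0}\<close> in \<open>auto simp: indicator_def\<close>)
    qed auto
    then show ?thesis by (simp only: set_integral_mult_right)
  qed
  moreover have "I1 0 = 2 * pi * lognorm 0" by (simp add: I1_def)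
  ultimately show ?thesis
    by (simp add: circle_mean_def I1_def field_simps)
qed

end

section \<open>The Fubini-Study derivative in terms of the connection\<close>

lemma sum_lower_triangle:
  fixes g :: "nat \<Rightarrow> nat \<Rightarrow> real"
  assumes "\<And>i j. g i j = g j i" "\<And>i. g i i = 0"
  shows "2 * (\<Sum>j\<le>n. \<Sum>i<j. g i j) = (\<Sum>j\<le>n. \<Sum>i\<le>n. g i j)"
proof (induction n)
  case (Suc n)
  have "(\<Sum>j\<le>Suc n. \<Sum>i\<le>Suc n. g i j) = (\<Sum>j\<le>n. \<Sum>i\<le>n. g i j) + (\<Sum>j\<le>n. g (Suc n) j) + (\<Sum>i\<le>n. g i (Suc n))"
    by (simp add: sum.distrib assms(2))
  also have "(\<Sum>j\<le>n. g (Suc n) j) = (\<Sum>i\<le>n. g i (Suc n))"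
    by (rule sum.cong) (auto simp: assms(1))
  finally show ?case using Suc by (simp add: lessThan_Suc_atMost)
qed (simp add: assms)

lemma homogeneous_rep_curve: "homogeneous_rep n F f \<Longrightarrow> curve {..n} f"
  by (unfold_locales) (auto simp: homogeneous_rep_def)

text \<open>Lagrange's identity: summed over all ordered pairs, |d_i v_j - v_i d_j|^2 is twice |d|^2
  |v|^2 - |<d, v>|^2. Dividing by |v|^4 gives the expression in \<open>kap_sq\<close>.\<close>

lemma fs_deriv_rep_eq_kap:
  assumes "curve {..n} f"
  shows "fs_deriv_rep n f z = curve.kap {..n} f z"
proof -
  interpret curve "{..n}" f by fact
  define d where "d i = deriv (f i) z" for i
  define v where "v i = f i z" for i
  define W where "W i j = (cmod (d i * v j - v i * d j))\<^sup>2" for i j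
  define S1 where "S1 = (\<Sum>i\<le>n. (cmod (d i))\<^sup>2)"
  define X where "X = (\<Sum>i\<le>n. d i * cnj (v i))"
  have Sv: "S z = (\<Sum>i\<le>n. (cmod (v i))\<^sup>2)" by (simp add: S_def v_def)
  have "complex_of_real (\<Sum>j\<le>n. \<Sum>i\<le>n. W i j) = (\<Sum>j\<le>n. \<Sum>i\<le>n. (d i * v j - v i * d j) * cnj (d i * v j - v i * d j))"
    by (simp add: W_def of_real_cmod_power2 del: complex_cnj_diff)
  also have "\<dots> = (\<Sum>j\<le>n. \<Sum>i\<le>n. (d i * cnj (d i)) * (v j * cnj (v j))) + (\<Sum>j\<le>n. \<Sum>i\<le>n. (v i * cnj (v i)) * (d j * cnj (d j)))
      - (\<Sum>j\<le>n. \<Sum>i\<le>n. (d i * cnj (v i)) * cnj (d j * cnj (v j))) - (\<Sum>j\<le>n. \<Sum>i\<le>n. cnj (d i * cnj (v i)) * (d j * cnj (v j)))"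
    by (simp add: algebra_simps sum.distrib sum_subtractf)
  also have "(\<Sum>j\<le>n. \<Sum>i\<le>n. (d i * cnj (d i)) * (v j * cnj (v j))) = of_real S1 * of_real (S z)"
    by (simp add: S1_def Sv of_real_cmod_power2 flip: sum_distrib_left sum_distrib_right)
  also have "(\<Sum>j\<le>n. \<Sum>i\<le>n. (v i * cnj (v i)) * (d j * cnj (d j))) = of_real S1 * of_real (S z)"
    by (simp add: S1_def Sv of_real_cmod_power2 mult.commute flip: sum_distrib_left sum_distrib_right)
  also have "(\<Sum>j\<le>n. \<Sum>i\<le>n. (d i * cnj (v i)) * cnj (d j * cnj (v j))) = X * cnj X"
    unfolding X_def cnj_sum by (simp flip: sum_distrib_left sum_distrib_right)
  also have "(\<Sum>j\<le>n. \<Sum>i\<le>n. cnj (d i * cnj (v i)) * (d j * cnj (v j))) = X * cnj X"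
    unfolding X_def cnj_sum by (simp add: mult.commute flip: sum_distrib_left sum_distrib_right)
  also have "of_real S1 * of_real (S z) + of_real S1 * of_real (S z) - X * cnj X - X * cnj X
     = complex_of_real (2 * (S1 * S z - (cmod X)\<^sup>2))"
    by (simp add: of_real_cmod_power2)
  finally have "(\<Sum>j\<le>n. \<Sum>i\<le>n. W i j) = 2 * (S1 * S z - (cmod X)\<^sup>2)"
    using of_real_eq_iff by blast
  moreover have "2 * (\<Sum>j\<le>n. \<Sum>i<j. W i j) = (\<Sum>j\<le>n. \<Sum>i\<le>n. W i j)"
    by (rule sum_lower_triangle) (auto simp: W_def norm_minus_commute mult.commute)
  ultimately have num: "(\<Sum>j\<le>n. \<Sum>i<j. W i j) = S1 * S z - (cmod X)\<^sup>2" by simp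
  have rn: "rep_norm n f z ^ 4 = (S z)\<^sup>2"
  proof -
    have "rep_norm n f z ^ 4 = ((rep_norm n f z)\<^sup>2)\<^sup>2" by simp
    also have "(rep_norm n f z)\<^sup>2 = S z" by (simp add: rep_norm_def S_def sum_nonneg)
    finally show ?thesis .
  qed
  have cX: "cmod (conn z) = cmod X / S z"
    by (simp add: conn_def X_def d_def v_def norm_divide)
  have "(kap z)\<^sup>2 = (S1 * S z - (cmod X)\<^sup>2) / (S z)\<^sup>2"
    unfolding kap_sq cX by (simp add: S1_def d_def field_simps power2_eq_square)
  then have "(kap z)\<^sup>2 = (\<Sum>j\<le>n. \<Sum>i<j. W i j) / rep_norm n f z ^ 4"
    by (simp add: num rn)
  then have "kap z = sqrt ((\<Sum>j\<le>n. \<Sum>i<j. W i j) / rep_norm n f z ^ 4)"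
    using kap_nonneg[of z] by (metis real_sqrt_unique)
  then show ?thesis by (simp add: fs_deriv_rep_def W_def d_def v_def)
qed

section \<open>Curves of exponential sums with small spherical derivative\<close>

text \<open>The operator 1 - (1/m_k) d/dz kills exp(m_k z) and fixes the constant 1. Applying it for
  every k annihilates the sum, while by Cauchy's estimate each application multiplies the distance
  to 1 by at most 1 + (n + 1)/\<tau>. At the end it is 0 that lies within that distance of
  1.\<close>

lemma exp_sum_near_one:
  fixes m \<beta> :: "nat \<Rightarrow> complex"
  assumes \<tau>: "\<tau> > 0" and m: "\<And>j. j < n \<Longrightarrow> \<tau> \<le> cmod (m j)"
    and E: "\<And>z. cmod z < 1 \<Longrightarrow> cmod ((\<Sum>j<n. \<beta> j * exp (m j * z)) - 1) \<le> \<epsilon>"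
  shows "1 \<le> \<epsilon> * (1 + (real n + 1) / \<tau>) ^ n"
proof -
  \<comment> \<open>\<open>E k\<close> is the sum after the first k operators: on exp(m_j z) the
    i-th operator acts as the factor 1 - m_j / m_i.\<close>
  define E where "E = (\<lambda>k z. \<Sum>j<n. \<beta> j * (\<Prod>i<k. 1 - m j / m i) * exp (m j * z))"
  define q where "q = 1 + (n + 1) / \<tau>"
  have hol: "E k holomorphic_on B" for k B
    unfolding E_def by (intro holomorphic_intros)
  have main: "cmod (E k z - 1) \<le> \<epsilon> * q ^ k" if "k \<le> n" "cmod z < 1 - k / (n + 1)" for k z
    using that
  proof (induction k arbitrary: z)
    case 0
    then show ?case using assms(3)[of z] by (simp add: E_def)
  next
    case (Suc k)
    \<comment> \<open>Each derivative costs a radius of 1 / (n + 1), so a disc about 0 is still left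
      after n steps.\<close>
    define r where "r = 1 / real (n + 1)"
    have r: "r > 0" by (simp add: r_def)
    have inb: "cmod w < 1 - k / (n + 1)" if "cmod (z - w) \<le> r" for w
    proof -
      have "cmod w \<le> cmod z + cmod (z - w)" by (metis norm_minus_commute norm_triangle_sub)
      also have "\<dots> < 1 - Suc k / (n + 1) + r" using Suc.prems that by simp
      also have "\<dots> = 1 - k / (n + 1)" by (simp add: r_def field_simps)
      finally show ?thesis .
    qed
    have IH: "cmod (E k w - 1) \<le> \<epsilon> * q ^ k" if "cmod (z - w) \<le> r" for w
      using Suc.IH[OF _ inb[OF that]] Suc.prems by simp
    have "norm ((deriv ^^ 1) (\<lambda>w. E k w - 1) z) \<le> fact 1 * (\<epsilon> * q ^ k) / r ^ 1"
      by (rule Cauchy_inequality)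
         (auto intro!: holomorphic_intros hol r IH holomorphic_on_imp_continuous_on)
    then have d: "cmod (deriv (E k) z) \<le> (n + 1) * (\<epsilon> * q ^ k)"
      using hol[of k UNIV] by (simp add: r_def holomorphic_on_imp_differentiable_at mult_ac)
    have mk: "cmod (m k) \<ge> \<tau>" "m k \<noteq> 0" using m[of k] \<tau> Suc.prems by auto
    have "deriv (E k) z = (\<Sum>j<n. \<beta> j * (\<Prod>i<k. 1 - m j / m i) * (exp (m j * z) * m j))"
      unfolding E_def by (rule DERIV_imp_deriv) (auto intro!: derivative_eq_intros sum.cong)
    then have "E k z - deriv (E k) z / m k = (\<Sum>j<n. \<beta> j * (\<Prod>i<k. 1 - m j / m i) * exp (m j * z)
        - \<beta> j * (\<Prod>i<k. 1 - m j / m i) * (exp (m j * z) * m j) / m k)"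
      by (simp add: E_def sum_subtractf sum_divide_distrib)
    also have "\<dots> = E (Suc k) z"
      unfolding E_def by (intro sum.cong) (auto simp: algebra_simps)
    finally have "E k z - deriv (E k) z / m k = E (Suc k) z" .
    then have "E (Suc k) z - 1 = (E k z - 1) - deriv (E k) z / m k" by simp
    then have "cmod (E (Suc k) z - 1) \<le> cmod (E k z - 1) + cmod (deriv (E k) z / m k)"
      by (simp only: norm_triangle_ineq4)
    also have "cmod (E k z - 1) \<le> \<epsilon> * q ^ k" by (rule IH) (use r in simp)
    also have "cmod (deriv (E k) z / m k) \<le> (n + 1) * (\<epsilon> * q ^ k) / \<tau>"
      unfolding norm_divide using d mk \<tau> order_trans[OF norm_ge_zero d] by (intro frac_le) auto
    also have "\<epsilon> * q ^ k + (n + 1) * (\<epsilon> * q ^ k) / \<tau> = \<epsilon> * q ^ Suc k"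
      by (simp add: q_def algebra_simps)
    finally show ?case by simp
  qed
  have "E n 0 = 0"
    unfolding E_def
  proof (intro sum.neutral ballI)
    fix j assume j: "j \<in> {..<n}"
    then have "m j \<noteq> 0" using m[of j] \<tau> by auto
    then have "(\<Prod>i<n. 1 - m j / m i) = 0" using j by (intro prod_zero) auto
    then show "\<beta> j * (\<Prod>i<n. 1 - m j / m i) * exp (m j * 0) = 0" by simp
  qed
  then show ?thesis using main[of n 0] by (simp add: q_def add.commute)
qed

text \<open>Projection to the line through x and y does not increase distances and maps the
  connected set onto a set containing an interval of length |y - x|. The n discs project into n
  intervals of length 2 r, and Lebesgue measure compares the lengths.\<close>

lemma connected_cballs_diam:
  fixes l :: "nat \<Rightarrow> complex"
  assumes A: "connected A" "A \<subseteq> (\<Union>j<n. cball (l j) r)" and x: "x \<in> A" "y \<in> A" and r: "r \<ge> 0"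
  shows "cmod (y - x) \<le> 2 * n * r"
proof (cases "x = y")
  case True
  then show ?thesis using r by simp
next
  case False
  define u where "u = cnj (y - x) / of_real (cmod (y - x))"
  define p where "p = (\<lambda>w. Re ((w - x) * u))"
  have u1: "cmod u = 1" using False by (simp add: u_def norm_divide del: complex_cnj_diff)
  have lip: "\<bar>p w - p v\<bar> \<le> cmod (w - v)" for w v
  proof -
    have "p w - p v = Re ((w - v) * u)" by (simp add: p_def algebra_simps)
    then show ?thesis using abs_Re_le_cmod[of "(w - v) * u"] by (simp add: norm_mult u1)
  qed
  have px: "p x = 0" by (simp add: p_def)
  have "(y - x) * u = of_real (cmod (y - x))"
    using False complex_norm_square[of "y - x"] by (simp add: u_def power2_eq_square field_simps)
  then have py: "p y = cmod (y - x)" by (simp only: p_def Re_complex_of_real)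
  have "connected (p ` A)"
    by (rule connected_continuous_image[OF _ A(1)]) (auto simp: p_def intro!: continuous_intros)
  then have "{p x..p y} \<subseteq> p ` A"
    using x connected_contains_Icc by blast
  also have "\<dots> \<subseteq> (\<Union>j<n. {p (l j) - r..p (l j) + r})"
  proof
    fix s assume "s \<in> p ` A"
    then obtain w where w: "w \<in> A" "s = p w" by blast
    then obtain j where "j < n" "cmod (w - l j) \<le> r"
      using A(2) by (auto simp: dist_norm norm_minus_commute)
    then show "s \<in> (\<Union>j<n. {p (l j) - r..p (l j) + r})"
      using lip[of w "l j"] w by (auto simp: abs_le_iff intro!: bexI[of _ j])
  qed
  finally have sub: "{0..cmod (y - x)} \<subseteq> (\<Union>j<n. {p (l j) - r..p (l j) + r})"
    by (simp add: px py)
  have "cmod (y - x) = measure lborel {0..cmod (y - x)}" by simp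
  also have "\<dots> \<le> measure lborel (\<Union>j<n. {p (l j) - r..p (l j) + r})"
    by (rule measure_mono_fmeasurable[OF sub])
       (auto intro!: fmeasurable.finite_UN simp: fmeasurable_cbox[where 'a=real, simplified])
  also have "\<dots> \<le> (\<Sum>j<n. measure lborel {p (l j) - r..p (l j) + r})"
    by (rule measure_UNION_le) auto
  also have "\<dots> = 2 * n * r" using r by simp
  finally show ?thesis by simp
qed

section \<open>The gap: curves that cannot arise as limits\<close>

context curve
begin

lemma orthogonal_functional_aux:
  assumes e: "(\<Sum>i\<in>I. (cmod (e i))\<^sup>2) = 1" and h: "h = (\<lambda>i. f i z - app (\<lambda>i. cnj (e i)) z * e i)"
  shows "(\<Sum>i\<in>I. cnj (h i) * e i) = 0"
    and "(\<Sum>i\<in>I. cnj (h i) * f i z) = of_real (\<Sum>i\<in>I. (cmod (h i))\<^sup>2)"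
    and "(\<Sum>i\<in>I. (cmod (h i))\<^sup>2) = S z - (cmod (app (\<lambda>i. cnj (e i)) z))\<^sup>2"
proof -
  define f0 where "f0 = app (\<lambda>i. cnj (e i)) z"
  define N where "N = (\<Sum>i\<in>I. (cmod (h i))\<^sup>2)"
  have h_def: "h = (\<lambda>i. f i z - f0 * e i)" by (simp add: h f0_def)
  have ee: "(\<Sum>i\<in>I. e i * cnj (e i)) = 1"
    using arg_cong[OF e, of complex_of_real] by (simp add: of_real_cmod_power2)
  have f0': "(\<Sum>i\<in>I. f i z * cnj (e i)) = f0" by (simp add: f0_def app_def mult.commute)
  have he: "(\<Sum>i\<in>I. h i * cnj (e i)) = 0"
  proof -
    have "(\<Sum>i\<in>I. h i * cnj (e i)) = (\<Sum>i\<in>I. f i z * cnj (e i)) - f0 * (\<Sum>i\<in>I. e i * cnj (e i))"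
      by (simp add: h_def algebra_simps sum_subtractf sum_distrib_left)
    then show ?thesis by (simp add: ee f0')
  qed
  show he': "(\<Sum>i\<in>I. cnj (h i) * e i) = 0"
    using arg_cong[OF he, of cnj] by simp
  show hf: "(\<Sum>i\<in>I. cnj (h i) * f i z) = of_real (\<Sum>i\<in>I. (cmod (h i))\<^sup>2)"
    unfolding N_def[symmetric]
  proof -
    have "(\<Sum>i\<in>I. cnj (h i) * f i z) = (\<Sum>i\<in>I. cnj (h i) * h i) + f0 * (\<Sum>i\<in>I. cnj (h i) * e i)"
      by (simp add: h_def algebra_simps sum.distrib sum_subtractf sum_distrib_left)
    also have "\<dots> = (\<Sum>i\<in>I. cnj (h i) * h i) + f0 * 0"
      by (simp only: he')
    also have "\<dots> = of_real N"
      by (simp add: N_def of_real_cmod_power2 mult.commute)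
    finally show "(\<Sum>i\<in>I. cnj (h i) * f i z) = of_real N" .
  qed
  have "of_real N = (\<Sum>i\<in>I. cnj (f i z) * f i z) - cnj f0 * (\<Sum>i\<in>I. f i z * cnj (e i))"
    unfolding N_def hf[symmetric] by (simp add: h_def algebra_simps sum_subtractf sum_distrib_left)
  also have "\<dots> = (\<Sum>i\<in>I. cnj (f i z) * f i z) - cnj f0 * f0"
    by (simp only: f0')
  also have "\<dots> = of_real (S z - (cmod f0)\<^sup>2)"
    by (simp add: S_def of_real_cmod_power2 mult.commute)
  finally have NS: "N = S z - (cmod f0)\<^sup>2"
    using of_real_eq_iff by blast
  then show "(\<Sum>i\<in>I. (cmod (h i))\<^sup>2) = S z - (cmod (app (\<lambda>i. cnj (e i)) z))\<^sup>2"
    by (simp add: N_def f0_def)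
qed

lemma orthogonal_remainder:
  assumes e: "(\<Sum>i\<in>I. (cmod (e i))\<^sup>2) = 1"
  shows "(\<Sum>i\<in>I. (cmod (f i z - app (\<lambda>i. cnj (e i)) z * e i))\<^sup>2) = S z - (cmod (app (\<lambda>i. cnj (e i)) z))\<^sup>2"
proof -
  obtain h where h: "h = (\<lambda>i. f i z - app (\<lambda>i. cnj (e i)) z * e i)" by blast
  show ?thesis using orthogonal_functional_aux(3)[OF e h] by (simp add: h)
qed

text \<open>The form is the inner product with the unit vector along h, the component of f(z)
  orthogonal to e; it attains the length of h.\<close>

lemma orthogonal_functional:
  assumes e: "(\<Sum>i\<in>I. (cmod (e i))\<^sup>2) = 1"
  shows "(cmod (app (\<lambda>i. cnj (e i)) z))\<^sup>2 \<le> S z"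
    and "\<exists>c. nrm c \<le> 1 \<and> (\<Sum>i\<in>I. c i * e i) = 0 \<and>
           (cmod (app c z))\<^sup>2 = S z - (cmod (app (\<lambda>i. cnj (e i)) z))\<^sup>2"
proof -
  define f0 where "f0 = app (\<lambda>i. cnj (e i)) z"
  define h where "h = (\<lambda>i. f i z - f0 * e i)"
  define N where "N = (\<Sum>i\<in>I. (cmod (h i))\<^sup>2)"
  have h: "h = (\<lambda>i. f i z - app (\<lambda>i. cnj (e i)) z * e i)" by (simp add: h_def f0_def)
  note he' = orthogonal_functional_aux(1)[OF e h]
  note hf = orthogonal_functional_aux(2)[OF e h, folded N_def]
  note NS = orthogonal_functional_aux(3)[OF e h, folded N_def f0_def]
  have N0: "N \<ge> 0" by (simp add: N_def sum_nonneg)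
  show "(cmod (app (\<lambda>i. cnj (e i)) z))\<^sup>2 \<le> S z"
    using N0 NS by (simp add: f0_def)
  \<comment> \<open>If h = 0, division by 0 gives c = 0, which still has the required values; this
    is why the norm is only claimed to be at most 1.\<close>
  define c where "c = (\<lambda>i. cnj (h i) / of_real (sqrt N))"
  have "(\<Sum>i\<in>I. (cmod (c i))\<^sup>2) = N / N"
    using N0 by (simp add: c_def norm_divide power_divide N_def sum_divide_distrib[symmetric])
  then have "nrm c \<le> 1" by (simp add: nrm_def)
  moreover have "(\<Sum>i\<in>I. c i * e i) = 0"
    using he' by (simp add: c_def sum_divide_distrib[symmetric])
  moreover have "(cmod (app c z))\<^sup>2 = N"
  proof -
    have "app c z = of_real N / of_real (sqrt N)"
      using hf by (simp add: app_def c_def sum_divide_distrib[symmetric])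
    then show ?thesis using N0 by (simp add: norm_divide power_divide power2_eq_square)
  qed
  ultimately show "\<exists>c. nrm c \<le> 1 \<and> (\<Sum>i\<in>I. c i * e i) = 0 \<and>
           (cmod (app c z))\<^sup>2 = S z - (cmod (app (\<lambda>i. cnj (e i)) z))\<^sup>2"
    unfolding NS f0_def by blast
qed

text \<open>This is \<open>app_conn_le\<close> divided by |c(f)|.\<close>

lemma app_logderiv_conn:
  assumes "nrm c \<le> 1" "(cmod (app c z))\<^sup>2 \<ge> \<delta>\<^sup>2 * S z" "\<delta> > 0"
  shows "app c z \<noteq> 0" "cmod (deriv (app c) z / app c z - conn z) \<le> kap z / \<delta>"
proof -
  have "\<delta> * sqrt (S z) \<le> cmod (app c z)"
    using real_sqrt_le_mono[OF assms(2)] assms(3) by (simp add: real_sqrt_mult)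
  moreover have "\<delta> * sqrt (S z) > 0" using assms(3) S_pos[of z] by simp
  ultimately have c: "cmod (app c z) > 0" "\<delta> * sqrt (S z) \<le> cmod (app c z)" by auto
  then show nz: "app c z \<noteq> 0" by auto
  have "deriv (app c) z / app c z - conn z = (deriv (app c) z - conn z * app c z) / app c z"
    using nz by (simp add: field_simps)
  then have "cmod (deriv (app c) z / app c z - conn z) = cmod (deriv (app c) z - conn z * app c z) / cmod (app c z)"
    by (simp add: norm_divide)
  also have "\<dots> \<le> (kap z * sqrt (S z)) / (\<delta> * sqrt (S z))"
  proof (intro frac_le)
    have "cmod (deriv (app c) z - conn z * app c z) \<le> nrm c * (kap z * sqrt (S z))"
      using app_conn_le[of c z] by (simp add: mult.assoc)
    also have "\<dots> \<le> 1 * (kap z * sqrt (S z))"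
      by (intro mult_right_mono assms) (simp add: kap_nonneg)
    finally show "cmod (deriv (app c) z - conn z * app c z) \<le> kap z * sqrt (S z)" by simp
  qed (use c assms S_pos[of z] kap_nonneg[of z] in auto)
  also have "\<dots> = kap z / \<delta>" using S_pos[of z] by simp
  finally show "cmod (deriv (app c) z / app c z - conn z) \<le> kap z / \<delta>" .
qed

text \<open>Where f0 leaves at least a quarter of \<open>S\<close>, a form c of norm at most 1
  vanishing at e carries that quarter, and because \<open>kap\<close> is tiny, c(f) stays comparable
  with |f| on a huge disc. There c(f)'/c(f) is holomorphic and, following \<open>conn\<close>, has
  bounded oscillation, so by Cauchy it is nearly a constant a on the unit disc about z1. Then c(f)
  exp(-a z), normalised, is an exponential sum close to 1, which \<open>exp_sum_near_one\<close>
  permits only if some frequency is close to a.\<close>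

lemma exp_sum_near_exponent:
  fixes \<mu> :: "nat \<Rightarrow> complex"
  assumes \<tau>: "0 < \<tau>" "\<tau> \<le> 1" and t: "0 < t" "t \<le> 1 / 32" "t \<le> \<tau> / 3"
    "t \<le> 1 / (128 * (2 * real n + 1) * (1 + (real n + 1) / \<tau>) ^ n)"
    and kap: "\<And>z. kap z \<le> t"
    and diam: "\<And>w z. cmod (conn w - conn z) \<le> 2 * real n"
    and e: "(\<Sum>i\<in>I. (cmod (e i))\<^sup>2) = 1"
    and form: "\<And>c. (\<Sum>i\<in>I. c i * e i) = 0 \<Longrightarrow> \<exists>\<beta>. \<forall>z. app c z = (\<Sum>j<n. \<beta> j * exp (\<mu> j * z))"
    and z1: "(cmod (app (\<lambda>i. cnj (e i)) z1))\<^sup>2 \<le> 3/4 * S z1"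
  shows "\<exists>j<n. cmod (conn z1 - \<mu> j) < 2 * \<tau>"
proof (rule ccontr)
  assume "\<not> ?thesis"
  then have far: "2 * \<tau> \<le> cmod (conn z1 - \<mu> j)" if "j < n" for j using that by force
  obtain c where c: "nrm c \<le> 1" "(\<Sum>i\<in>I. c i * e i) = 0"
    "(cmod (app c z1))\<^sup>2 = S z1 - (cmod (app (\<lambda>i. cnj (e i)) z1))\<^sup>2"
    using orthogonal_functional(2)[OF e, of z1] by blast
  obtain \<beta> where \<beta>: "\<And>z. app c z = (\<Sum>j<n. \<beta> j * exp (\<mu> j * z))"
    using form[OF c(2)] by blast
  \<comment> \<open>Within this radius the ratio |c(f)|^2 / S drops by at most 1/8 from a value of
    at least 1/4; the remaining 1/8 exceeds (1/3)^2.\<close>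
  define \<rho> where "\<rho> = 1 / (16 * t)"
  have \<rho>: "\<rho> \<ge> 2" using t by (simp add: \<rho>_def field_simps)
  have n1: "(nrm c)\<^sup>2 \<le> 1" using c(1) nrm_nonneg[of c] by (simp add: power_le_one)
  have big: "(cmod (app c z))\<^sup>2 \<ge> (1/3)\<^sup>2 * S z" if z: "cmod (z - z1) \<le> \<rho>" for z
  proof -
    have "\<bar>(cmod (app c z))\<^sup>2 / S z - (cmod (app c z1))\<^sup>2 / S z1\<bar> \<le> 2 * (nrm c)\<^sup>2 * t * cmod (z - z1)"
      by (rule ratio_lipschitz[of UNIV]) (auto simp: kap)
    also have "\<dots> \<le> 2 * 1 * t * \<rho>"
      using t n1 z by (intro mult_mono) auto
    also have "\<dots> = 1/8" using t by (simp add: \<rho>_def)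
    finally have "(cmod (app c z))\<^sup>2 / S z \<ge> (cmod (app c z1))\<^sup>2 / S z1 - 1/8" by linarith
    moreover have "(cmod (app c z1))\<^sup>2 / S z1 \<ge> 1/4"
      using c(3) z1 S_pos[of z1] by (simp add: field_simps)
    ultimately have "(cmod (app c z))\<^sup>2 / S z \<ge> 1/8" by linarith
    then have "(cmod (app c z))\<^sup>2 \<ge> 1/8 * S z" using S_pos[of z] by (simp add: field_simps)
    then show ?thesis using S_pos[of z] by (simp add: power2_eq_square)
  qed
  define L where "L = (\<lambda>z. deriv (app c) z / app c z)"
  have nz: "app c z \<noteq> 0" and Lc: "cmod (L z - conn z) \<le> 3 * t" if "cmod (z - z1) \<le> \<rho>" for z
    using app_logderiv_conn[OF c(1) big[OF that]] kap[of z] by (auto simp: L_def)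
  define a where "a = L z1"
  have La: "cmod (L z - a) \<le> 2 * n + 1" if "cmod (z - z1) \<le> \<rho>" for z
  proof -
    have "L z - a = (L z - conn z) + (conn z - conn z1) - (L z1 - conn z1)" by (simp add: a_def)
    then have "cmod (L z - a) \<le> cmod (L z - conn z) + cmod (conn z - conn z1) + cmod (L z1 - conn z1)"
      by (metis norm_triangle_le_diff norm_triangle_ineq add_mono order_refl)
    also have "\<dots> \<le> 3 * t + 2 * n + 3 * t"
      using Lc[OF that] Lc[of z1] diam[of z z1] \<rho> by auto
    also have "\<dots> \<le> 2 * n + 1" using t by simp
    finally show ?thesis .
  qed
  have holL: "L holomorphic_on cball z1 \<rho>"
    unfolding L_def
    by (intro holomorphic_intros holomorphic_on_subset[OF app_hol] holomorphic_on_subset[OF holomorphic_deriv[OF app_hol]])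
       (auto simp: dist_norm norm_minus_commute intro!: nz)
  have dL: "cmod (deriv L z) \<le> 2 * (2 * n + 1) / \<rho>" if z: "cmod (z - z1) \<le> 1" for z
  proof -
    have sub: "cball z (\<rho>/2) \<subseteq> cball z1 \<rho>"
      using z \<rho> by (intro cball_subset_cball_iff[THEN iffD2]) (simp add: dist_norm)
    have "norm ((deriv ^^ 1) (\<lambda>z. L z - a) z) \<le> fact 1 * real (2 * n + 1) / (\<rho>/2) ^ 1"
    proof (rule Cauchy_inequality)
      show "(\<lambda>z. L z - a) holomorphic_on ball z (\<rho>/2)"
        using sub by (intro holomorphic_intros holomorphic_on_subset[OF holL]) auto
      show "continuous_on (cball z (\<rho>/2)) (\<lambda>z. L z - a)"
        using sub by (intro continuous_intros holomorphic_on_imp_continuous_on holomorphic_on_subset[OF holL])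
      show "cmod (L w - a) \<le> real (2 * n + 1)" if "cmod (z - w) = \<rho>/2" for w
      proof (rule La)
        have "w \<in> cball z (\<rho>/2)" using that by (simp add: dist_norm)
        then have "w \<in> cball z1 \<rho>" using sub by blast
        then show "cmod (w - z1) \<le> \<rho>" by (simp add: dist_norm norm_minus_commute)
      qed
    qed (use \<rho> in auto)
    moreover have "L field_differentiable at z"
    proof (rule holomorphic_on_imp_differentiable_at[OF holomorphic_on_subset[OF holL]])
      show "ball z1 \<rho> \<subseteq> cball z1 \<rho>" "open (ball z1 \<rho>)" by auto
      show "z \<in> ball z1 \<rho>" using z \<rho> by (simp add: dist_norm norm_minus_commute)
    qed
    ultimately show ?thesis by (simp add: mult_ac)
  qed
  \<comment> \<open>\<open>x\<close> bounds |L'| on the unit disc about z1, by Cauchy on discs of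
    radius \<rho>/2. It is a multiple of t, and the fourth bound on t says precisely that x (1 + (n
    + 1)/\<tau>)^n <= 1/4.\<close>
  define x where "x = 2 * (2 * n + 1) / \<rho>"
  have x: "x = 32 * (2 * n + 1) * t" using t by (simp add: x_def \<rho>_def)
  have Lx: "cmod (L z - a) \<le> x" if z: "cmod (z - z1) \<le> 1" for z
  proof -
    have "cmod (L z - L z1) \<le> x * cmod (z - z1)"
    proof (rule field_differentiable_bound[of "cball z1 1" L "deriv L"])
      fix w assume "w \<in> cball z1 1"
      then have w: "cmod (w - z1) \<le> 1" by (simp add: dist_norm norm_minus_commute)
      then show "cmod (deriv L w) \<le> x" unfolding x_def by (rule dL)
      show "(L has_field_derivative deriv L w) (at w within cball z1 1)"
      proof (rule has_field_derivative_at_within[OF holomorphic_derivI[OF holomorphic_on_subset[OF holL]]])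
        show "ball z1 \<rho> \<subseteq> cball z1 \<rho>" "open (ball z1 \<rho>)" by auto
        show "w \<in> ball z1 \<rho>" using w \<rho> by (simp add: dist_norm norm_minus_commute)
      qed
    qed (use z in \<open>auto simp: dist_norm norm_minus_commute\<close>)
    also have "\<dots> \<le> x * 1" using z t by (intro mult_left_mono) (auto simp: x)
    finally show ?thesis by (simp add: a_def)
  qed
  define E where "E = (\<lambda>z. app c (z1 + z) * exp (- a * z) / app c z1)"
  have dE: "(E has_field_derivative (L (z1 + z) - a) * E z) (at z)" if z: "cmod z \<le> 1" for z
  proof -
    have "app c (z1 + z) \<noteq> 0" by (rule nz) (use z \<rho> in auto)
    moreover have "((\<lambda>z. app c (z1 + z)) has_field_derivative deriv (app c) (z1 + z)) (at z)"
      using DERIV_shift[of "app c" _ z z1] app_fd[of c "z + z1"] by (simp add: add.commute)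
    moreover have "((\<lambda>z. exp (- a * z)) has_field_derivative exp (- a * z) * (- a)) (at z)"
      by (auto intro!: derivative_eq_intros)
    ultimately have "(E has_field_derivative (deriv (app c) (z1 + z) * exp (- a * z) + exp (- a * z) * (- a) * app c (z1 + z)) / app c z1) (at z)"
      unfolding E_def by (intro DERIV_cdivide DERIV_mult)
    moreover have "(deriv (app c) (z1 + z) * exp (- a * z) + exp (- a * z) * (- a) * app c (z1 + z)) / app c z1 = (L (z1 + z) - a) * E z"
      using \<open>app c (z1 + z) \<noteq> 0\<close> by (simp add: E_def L_def algebra_simps diff_divide_distrib)
    ultimately show ?thesis by simp
  qed
  have E0: "E 0 = 1" using nz[of z1] \<rho> by (simp add: E_def)
  have contE: "continuous_on (cball 0 1) E"
    by (intro continuous_at_imp_continuous_on ballI DERIV_isCont[OF dE]) simp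
  \<comment> \<open>A maximum point of |E| closes the estimate: |E - 1| <= x |E w| with x <= 1/4,
    evaluated at w itself, bounds |E w| by 2.\<close>
  obtain w where w: "w \<in> cball 0 1" "\<And>z. z \<in> cball 0 1 \<Longrightarrow> cmod (E z) \<le> cmod (E w)"
    using continuous_attains_sup[OF compact_cball _ continuous_on_norm[OF contE]] by force
  have E1: "cmod (E z - 1) \<le> x * cmod (E w)" if z: "cmod z \<le> 1" for z
  proof -
    have "cmod (E z - E 0) \<le> (x * cmod (E w)) * cmod (z - 0)"
    proof (rule field_differentiable_bound[of "cball 0 1" E "\<lambda>z. (L (z1 + z) - a) * E z"])
      fix v :: complex assume v: "v \<in> cball 0 1"
      show "cmod ((L (z1 + v) - a) * E v) \<le> x * cmod (E w)"
        unfolding norm_mult using v w(2)[OF v] Lx[of "z1 + v"] by (intro mult_mono) (auto intro: order_trans[OF norm_ge_zero])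
      show "(E has_field_derivative (L (z1 + v) - a) * E v) (at v within cball 0 1)"
        by (rule has_field_derivative_at_within[OF dE]) (use v in auto)
    qed (use z in auto)
    also have "\<dots> \<le> (x * cmod (E w)) * 1"
      using z t by (intro mult_left_mono) (auto simp: x)
    finally show ?thesis by (simp add: E0)
  qed
  define q where "q = (1 + (real n + 1) / \<tau>) ^ n"
  have q: "q \<ge> 1" using \<tau> by (simp add: q_def)
  have xq: "x * q \<le> 1 / 4"
  proof -
    have "t * (128 * (2 * real n + 1) * q) \<le> 1"
    proof -
      have "128 * (2 * real n + 1) * q > 0" using q by (intro mult_pos_pos) auto
      then show ?thesis using t(4) unfolding q_def[symmetric] by (simp only: pos_le_divide_eq)
    qed
    then show ?thesis by (simp add: x field_simps)
  qed
  have x0: "x > 0" using t by (simp add: x)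
  have x1: "x \<le> 1/4" using xq q x0 mult_left_mono[of 1 q x] by linarith
  have "cmod (E w) \<le> 1 + cmod (E w - 1)"
    using norm_triangle_ineq[of 1 "E w - 1"] by simp
  also have "\<dots> \<le> 1 + x * cmod (E w)" using E1[of w] w(1) by simp
  also have "\<dots> \<le> 1 + 1/4 * cmod (E w)" using x1 by (intro add_mono mult_right_mono) auto
  finally have Ew: "cmod (E w) \<le> 2" by simp
  have E2: "cmod (E z - 1) \<le> 2 * x" if "cmod z < 1" for z
    using order_trans[OF E1[of z] mult_left_mono[OF Ew, of x]] that x0 by (simp add: mult.commute)
  \<comment> \<open>By \<open>xq\<close> the right side is at most 1/2, which is the
    contradiction.\<close>
  have "1 \<le> (2 * x) * (1 + (real n + 1) / \<tau>) ^ n"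
  proof (rule exp_sum_near_one[OF \<tau>(1)])
    fix j assume j: "j < n"
    have "2 * \<tau> \<le> cmod (conn z1 - \<mu> j)" by (rule far[OF j])
    also have "\<dots> \<le> cmod (\<mu> j - a) + cmod (L z1 - conn z1)"
      using norm_triangle_ineq4[of "a - \<mu> j" "L z1 - conn z1"] by (simp add: a_def norm_minus_commute)
    finally show "\<tau> \<le> cmod (\<mu> j - a)" using Lc[of z1] \<rho> t by simp
  next
    fix z :: complex assume z: "cmod z < 1"
    have "E z = (\<Sum>j<n. (\<beta> j * exp (\<mu> j * z1) / app c z1) * exp ((\<mu> j - a) * z))"
      unfolding E_def \<beta>[of "z1 + z"] sum_distrib_right sum_divide_distrib
      by (intro sum.cong refl) (simp add: exp_add exp_diff exp_minus algebra_simps divide_inverse)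
    then show "cmod ((\<Sum>j<n. (\<beta> j * exp (\<mu> j * z1) / app c z1) * exp ((\<mu> j - a) * z)) - 1) \<le> 2 * x"
      using E2[OF z] by simp
  qed
  then show False using xq by (simp add: q_def[symmetric])
qed

text \<open>On the domain \<Omega> where f0 dominates, A0 = f0'/f0 is holomorphic and within 2 t of
  \<open>conn\<close>; off \<Omega>, \<open>conn\<close> is within 2 \<tau> of a frequency. So the
  product of the relevant A0 - \<mu>_j is bounded on \<Omega> and tiny on its boundary, while
  \<open>far0\<close> keeps it at least 2^(-n) at 0, which lies in \<Omega>. The point x0 gives a
  disc in the complement of \<Omega>, and with it a barrier for the unbounded domain.\<close>

lemma brody_gap_aux:
  fixes \<mu> :: "nat \<Rightarrow> complex" and \<tau> t :: real
  assumes \<tau>: "0 < \<tau>" "\<tau> \<le> 1 / 2" "3 * \<tau> * real (4 * n + 2) ^ n < (1/2) ^ n"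
    and t: "0 < t" "t \<le> 1 / 32" "t \<le> \<tau> / 3"
    "t \<le> 1 / (128 * (2 * real n + 1) * (1 + (real n + 1) / \<tau>) ^ n)"
    and kap: "\<And>z. kap z \<le> t"
    and e: "(\<Sum>i\<in>I. (cmod (e i))\<^sup>2) = 1"
    and form: "\<And>c. (\<Sum>i\<in>I. c i * e i) = 0 \<Longrightarrow> \<exists>\<beta>. \<forall>z. app c z = (\<Sum>j<n. \<beta> j * exp (\<mu> j * z))"
    and near: "\<And>z. \<exists>j<n. cmod (conn z - \<mu> j) \<le> 1"
    and far0: "\<And>j. j < n \<Longrightarrow> 1 \<le> cmod (conn 0 - \<mu> j)"
    and x0: "(cmod (app (\<lambda>i. cnj (e i)) x0))\<^sup>2 \<le> S x0 / 2"
  shows False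
proof -
  define g where "g = app (\<lambda>i. cnj (e i))"
  define \<Omega> where "\<Omega> = {z. 3/4 * S z < (cmod (g z))\<^sup>2}"
  have diam: "cmod (conn w - conn z) \<le> 2 * real n" for w z
  proof -
    have "cmod (conn w - conn z) \<le> 2 * real n * 1"
    proof (rule connected_cballs_diam)
      show "connected (range conn)"
        by (rule connected_continuous_image[OF cont_conn]) auto
      show "range conn \<subseteq> (\<Union>j<n. cball (\<mu> j) 1)"
        using near by (force simp: dist_norm norm_minus_commute)
    qed auto
    then show ?thesis by simp
  qed
  have pt: "\<exists>j<n. cmod (conn z - \<mu> j) < 2 * \<tau>" if "z \<notin> \<Omega>" for z
    by (rule exp_sum_near_exponent[OF \<tau>(1) _ t kap diam e form])
       (use that \<tau> in \<open>auto simp: \<Omega>_def g_def\<close>)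
  have cg: "continuous_on UNIV g"
    unfolding g_def by (rule holomorphic_on_imp_continuous_on[OF app_hol])
  have op: "open \<Omega>"
    unfolding \<Omega>_def by (intro open_Collect_less continuous_intros cont_S cg)
  have cl: "closure \<Omega> \<subseteq> {z. 3/4 * S z \<le> (cmod (g z))\<^sup>2}"
    by (rule closure_minimal) (auto simp: \<Omega>_def intro!: closed_Collect_le continuous_intros cont_S cg)
  have in0: "0 \<in> \<Omega>"
  proof (rule ccontr)
    assume "0 \<notin> \<Omega>"
    then obtain j where "j < n" "cmod (conn 0 - \<mu> j) < 2 * \<tau>" using pt by blast
    then show False using far0[of j] \<tau>(2) by simp
  qed
  have ng: "nrm (\<lambda>i. cnj (e i)) = 1" by (simp add: nrm_def e)
  define A0 where "A0 = (\<lambda>z. deriv g z / g z)"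
  have gnz: "g z \<noteq> 0" and A0: "cmod (A0 z - conn z) \<le> 2 * t" if "z \<in> closure \<Omega>" for z
  proof -
    have "(1/2)\<^sup>2 * S z \<le> (cmod (g z))\<^sup>2"
      using subsetD[OF cl that] S_pos[of z] by (simp add: power2_eq_square)
    note * = app_logderiv_conn[of "\<lambda>i. cnj (e i)" "1/2" z, folded g_def, OF _ this]
    show "g z \<noteq> 0" using * ng by simp
    show "cmod (A0 z - conn z) \<le> 2 * t" using * ng kap[of z] by (simp add: A0_def)
  qed
  \<comment> \<open>Frequencies farther than 2 n + 1 from \<open>conn 0\<close> are never
    approached, since the range of \<open>conn\<close> has diameter at most 2 n. Without them every
    factor of \<open>q\<close> is at most 4 n + 2, whatever the \<mu>_j are.\<close>
  define J where "J = {j. j < n \<and> cmod (conn 0 - \<mu> j) \<le> 2 * n + 1}"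
  have J: "finite J" "card J \<le> n"
    using card_mono[of "{..<n}" J] by (auto simp: J_def)
  define q where "q = (\<lambda>z. \<Prod>j\<in>J. A0 z - \<mu> j)"
  define Q where "Q = real (4 * n + 2) ^ n"
  define \<epsilon> where "\<epsilon> = 3 * \<tau> * Q"
  have Q1: "Q \<ge> 1" by (simp add: Q_def)
  have fac: "cmod (A0 z - \<mu> j) \<le> 4 * n + 2" if "z \<in> closure \<Omega>" "j \<in> J" for z j
  proof -
    have "A0 z - \<mu> j = (A0 z - conn z) + (conn z - conn 0) + (conn 0 - \<mu> j)" by simp
    also have "cmod \<dots> \<le> cmod (A0 z - conn z) + cmod (conn z - conn 0) + cmod (conn 0 - \<mu> j)"
      by (intro order_trans[OF norm_triangle_ineq] add_mono order_refl)
    also have "\<dots> \<le> 2 * t + 2 * n + (2 * n + 1)"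
      using A0[OF that(1)] diam[of z 0] that(2) by (auto simp: J_def)
    finally show ?thesis using t by simp
  qed
  have qQ: "cmod (q z) \<le> Q" if "z \<in> closure \<Omega>" for z
  proof -
    have "cmod (q z) \<le> (\<Prod>j\<in>J. real (4 * n + 2))"
      unfolding q_def prod_norm[symmetric] using fac[OF that] by (intro prod_mono) auto
    also have "\<dots> \<le> Q" unfolding Q_def prod_constant by (rule power_increasing[OF J(2)]) simp
    finally show ?thesis .
  qed
  have qe: "cmod (q z) \<le> \<epsilon>" if z: "z \<in> closure \<Omega>" "z \<notin> \<Omega>" for z
  proof -
    obtain k where k: "k < n" "cmod (conn z - \<mu> k) < 2 * \<tau>" using pt[OF z(2)] by blast
    have "cmod (conn 0 - \<mu> k) \<le> cmod (conn 0 - conn z) + cmod (conn z - \<mu> k)"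
      by (metis norm_triangle_ineq diff_add_cancel add_diff_eq)
    also have "\<dots> \<le> 2 * n + 1" using diam[of 0 z] k \<tau>(2) by simp
    finally have kJ: "k \<in> J" using k by (simp add: J_def)
    have "cmod (A0 z - \<mu> k) \<le> cmod (A0 z - conn z) + cmod (conn z - \<mu> k)"
      by (metis norm_triangle_ineq diff_add_cancel add_diff_eq)
    also have "\<dots> \<le> 3 * \<tau>" using A0[OF z(1)] k t by simp
    finally have k3: "cmod (A0 z - \<mu> k) \<le> 3 * \<tau>" .
    have "cmod (q z) = cmod (A0 z - \<mu> k) * (\<Prod>j\<in>J - {k}. cmod (A0 z - \<mu> j))"
      unfolding q_def prod_norm[symmetric] by (rule prod.remove[OF J(1) kJ])
    also have "\<dots> \<le> (3 * \<tau>) * (\<Prod>j\<in>J - {k}. real (4 * n + 2))"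
      using fac[OF z(1)] k3 \<tau> by (intro mult_mono prod_mono prod_nonneg) auto
    also have "\<dots> \<le> (3 * \<tau>) * Q"
    proof (rule mult_left_mono)
      have "card (J - {k}) \<le> n" using J card_mono[of J "J - {k}"] by auto
      then show "(\<Prod>j\<in>J - {k}. real (4 * n + 2)) \<le> Q"
        unfolding Q_def prod_constant by (rule power_increasing) simp
    qed (use \<tau> in simp)
    finally show ?thesis by (simp add: \<epsilon>_def)
  qed
  have q0: "cmod (q 0) > \<epsilon>"
  proof -
    have "(1/2) ^ n \<le> (1/2::real) ^ card J" by (rule power_decreasing[OF J(2)]) auto
    also have "\<dots> = (\<Prod>j\<in>J. 1/2)" by simp
    also have "\<dots> \<le> cmod (q 0)"
      unfolding q_def prod_norm[symmetric]
    proof (rule prod_mono)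
      fix j assume j: "j \<in> J"
      have "1 \<le> cmod (conn 0 - \<mu> j)" using far0 j by (auto simp: J_def)
      also have "\<dots> \<le> cmod (A0 0 - \<mu> j) + cmod (A0 0 - conn 0)"
        using norm_triangle_ineq4[of "A0 0 - \<mu> j" "A0 0 - conn 0"] by simp
      finally show "0 \<le> (1/2::real) \<and> 1/2 \<le> cmod (A0 0 - \<mu> j)"
        using A0[of 0] in0 closure_subset[of \<Omega>] t by auto
    qed
    finally show ?thesis using \<tau>(3) by (simp add: \<epsilon>_def Q_def)
  qed
  have \<epsilon>0: "\<epsilon> > 0" using \<tau> Q1 by (simp add: \<epsilon>_def)
  \<comment> \<open>Within this distance of x0 the ratio |g|^2 / S rises by at most 1/4, from at
    most 1/2 to at most 3/4, so the disc misses \<Omega>.\<close>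
  define c where "c = 1 / (8 * t)"
  have c0: "c > 0" using t by (simp add: c_def)
  have avoid: "z \<notin> \<Omega>" if "cmod (z - x0) \<le> c" for z
  proof -
    have "\<bar>(cmod (g z))\<^sup>2 / S z - (cmod (g x0))\<^sup>2 / S x0\<bar> \<le> 2 * (nrm (\<lambda>i. cnj (e i)))\<^sup>2 * t * cmod (z - x0)"
      unfolding g_def by (rule ratio_lipschitz[of UNIV]) (auto simp: kap)
    also have "\<dots> \<le> 2 * 1 * t * c" unfolding ng using t that by (intro mult_mono) auto
    also have "\<dots> = 1/4" using t by (simp add: c_def)
    finally have "(cmod (g z))\<^sup>2 / S z \<le> (cmod (g x0))\<^sup>2 / S x0 + 1/4" by linarith
    moreover have "(cmod (g x0))\<^sup>2 / S x0 \<le> 1/2" using x0 S_pos[of x0] by (simp add: g_def field_simps)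
    ultimately have "(cmod (g z))\<^sup>2 / S z \<le> 3/4" by linarith
    then show ?thesis using S_pos[of z] by (simp add: \<Omega>_def field_simps)
  qed
  have cldist: "c \<le> cmod (z - x0)" if "z \<in> closure \<Omega>" for z
  proof -
    have "closure \<Omega> \<subseteq> {z. c \<le> cmod (z - x0)}"
      by (rule closure_minimal) (use avoid in \<open>force intro!: closed_Collect_le continuous_intros\<close>)+
    then show ?thesis using that by blast
  qed
  have holq: "q holomorphic_on \<Omega>" and contq: "continuous_on (closure \<Omega>) q"
  proof -
    have hg: "g holomorphic_on B" "deriv g holomorphic_on B" for B
      unfolding g_def by (auto intro: holomorphic_on_subset[OF app_hol] holomorphic_on_subset[OF holomorphic_deriv[OF app_hol]])
    show "q holomorphic_on \<Omega>"
      unfolding q_def A0_def by (intro holomorphic_intros hg gnz subsetD[OF closure_subset])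
    show "continuous_on (closure \<Omega>) q"
      unfolding q_def A0_def
      by (intro continuous_on_prod continuous_on_diff continuous_on_divide continuous_on_const
          holomorphic_on_imp_continuous_on hg ballI gnz)
  qed
  have x00: "cmod x0 \<ge> c" using cldist[of 0] in0 closure_subset by auto
  have bound: "cmod (q 0) ^ M \<le> \<epsilon> ^ M * (cmod x0 / c)" for M :: nat
  proof -
    \<comment> \<open>Large enough for the factor c / X to absorb (Q / \<epsilon>)^M on the part of
      the outer circle that lies in \<Omega>.\<close>
    define X where "X = cmod x0 + 1 + c * (Q / \<epsilon>) ^ M"
    have cX: "0 \<le> c * (Q / \<epsilon>) ^ M" using c0 Q1 \<epsilon>0 by simp
    have X: "X > cmod x0" "X > 0" using cX norm_ge_zero[of x0] unfolding X_def by linarith+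
    \<comment> \<open>Phragmen--Lindelof: \<open>c / (z - x0)\<close> decays at infinity and is harmless after taking \<open>M\<close>-th roots.\<close>
    define w where "w = (\<lambda>z. q z ^ M * (of_real c / (z - x0)))"
    have "cmod (w 0) \<le> \<epsilon> ^ M"
    proof (rule maximum_modulus_frontier[of w "\<Omega> \<inter> ball x0 X"])
      have nx: "z - x0 \<noteq> 0" if "z \<in> closure \<Omega>" for z using cldist[OF that] c0 by auto
      show "w holomorphic_on interior (\<Omega> \<inter> ball x0 X)"
      proof (rule holomorphic_on_subset)
        show "w holomorphic_on \<Omega>"
          unfolding w_def by (intro holomorphic_intros holq nx subsetD[OF closure_subset])
      qed (use interior_subset in blast)
      show "continuous_on (closure (\<Omega> \<inter> ball x0 X)) w"
      proof (rule continuous_on_subset)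
        show "continuous_on (closure \<Omega>) w"
          unfolding w_def by (intro continuous_intros contq ballI nx)
      qed (simp add: closure_mono)
      show "bounded (\<Omega> \<inter> ball x0 X)" by (rule bounded_subset[OF bounded_ball]) auto
      show "0 \<in> \<Omega> \<inter> ball x0 X" using in0 X by simp
      fix z assume z: "z \<in> frontier (\<Omega> \<inter> ball x0 X)"
      have zc: "z \<in> closure \<Omega>" using z closure_mono[of "\<Omega> \<inter> ball x0 X" \<Omega>] by (auto simp: frontier_def)
      have zn: "z \<notin> \<Omega> \<inter> ball x0 X" using z op by (simp add: frontier_def interior_open open_Int)
      show "cmod (w z) \<le> \<epsilon> ^ M"
      proof (cases "z \<in> \<Omega>")
        case False
        have "cmod (w z) = cmod (q z) ^ M * (c / cmod (z - x0))"
          using c0 by (simp add: w_def norm_mult norm_power norm_divide)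
        also have "\<dots> \<le> \<epsilon> ^ M * 1"
          using qe[OF zc False] cldist[OF zc] c0 \<epsilon>0 by (intro mult_mono power_mono) (auto simp: divide_le_eq)
        finally show ?thesis by simp
      next
        case True
        then have zX: "cmod (z - x0) \<ge> X" using zn by (auto simp: dist_norm norm_minus_commute)
        have "cmod (w z) = cmod (q z) ^ M * (c / cmod (z - x0))"
          using c0 by (simp add: w_def norm_mult norm_power norm_divide)
        also have "\<dots> \<le> Q ^ M * (c / X)"
          using qQ[OF zc] zX X c0 Q1 by (intro mult_mono power_mono divide_left_mono) (auto intro!: mult_pos_pos)
        also have "\<dots> \<le> \<epsilon> ^ M"
        proof -
          have "c * (Q / \<epsilon>) ^ M \<le> X" by (simp add: X_def add_nonneg_nonneg)
          then have "c * Q ^ M \<le> X * \<epsilon> ^ M" using \<epsilon>0 by (simp add: power_divide field_simps)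
          then show ?thesis using X by (simp add: field_simps)
        qed
        finally show ?thesis .
      qed
    qed
    moreover have "cmod (w 0) = cmod (q 0) ^ M * (c / cmod x0)"
      using c0 by (simp add: w_def norm_mult norm_power norm_divide)
    moreover have "cmod x0 > 0" using c0 x00 by linarith
    ultimately show ?thesis using c0 by (simp add: field_simps)
  qed
  obtain M :: nat where M: "cmod x0 / c < (cmod (q 0) / \<epsilon>) ^ M"
    using real_arch_pow[of "cmod (q 0) / \<epsilon>" "cmod x0 / c"] q0 \<epsilon>0 by auto
  have "(cmod (q 0) / \<epsilon>) ^ M \<le> cmod x0 / c"
    using bound[of M] \<epsilon>0 by (simp add: power_divide divide_le_eq mult.commute)
  then show False using M by simp
qed

end

text \<open>\<open>t\<close> is fixed before the curve, the vector e and the frequencies are given;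
  this uniformity is what frees the final constant from the hyperplanes. The two conditions on the
  distance from \<open>conn\<close> to the frequencies describe an extremal limit: the distance is
  at most 1 everywhere and equals 1 at the origin.\<close>

theorem brody_gap:
  fixes n :: nat
  obtains t :: real where "t > 0"
    "\<And>(I :: 'i set) f e \<mu> x0. \<lbrakk>curve I f; \<And>z. curve.kap I f z \<le> t;
       (\<Sum>i\<in>I. (cmod (e i))\<^sup>2) = 1;
       \<And>c. (\<Sum>i\<in>I. c i * e i) = 0 \<Longrightarrow> \<exists>\<beta>. \<forall>z. curve.app I f c z = (\<Sum>j<n. \<beta> j * exp (\<mu> j * z));
       \<And>z. \<exists>j<n. cmod (curve.conn I f z - \<mu> j) \<le> 1;
       \<And>j. j < n \<Longrightarrow> 1 \<le> cmod (curve.conn I f 0 - \<mu> j);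
       (cmod (curve.app I f (\<lambda>i. cnj (e i)) x0))\<^sup>2 \<le> curve.S I f x0 / 2\<rbrakk> \<Longrightarrow> False"
proof -
  define Q where "Q = real (4 * n + 2) ^ n * (2::real) ^ n"
  have Q: "Q \<ge> 1" unfolding Q_def by (intro mult_ge1_I) auto
  \<comment> \<open>With this choice the boundary value 3 \<tau> (4 n + 2)^n is half of 2^(-n), the
    lower bound at the origin.\<close>
  define \<tau> where "\<tau> = 1 / (6 * Q)"
  have \<tau>: "0 < \<tau>" "\<tau> \<le> 1/2" using Q by (auto simp: \<tau>_def field_simps)
  have \<tau>3: "3 * \<tau> * real (4 * n + 2) ^ n < (1/2) ^ n"
  proof -
    have "3 * \<tau> * Q < 1" using Q by (simp add: \<tau>_def)
    then show ?thesis by (simp add: Q_def power_one_over field_simps)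
  qed
  define t where "t = min (min (1/32) (\<tau> / 3)) (1 / (128 * (2 * real n + 1) * (1 + (real n + 1) / \<tau>) ^ n))"
  have "(1 + (real n + 1) / \<tau>) ^ n > 0" using \<tau> by (simp add: add_pos_nonneg)
  then have t: "0 < t" using \<tau> by (simp add: t_def)
  have t': "t \<le> 1 / 32" "t \<le> \<tau> / 3" "t \<le> 1 / (128 * (2 * real n + 1) * (1 + (real n + 1) / \<tau>) ^ n)"
    by (auto simp: t_def)
  show thesis
    by (rule that[OF t]) (rule curve.brody_gap_aux[OF _ \<tau> \<tau>3 t t'])
qed

section \<open>Curves omitting hyperplanes\<close>

text \<open>The Cayley transform (G - G(a)) / (G + cnj (G a)) takes values in the unit disc and
  vanishes at a. The Schwarz lemma bounds its derivative at the centre, and its modulus by 1/2 on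
  the disc of half the radius; the latter is Harnack's inequality with the constant (1 - 1/2) / (1 +
  1/2) = 1/3.\<close>

lemma positive_Re_Schwarz:
  assumes hol: "G holomorphic_on ball a R" and R: "R > 0" and pos: "\<And>z. z \<in> ball a R \<Longrightarrow> Re (G z) > 0"
  shows "cmod (deriv G a) \<le> 2 * Re (G a) / R"
    and "\<And>z. cmod (z - a) \<le> R / 2 \<Longrightarrow> Re (G z) \<ge> Re (G a) / 3"
proof -
  define x where "x = Re (G a)"
  have x: "x > 0" using pos[of a] R by (simp add: x_def)
  define W where "W = (\<lambda>\<zeta>. (G (a + of_real R * \<zeta>) - G a) / (G (a + of_real R * \<zeta>) + cnj (G a)))"
  have inb: "a + of_real R * \<zeta> \<in> ball a R" if "cmod \<zeta> < 1" for \<zeta>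
    using that R by (simp add: dist_norm norm_mult)
  have den: "G z + cnj (G a) \<noteq> 0" if "z \<in> ball a R" for z
    using pos[OF that] x by (auto simp: complex_eq_iff x_def)
  have holW: "W holomorphic_on ball 0 1"
  proof -
    have "(\<lambda>\<zeta>. G (a + of_real R * \<zeta>)) holomorphic_on ball 0 1"
      using holomorphic_on_compose_gen[OF _ hol, of "\<lambda>\<zeta>. a + of_real R * \<zeta>" "ball 0 1"] inb
      by (force simp: o_def intro!: holomorphic_intros)
    then show ?thesis
      unfolding W_def using inb den by (intro holomorphic_intros) auto
  qed
  have lt: "cmod (W \<zeta>) < 1" if "cmod \<zeta> < 1" for \<zeta>
  proof -
    define g where "g = G (a + of_real R * \<zeta>)"
    have g: "Re g > 0" unfolding g_def by (rule pos[OF inb[OF that]])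
    have "(cmod (g + cnj (G a)))\<^sup>2 - (cmod (g - G a))\<^sup>2 = 4 * Re g * x"
      unfolding cmod_power2 by (simp add: x_def power2_eq_square algebra_simps)
    then have "(cmod (g - G a))\<^sup>2 < (cmod (g + cnj (G a)))\<^sup>2" using g x by (smt (verit) mult_pos_pos)
    then have "cmod (g - G a) < cmod (g + cnj (G a))" by (rule power2_less_imp_less) simp
    then show ?thesis by (simp add: W_def g_def norm_divide divide_less_eq)
  qed
  have W0: "W 0 = 0" by (simp add: W_def)
  note Sch = Schwarz_Lemma[OF holW W0 lt]
  have dG: "(G has_field_derivative deriv G a) (at a)"
    using holomorphic_derivI[OF hol open_ball] R by simp
  have "(W has_field_derivative (deriv G a * of_real R) / of_real (2 * x)) (at 0)"
  proof -
    have 1: "((\<lambda>\<zeta>. G (a + of_real R * \<zeta>)) has_field_derivative deriv G a * of_real R) (at 0)"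
      by (rule DERIV_chain2[of G]) (use dG in \<open>auto intro!: derivative_eq_intros\<close>)
    have 2: "complex_of_real (2 * x) = G a + cnj (G a)" by (simp add: x_def complex_add_cnj)
    have 3: "G a + cnj (G a) \<noteq> 0" using den[of a] R by simp
    show ?thesis
      unfolding W_def 2 using 3 by (auto intro!: derivative_eq_intros 1 simp: power2_eq_square)
  qed
  then have "deriv W 0 = (deriv G a * of_real R) / of_real (2 * x)" by (rule DERIV_imp_deriv)
  then have "cmod (deriv G a) * R / (2 * x) \<le> 1"
    using Sch(2)[of 0] R x by (simp add: norm_divide norm_mult)
  then show "cmod (deriv G a) \<le> 2 * Re (G a) / R"
    using R x by (simp add: x_def field_simps)
  fix z assume z: "cmod (z - a) \<le> R / 2"
  define \<zeta> where "\<zeta> = (z - a) / of_real R"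
  have \<zeta>: "cmod \<zeta> \<le> 1/2" "z = a + of_real R * \<zeta>" using z R by (auto simp: \<zeta>_def norm_divide field_simps)
  have zb: "z \<in> ball a R" using z R by (simp add: dist_norm norm_minus_commute)
  have "cmod (W \<zeta>) \<le> 1/2" using Sch(1)[of \<zeta>] \<zeta> by simp
  then have "cmod (G z - G a) \<le> 1/2 * cmod (G z + cnj (G a))"
    using den[OF zb] by (simp add: W_def \<zeta>(2)[symmetric] norm_divide divide_le_eq)
  then have "(cmod (G z - G a))\<^sup>2 \<le> (1/2 * cmod (G z + cnj (G a)))\<^sup>2" by (rule power_mono) simp
  then have "4 * (cmod (G z - G a))\<^sup>2 \<le> (cmod (G z + cnj (G a)))\<^sup>2" by (simp add: power_mult_distrib power2_eq_square)
  then have le4: "4 * ((Re (G z) - x)\<^sup>2 + (Im (G z) - Im (G a))\<^sup>2) \<le> (Re (G z) + x)\<^sup>2 + (Im (G z) - Im (G a))\<^sup>2"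
    by (simp add: cmod_power2 x_def)
  then have le: "4 * (Re (G z) - x)\<^sup>2 \<le> (Re (G z) + x)\<^sup>2"
  proof -
    have "4 * A \<le> C" if "4 * (A + B) \<le> C + B" "0 \<le> B" for A B C :: real using that by simp
    from this[OF le4 zero_le_power2] show ?thesis .
  qed
  show "Re (G z) \<ge> Re (G a) / 3"
  proof (rule ccontr)
    assume "\<not> ?thesis"
    then have "3 * Re (G z) < x" by (simp add: x_def)
    then have "(Re (G z) + x) < 2 * (x - Re (G z))" by simp
    moreover have "0 \<le> Re (G z) + x" using pos[OF zb] x by simp
    ultimately have "(Re (G z) + x)\<^sup>2 < (2 * (x - Re (G z)))\<^sup>2" by (intro power_strict_mono) auto
    moreover have "(2 * (x - Re (G z)))\<^sup>2 = 4 * (Re (G z) - x)\<^sup>2"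
      by (simp add: power2_eq_square algebra_simps)
    ultimately show False using le by simp
  qed
qed

text \<open>Hopf's boundary argument: on the radius through z1, |w| leaves its value 1 at z1 at
  least as fast as s^p leaves 1, and s^p has derivative p at s = 1. The difference quotients of w
  are therefore at least those of s^p.\<close>

lemma boundary_derivative_lower_bound:
  fixes w :: "complex \<Rightarrow> complex" and p :: nat
  assumes w: "(w has_field_derivative w') (at z1)" and R: "R = cmod (z1 - a)" "R > 0"
    and w1: "cmod (w z1) = 1"
    and le: "\<And>z. R / 2 \<le> cmod (z - a) \<Longrightarrow> cmod (z - a) < R \<Longrightarrow> cmod (w z) \<le> (cmod (z - a) / R) ^ p"
  shows "p \<le> cmod w' * R"
proof -
  define \<phi> where "\<phi> = (\<lambda>s::real. w (a + of_real s * (z1 - a)))"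
  have "((\<lambda>z. w (a + z * (z1 - a))) has_field_derivative w' * (z1 - a)) (at (of_real 1))"
    by (rule DERIV_chain2[of w]) (use w in \<open>auto intro!: derivative_eq_intros\<close>)
  then have lim: "((\<lambda>z. (w (a + z * (z1 - a)) - w z1) / (z - 1)) \<longlongrightarrow> w' * (z1 - a)) (at (of_real 1))"
    by (simp add: has_field_derivative_iff)
  have "filterlim complex_of_real (at (of_real 1)) (at_left 1)"
    using tendsto_of_real[OF tendsto_ident_at[of 1 "{..<1::real}"], where 'a = complex]
    by (auto simp: filterlim_at eventually_at_filter)
  from filterlim_compose[OF lim this]
  have "((\<lambda>s. (\<phi> s - \<phi> 1) / of_real (s - 1)) \<longlongrightarrow> w' * (z1 - a)) (at_left 1)"
    by (simp add: \<phi>_def)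
  from tendsto_norm[OF this]
  have l1: "((\<lambda>s. cmod ((\<phi> s - \<phi> 1) / of_real (s - 1))) \<longlongrightarrow> cmod w' * R) (at_left 1)"
    by (simp add: norm_mult R)
  have "((\<lambda>s::real. s ^ p) has_field_derivative real p) (at 1)"
    by (auto intro!: derivative_eq_intros)
  then have "((\<lambda>s::real. (s ^ p - 1) / (s - 1)) \<longlongrightarrow> real p) (at 1)"
    by (simp add: has_field_derivative_iff)
  then have l2: "((\<lambda>s::real. (s ^ p - 1) / (s - 1)) \<longlongrightarrow> real p) (at_left 1)"
    by (simp add: filterlim_at_split)
  have "\<forall>\<^sub>F s in at_left (1::real). s \<in> {1/2<..<1}"
    by (rule eventually_at_left_real) simp
  then have "\<forall>\<^sub>F s in at_left 1. (s ^ p - 1) / (s - 1) \<le> cmod ((\<phi> s - \<phi> 1) / of_real (s - 1))"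
  proof eventually_elim
    case (elim s)
    define z where "z = a + of_real s * (z1 - a)"
    have cz: "cmod (z - a) = s * R" using elim by (simp add: z_def norm_mult R)
    have "cmod (\<phi> s) \<le> s ^ p"
      using le[of z] elim R cz by (simp add: \<phi>_def z_def)
    then have "1 - s ^ p \<le> cmod (\<phi> 1) - cmod (\<phi> s)" by (simp add: \<phi>_def w1)
    also have "\<dots> \<le> cmod (\<phi> s - \<phi> 1)" using norm_triangle_ineq2[of "\<phi> 1" "\<phi> s"] by (simp add: norm_minus_commute)
    finally have "(1 - s ^ p) / (1 - s) \<le> cmod (\<phi> s - \<phi> 1) / (1 - s)"
      using elim by (intro divide_right_mono) auto
    moreover have "(s ^ p - 1) / (s - 1) = (1 - s ^ p) / (1 - s)"
      using minus_divide_divide[of "1 - s ^ p" "1 - s"] by simp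
    moreover have "cmod ((\<phi> s - \<phi> 1) / of_real (s - 1)) = cmod (\<phi> s - \<phi> 1) / (1 - s)"
      using elim by (simp only: norm_divide norm_of_real) simp
    ultimately show ?case by simp
  qed
  from tendsto_le[OF _ l1 l2 this] show ?thesis by (simp add: trivial_limit_at_left_real)
qed

text \<open>\<open>e\<close> lies in the common kernel of the forms \<open>a j\<close>, and
  \<open>decomp\<close> expands f along e and the vectors \<open>b j\<close>, so a form vanishing at
  e sees only the exponentials. The sizes of the \<open>a j\<close> and \<open>b j\<close> are where
  the hyperplanes enter.\<close>

locale omitting_curve = curve I f for I :: "'i set" and f +
  fixes e :: "'i \<Rightarrow> complex" and n :: nat and a b :: "nat \<Rightarrow> 'i \<Rightarrow> complex" and P :: "nat \<Rightarrow> complex \<Rightarrow> complex"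
  assumes e_unit: "(\<Sum>i\<in>I. (cmod (e i))\<^sup>2) = 1"
    and P_hol: "\<And>j. j < n \<Longrightarrow> P j holomorphic_on UNIV"
    and app_a: "\<And>j z. j < n \<Longrightarrow> app (a j) z = exp (P j z)"
    and a_e: "\<And>j. j < n \<Longrightarrow> (\<Sum>i\<in>I. a j i * e i) = 0"
    and decomp: "\<And>i z. i \<in> I \<Longrightarrow> f i z = app (\<lambda>i. cnj (e i)) z * e i + (\<Sum>j<n. b j i * exp (P j z))"
begin

definition f0 :: "complex \<Rightarrow> complex" where "f0 = app (\<lambda>i. cnj (e i))"

definition E :: "complex set" where "E = {z. (cmod (f0 z))\<^sup>2 \<le> S z / 2}"

lemma nrm_e: "nrm (\<lambda>i. cnj (e i)) = 1" by (simp add: nrm_def e_unit)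

lemma f0_hol: "f0 holomorphic_on B" and deriv_f0_hol: "deriv f0 holomorphic_on B"
  unfolding f0_def
  by (auto intro: holomorphic_on_subset[OF app_hol] holomorphic_on_subset[OF holomorphic_deriv[OF app_hol]])

lemma cont_f0: "continuous_on B f0"
  by (rule holomorphic_on_imp_continuous_on[OF f0_hol])

lemma f0_le: "(cmod (f0 z))\<^sup>2 \<le> S z"
  unfolding f0_def by (rule orthogonal_functional(1)[OF e_unit])

lemma closed_E: "closed E"
  unfolding E_def by (intro closed_Collect_le continuous_intros cont_S cont_f0) simp

lemma app_orth:
  assumes "(\<Sum>i\<in>I. c i * e i) = 0"
  shows "app c z = (\<Sum>j<n. (\<Sum>i\<in>I. c i * b j i) * exp (P j z))"
proof -
  have "f i z = f0 z * e i + (\<Sum>j<n. b j i * exp (P j z))" if "i \<in> I" for i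
    using decomp[OF that, of z] by (simp add: f0_def)
  then have "(\<Sum>i\<in>I. c i * f i z) = (\<Sum>i\<in>I. c i * (f0 z * e i + (\<Sum>j<n. b j i * exp (P j z))))"
    by (intro sum.cong refl) simp
  then have "app c z = (\<Sum>i\<in>I. c i * (f0 z * e i + (\<Sum>j<n. b j i * exp (P j z))))"
    by (simp add: app_def)
  also have "\<dots> = f0 z * (\<Sum>i\<in>I. c i * e i) + (\<Sum>i\<in>I. \<Sum>j<n. c i * b j i * exp (P j z))"
    by (simp add: algebra_simps sum.distrib sum_distrib_left)
  also have "(\<Sum>i\<in>I. \<Sum>j<n. c i * b j i * exp (P j z)) = (\<Sum>j<n. (\<Sum>i\<in>I. c i * b j i) * exp (P j z))"
    by (subst sum.swap) (simp add: sum_distrib_right)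
  finally show ?thesis using assms by simp
qed

text \<open>The summand 1 keeps both constants at least 1, so that they may be divided by and have
  nonnegative logarithms.\<close>

definition Kb :: real where "Kb = 1 + (\<Sum>j<n. nrm (b j))"
definition Ka :: real where "Ka = 1 + (\<Sum>j<n. nrm (a j))"

lemma Kb_ge1: "Kb \<ge> 1" and Ka_ge1: "Ka \<ge> 1"
  by (auto simp: Kb_def Ka_def intro!: sum_nonneg nrm_nonneg)

lemma nrm_a_le: "j < n \<Longrightarrow> nrm (a j) \<le> Ka"
  using member_le_sum[of j "{..<n}" "\<lambda>j. nrm (a j)"] by (auto simp: Ka_def nrm_nonneg)

lemma app_orth_le:
  assumes "(\<Sum>i\<in>I. c i * e i) = 0" "nrm c \<le> 1" and M: "\<And>j. j < n \<Longrightarrow> cmod (exp (P j z)) \<le> M" "M \<ge> 0"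
  shows "cmod (app c z) \<le> Kb * M"
proof -
  have "cmod (app c z) \<le> (\<Sum>j<n. cmod (\<Sum>i\<in>I. c i * b j i) * cmod (exp (P j z)))"
    unfolding app_orth[OF assms(1)] by (rule order_trans[OF norm_sum]) (simp add: norm_mult del: norm_exp_eq_Re)
  also have "\<dots> \<le> (\<Sum>j<n. nrm (b j) * M)"
  proof (intro sum_mono mult_mono)
    fix j
    have "cmod (\<Sum>i\<in>I. c i * b j i) \<le> nrm c * nrm (b j)"
      unfolding nrm_def by (rule cmod_sum_mult_le_L2)
    also have "\<dots> \<le> 1 * nrm (b j)" by (intro mult_right_mono assms nrm_nonneg)
    finally show "cmod (\<Sum>i\<in>I. c i * b j i) \<le> nrm (b j)" by simp
  qed (auto simp: M nrm_nonneg simp del: norm_exp_eq_Re)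
  also have "\<dots> \<le> Kb * M"
    using M(2) by (simp add: Kb_def distrib_right sum_distrib_right)
  finally show ?thesis .
qed

text \<open>\<open>a j\<close> vanishes at e, hence sees only the remainder f - f0 e, whose squared
  length is S - |f0|^2.\<close>

lemma exp_P_le:
  assumes j: "j < n"
  shows "cmod (exp (P j z)) \<le> Ka * sqrt (S z - (cmod (f0 z))\<^sup>2)"
proof -
  define h where "h = (\<lambda>i. f i z - f0 z * e i)"
  have "exp (P j z) = (\<Sum>i\<in>I. a j i * f i z) - f0 z * (\<Sum>i\<in>I. a j i * e i)"
    using app_a[OF j, of z] a_e[OF j] by (simp add: app_def)
  also have "\<dots> = (\<Sum>i\<in>I. a j i * h i)"
    by (simp add: h_def algebra_simps sum_subtractf sum_distrib_left)
  also have "cmod \<dots> \<le> nrm (a j) * sqrt (\<Sum>i\<in>I. (cmod (h i))\<^sup>2)"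
    unfolding nrm_def by (rule cmod_sum_mult_le_L2)
  also have "(\<Sum>i\<in>I. (cmod (h i))\<^sup>2) = S z - (cmod (f0 z))\<^sup>2"
    unfolding h_def f0_def by (rule orthogonal_remainder[OF e_unit])
  also have "nrm (a j) * sqrt (S z - (cmod (f0 z))\<^sup>2) \<le> Ka * sqrt (S z - (cmod (f0 z))\<^sup>2)"
    by (intro mult_right_mono nrm_a_le j) (use f0_le in simp)
  finally show ?thesis .
qed

text \<open>Converse to \<open>exp_P_le\<close>: the form that measures the remainder vanishes at e,
  so it is a combination of the exponentials. Together the two make the remainder comparable with
  the largest |exp P_j|.\<close>

lemma S_minus_f0_le:
  assumes M: "\<And>j. j < n \<Longrightarrow> cmod (exp (P j z)) \<le> M" "M \<ge> 0"
  shows "sqrt (S z - (cmod (f0 z))\<^sup>2) \<le> Kb * M"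
proof -
  obtain c where c: "nrm c \<le> 1" "(\<Sum>i\<in>I. c i * e i) = 0" "(cmod (app c z))\<^sup>2 = S z - (cmod (f0 z))\<^sup>2"
    using orthogonal_functional(2)[OF e_unit, of z] unfolding f0_def by blast
  have "sqrt (S z - (cmod (f0 z))\<^sup>2) = cmod (app c z)" unfolding c(3)[symmetric] by simp
  also have "\<dots> \<le> Kb * M" by (rule app_orth_le[OF c(2,1) M])
  finally show ?thesis .
qed

lemma app_orth_le_remainder:
  assumes "(\<Sum>i\<in>I. c i * e i) = 0" "nrm c \<le> 1"
  shows "cmod (app c z) \<le> sqrt (S z - (cmod (f0 z))\<^sup>2)"
proof -
  have "app c z = (\<Sum>i\<in>I. c i * f i z) - f0 z * (\<Sum>i\<in>I. c i * e i)"
    using assms by (simp add: app_def)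
  also have "\<dots> = (\<Sum>i\<in>I. c i * (f i z - f0 z * e i))"
    by (simp add: algebra_simps sum_subtractf sum_distrib_left)
  also have "cmod \<dots> \<le> nrm c * sqrt (\<Sum>i\<in>I. (cmod (f i z - f0 z * e i))\<^sup>2)"
    unfolding nrm_def by (rule cmod_sum_mult_le_L2)
  also have "(\<Sum>i\<in>I. (cmod (f i z - f0 z * e i))\<^sup>2) = S z - (cmod (f0 z))\<^sup>2"
    unfolding f0_def by (rule orthogonal_remainder[OF e_unit])
  also have "nrm c * sqrt (S z - (cmod (f0 z))\<^sup>2) \<le> 1 * sqrt (S z - (cmod (f0 z))\<^sup>2)"
    by (intro mult_right_mono assms) (use f0_le in simp)
  finally show ?thesis by simp
qed

lemma f0_logderiv_conn:
  assumes "(cmod (f0 z))\<^sup>2 \<ge> S z / 2"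
  shows "f0 z \<noteq> 0" "cmod (deriv f0 z / f0 z - conn z) \<le> 2 * kap z"
proof -
  have "(2/3)\<^sup>2 * S z \<le> (cmod (f0 z))\<^sup>2"
    using assms S_pos[of z] by (simp add: power2_eq_square)
  note * = app_logderiv_conn[of "\<lambda>i. cnj (e i)" "2/3" z, folded f0_def, OF _ this]
  show "f0 z \<noteq> 0" "cmod (deriv f0 z / f0 z - conn z) \<le> 2 * kap z"
    using * nrm_e kap_nonneg[of z] by auto
qed

text \<open>In the ball f0 = exp H dominates, and Re (H - P_j) is bounded below by a constant. Let m
  be the least Re G_j(z0), attained at k; Schwarz gives |G_k'(z0)| <= 2 m / R, so m has to be
  bounded. A quotient w = c(f) / f0 has modulus 1 at z1 and at most 1 in the ball, and by Harnack it
  is at most a constant times exp(-m/3) in the half ball. Such a fall towards the centre forces a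
  large derivative at z1, whereas \<open>kap z1\<close> bounds that derivative.\<close>

lemma conn_near_exponent_off_E:
  assumes a0: "ball z0 R \<inter> E = {}" and z1: "z1 \<in> E" and R: "R = cmod (z1 - z0)" "R > 0"
  shows "\<exists>j<n. cmod (conn z0 - deriv (P j) z0) \<le> 18 * kap z1 + 2 * kap z0 + (6 + 6 * ln (2 * Ka * Kb)) / R"
proof -
  have f0S: "S z / 2 \<le> (cmod (f0 z))\<^sup>2" if "z \<in> cball z0 R" for z
  proof -
    have "closure (ball z0 R) \<subseteq> {z. S z / 2 \<le> (cmod (f0 z))\<^sup>2}"
      by (rule closure_minimal)
         (use a0 in \<open>force simp: E_def intro!: closed_Collect_le continuous_intros cont_S cont_f0\<close>)+
    then show ?thesis using that R by (auto simp: closure_ball)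
  qed
  have f0nz: "f0 z \<noteq> 0" if "z \<in> cball z0 R" for z by (rule f0_logderiv_conn(1)[OF f0S[OF that]])
  have z1c: "z1 \<in> cball z0 R" using R by (simp add: dist_norm norm_minus_commute)
  have hle: "sqrt (S z - (cmod (f0 z))\<^sup>2) \<le> cmod (f0 z)" if "z \<in> cball z0 R" for z
    using real_sqrt_le_mono[of "S z - (cmod (f0 z))\<^sup>2" "(cmod (f0 z))\<^sup>2"] f0S[OF that] by simp
  have z1eq: "S z1 - (cmod (f0 z1))\<^sup>2 = (cmod (f0 z1))\<^sup>2"
    using f0S[OF z1c] z1 by (simp add: E_def)
  have n0: "n > 0"
  proof (rule ccontr)
    assume "\<not> n > 0"
    then have "sqrt (S z1 - (cmod (f0 z1))\<^sup>2) \<le> Kb * 0" by (intro S_minus_f0_le) auto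
    then show False using f0nz[OF z1c] by (simp add: z1eq)
  qed
  obtain H where H: "H holomorphic_on ball z0 R" "\<And>z. z \<in> ball z0 R \<Longrightarrow> exp (H z) = f0 z"
  proof (rule holomorphic_logarithm_exists[of "ball z0 R" f0 z0])
    show "z0 \<in> ball z0 R" using R by simp
  qed (use f0nz in \<open>auto intro: f0_hol\<close>)
  define L where "L = ln (2 * Ka)"
  \<comment> \<open>Each \<open>G j\<close> has positive real part on the ball, so Schwarz bounds \<open>f0' / f0 - P j'\<close> at the centre.\<close>
  define G where "G = (\<lambda>j z. H z - P j z + of_real L)"
  have gf: "cmod (exp (P j z)) = cmod (f0 z) * (2 * Ka * exp (- Re (G j z)))" if "z \<in> ball z0 R" for j z
  proof -
    have "cmod (f0 z) = exp (Re (H z))" unfolding H(2)[OF that, symmetric] by (rule norm_exp_eq_Re)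
    moreover have "2 * Ka = exp L" using Ka_ge1 by (simp add: L_def)
    ultimately have "cmod (f0 z) * (2 * Ka * exp (- Re (G j z))) = exp (Re (H z)) * (exp L * exp (- Re (G j z)))" by simp
    also have "\<dots> = exp (Re (P j z))" by (simp add: G_def flip: exp_add)
    finally show ?thesis by simp
  qed
  have Ghol: "G j holomorphic_on ball z0 R" if "j < n" for j
    unfolding G_def by (intro holomorphic_intros H holomorphic_on_subset[OF P_hol[OF that]]) auto
  have Gpos: "Re (G j z) > 0" if "j < n" "z \<in> ball z0 R" for j z
  proof -
    have "cmod (exp (P j z)) \<le> Ka * cmod (f0 z)"
      by (rule order_trans[OF exp_P_le[OF that(1)]]) (use hle[of z] that(2) Ka_ge1 in \<open>auto intro!: mult_left_mono\<close>)
    then have "cmod (f0 z) * (2 * Ka * exp (- Re (G j z))) \<le> cmod (f0 z) * Ka"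
      unfolding gf[OF that(2)] by (simp add: mult.commute)
    then have "2 * exp (- Re (G j z)) \<le> 1" using f0nz[of z] that(2) Ka_ge1 by simp
    then have "exp (- Re (G j z)) < 1" by linarith
    then show ?thesis by simp
  qed
  have "Min ((\<lambda>j. Re (G j z0)) ` {..<n}) \<in> (\<lambda>j. Re (G j z0)) ` {..<n}"
    using n0 by (intro Min_in) auto
  then obtain k where k': "k < n" "Min ((\<lambda>j. Re (G j z0)) ` {..<n}) = Re (G k z0)" by blast
  have k: "k < n" "\<And>j. j < n \<Longrightarrow> Re (G k z0) \<le> Re (G j z0)"
    using k' by (auto simp flip: k'(2))
  define m where "m = Re (G k z0)"
  have m0: "m > 0" using Gpos[OF k(1)] R by (simp add: m_def)
  \<comment> \<open>At z1 the inequalities |f0|^2 <= S/2 (z1 is in E) and >= S/2 (by closure) meet.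
    So the remainder is as long as f0, and the form c measuring it gives |w z1| = 1.\<close>
  obtain c where c: "nrm c \<le> 1" "(\<Sum>i\<in>I. c i * e i) = 0" "(cmod (app c z1))\<^sup>2 = S z1 - (cmod (f0 z1))\<^sup>2"
    using orthogonal_functional(2)[OF e_unit, of z1] unfolding f0_def by blast
  have appc: "cmod (app c z1) = cmod (f0 z1)"
    by (rule power2_eq_imp_eq) (use c(3) z1eq in simp_all)
  define w where "w = (\<lambda>z. app c z / f0 z)"
  have whol: "w holomorphic_on ball z0 R"
    unfolding w_def
    by (intro holomorphic_on_divide f0_hol holomorphic_on_subset[OF app_hol] subset_UNIV f0nz) auto
  have wcont: "continuous_on (cball z0 R) w"
    unfolding w_def
    by (intro continuous_on_divide cont_f0 holomorphic_on_imp_continuous_on holomorphic_on_subset[OF app_hol] subset_UNIV ballI f0nz)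
  have w_le1: "cmod (w z) \<le> 1" if "z \<in> cball z0 R" for z
  proof -
    have "cmod (app c z) \<le> sqrt (S z - (cmod (f0 z))\<^sup>2)"
      by (rule app_orth_le_remainder[OF c(2,1)])
    then show ?thesis using hle[OF that] f0nz[OF that] by (simp add: w_def norm_divide divide_le_eq)
  qed
  have w_small: "cmod (w z) \<le> 2 * Ka * Kb * exp (- m / 3)" if z: "z \<in> cball z0 (R / 2)" for z
  proof -
    have zb: "z \<in> ball z0 R" using z R(2) by simp
    have "cmod (app c z) \<le> Kb * (cmod (f0 z) * (2 * Ka * exp (- m / 3)))"
    proof (rule app_orth_le[OF c(2,1)])
      fix j assume j: "j < n"
      have "m / 3 \<le> Re (G j z0) / 3" using k(2)[OF j] by (simp add: m_def)
      also have "\<dots> \<le> Re (G j z)"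
        using positive_Re_Schwarz(2)[OF Ghol[OF j] R(2) Gpos[OF j], of z] z by (simp add: dist_norm norm_minus_commute)
      finally show "cmod (exp (P j z)) \<le> cmod (f0 z) * (2 * Ka * exp (- m / 3))"
        unfolding gf[OF zb] using Ka_ge1 by (intro mult_left_mono) auto
    qed (use Ka_ge1 in auto)
    then show ?thesis using f0nz[of z] zb by (simp add: w_def norm_divide divide_le_eq mult_ac)
  qed
  \<comment> \<open>Since |w z1| = 1, |w'| is the modulus of the difference between the logarithmic
    derivatives of c(f) and f0, each within 3/2 \<open>kap z1\<close> of
    \<open>conn z1\<close>.\<close>
  have dw: "(w has_field_derivative deriv w z1) (at z1)" and dw_le: "cmod (deriv w z1) \<le> 3 * kap z1"
  proof -
    have D: "(w has_field_derivative (deriv (app c) z1 * f0 z1 - app c z1 * deriv f0 z1) / (f0 z1 * f0 z1)) (at z1)"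
      unfolding w_def
      by (rule DERIV_divide) (use f0nz[OF z1c] in \<open>auto intro: app_fd holomorphic_derivI[OF f0_hol]\<close>)
    then show "(w has_field_derivative deriv w z1) (at z1)" by (simp add: DERIV_imp_deriv)
    have anz: "app c z1 \<noteq> 0" using appc f0nz[OF z1c] by auto
    have "deriv w z1 = (app c z1 / f0 z1) * ((deriv (app c) z1 / app c z1 - conn z1) - (deriv f0 z1 / f0 z1 - conn z1))"
      unfolding DERIV_imp_deriv[OF D] using anz f0nz[OF z1c] by (simp add: field_simps)
    then have "cmod (deriv w z1) = cmod ((deriv (app c) z1 / app c z1 - conn z1) - (deriv f0 z1 / f0 z1 - conn z1))"
      using appc f0nz[OF z1c] by (simp add: norm_mult norm_divide)
    also have "\<dots> \<le> cmod (deriv (app c) z1 / app c z1 - conn z1) + cmod (deriv f0 z1 / f0 z1 - conn z1)"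
      by (rule norm_triangle_ineq4)
    also have "\<dots> \<le> kap z1 / (2/3) + kap z1 / (2/3)"
    proof (intro add_mono)
      have "(2/3)\<^sup>2 * S z1 \<le> (cmod (app c z1))\<^sup>2"
        using c(3) z1eq S_pos[of z1] by (simp add: power2_eq_square)
      from app_logderiv_conn(2)[OF c(1) this] show "cmod (deriv (app c) z1 / app c z1 - conn z1) \<le> kap z1 / (2/3)" by simp
      have "(2/3)\<^sup>2 * S z1 \<le> (cmod (f0 z1))\<^sup>2"
        using f0S[OF z1c] S_pos[of z1] by (simp add: power2_eq_square)
      from app_logderiv_conn(2)[of "\<lambda>i. cnj (e i)" "2/3" z1, folded f0_def, OF _ this]
      show "cmod (deriv f0 z1 / f0 z1 - conn z1) \<le> kap z1 / (2/3)" by (simp add: nrm_e)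
    qed
    finally show "cmod (deriv w z1) \<le> 3 * kap z1" by simp
  qed
  define K where "K = 2 * Ka * Kb"
  have K: "K \<ge> 2" unfolding K_def using Ka_ge1 Kb_ge1 mult_mono[of 1 Ka 1 Kb] by simp
  \<comment> \<open>Hadamard's three circles between the radii R/2 and R. The exponent p is an
    integer so that (R / (z - z0))^p is single-valued on the annulus.\<close>
  have key: "real p \<le> 3 * kap z1 * R" if p: "K * exp (- m / 3) * 2 ^ p \<le> 1" for p :: nat
  proof -
    define A where "A = ball z0 R - cball z0 (R / 2)"
    define W where "W = (\<lambda>z. w z * (of_real R / (z - z0)) ^ p)"
    have opA: "open A" unfolding A_def by (intro open_Diff) auto
    have clA: "closure A \<subseteq> cball z0 R - ball z0 (R / 2)"
      by (rule closure_minimal) (auto simp: A_def intro!: closed_Diff)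
    have nzA: "z - z0 \<noteq> 0" if "z \<in> cball z0 R - ball z0 (R / 2)" for z
      using that R by auto
    have nW: "cmod (W z) = cmod (w z) * (R / cmod (z - z0)) ^ p" for z
      using R by (simp add: W_def norm_mult norm_power norm_divide)
    have W1: "cmod (W z) \<le> 1" if "z \<in> A" for z
    proof (rule maximum_modulus_frontier[of W A])
      show "W holomorphic_on interior A"
        unfolding W_def interior_open[OF opA] using R
        by (intro holomorphic_intros holomorphic_on_subset[OF whol]) (auto simp: A_def)
      show "continuous_on (closure A) W"
        unfolding W_def
        by (intro continuous_intros continuous_on_subset[OF wcont]) (use clA nzA in auto)
      show "bounded A" unfolding A_def by (rule bounded_subset[OF bounded_ball[of z0 R]]) auto
      fix z assume z: "z \<in> frontier A"
      then have zc: "z \<in> cball z0 R - ball z0 (R / 2)" and zA: "z \<notin> A"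
        using clA opA by (auto simp: frontier_def interior_open)
      then consider "cmod (z - z0) = R" | "cmod (z - z0) = R / 2"
        by (force simp: A_def dist_norm norm_minus_commute)
      then show "cmod (W z) \<le> 1"
      proof cases
        case 1
        then show ?thesis using w_le1[of z] zc R by (simp add: nW)
      next
        case 2
        have "cmod (w z) * 2 ^ p \<le> (K * exp (- m / 3)) * 2 ^ p"
          unfolding K_def using 2 by (intro mult_right_mono w_small) (auto simp: dist_norm norm_minus_commute)
        also note p
        finally have "cmod (w z) * 2 ^ p \<le> 1" .
        moreover have "R / cmod (z - z0) = 2" using 2 R(2) by (auto simp: divide_eq_eq)
        ultimately show ?thesis unfolding nW by simp
      qed
    qed (rule that)
    have wp: "cmod (w z) \<le> (cmod (z - z0) / R) ^ p" if z: "R / 2 \<le> cmod (z - z0)" "cmod (z - z0) < R" for z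
    proof (cases "R / 2 = cmod (z - z0)")
      case True
      have "cmod (w z) * 2 ^ p \<le> (K * exp (- m / 3)) * 2 ^ p"
        unfolding K_def using True by (intro mult_right_mono w_small) (auto simp: dist_norm norm_minus_commute)
      also note p
      finally have "cmod (w z) * 2 ^ p \<le> 1" .
      moreover have "cmod (z - z0) / R = 1 / 2" using True R by simp
      ultimately show ?thesis by (simp only:) (simp add: power_one_over field_simps)
    next
      case False
      then have "z \<in> A" using z by (auto simp: A_def dist_norm norm_minus_commute)
      from W1[OF this] have "cmod (w z) * (R / cmod (z - z0)) ^ p \<le> 1" by (simp add: nW)
      moreover have "cmod (z - z0) > 0" using z R by linarith
      ultimately show ?thesis using R by (simp add: power_divide field_simps)
    qed
    have "real p \<le> cmod (deriv w z1) * R"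
    proof (rule boundary_derivative_lower_bound[OF dw R _ wp])
      show "cmod (w z1) = 1" using appc f0nz[OF z1c] by (simp add: w_def norm_divide)
    qed auto
    also have "\<dots> \<le> 3 * kap z1 * R" using dw_le R by (intro mult_right_mono) auto
    finally show ?thesis .
  qed
  have lnK: "ln K \<ge> 0" using K by simp
  have m_le: "m \<le> 9 * kap z1 * R + 3 + 3 * ln K"
  proof (cases "m / 3 - ln K \<ge> 0")
    case False
    then show ?thesis using kap_nonneg[of z1] R by (auto intro: order_trans[of _ "3 * ln K"] simp: add_nonneg_nonneg)
  next
    case True
    \<comment> \<open>Rounding m/3 - ln K down costs the summand 3 in \<open>m_le\<close>; the bound
      2 <= exp 1 turns 2^p into exp p. The coefficient 9 is 3 from \<open>key\<close> times 3 from
      Harnack, and Schwarz doubles it to 18.\<close>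
    define p where "p = nat \<lfloor>m / 3 - ln K\<rfloor>"
    have p: "real p \<le> m / 3 - ln K" "m / 3 - ln K < real p + 1"
      using True by (auto simp: p_def)
    have "K * exp (- m / 3) * 2 ^ p \<le> K * exp (- m / 3) * exp (real p)"
    proof (rule mult_left_mono)
      have "(2::real) ^ p \<le> exp 1 ^ p" using exp_ge_add_one_self[of 1] by (intro power_mono) auto
      then show "2 ^ p \<le> exp (real p)" by (simp add: exp_of_nat_mult[symmetric])
    qed (use K in simp)
    also have "\<dots> = exp (ln K) * exp (- m / 3) * exp (real p)" using K by simp
    also have "\<dots> = exp (ln K - m / 3 + real p)" by (simp only: exp_add[symmetric]) simp
    also have "\<dots> \<le> 1" using p by simp
    finally have "real p \<le> 3 * kap z1 * R" by (rule key)
    then show ?thesis using p by linarith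
  qed
  have "cmod (deriv (G k) z0) \<le> 2 * m / R"
    using positive_Re_Schwarz(1)[OF Ghol[OF k(1)] R(2) Gpos[OF k(1)]] by (simp add: m_def)
  also have "\<dots> \<le> 2 * (9 * kap z1 * R + 3 + 3 * ln K) / R"
    using m_le R by (intro divide_right_mono) auto
  also have "\<dots> = 18 * kap z1 + (6 + 6 * ln K) / R" using R by (simp add: field_simps)
  finally have dG: "cmod (deriv (G k) z0) \<le> 18 * kap z1 + (6 + 6 * ln K) / R" .
  have z0b: "z0 \<in> ball z0 R" "z0 \<in> cball z0 R" using R by auto
  have "deriv (G k) z0 = deriv f0 z0 / f0 z0 - deriv (P k) z0"
  proof -
    have dH: "(H has_field_derivative deriv H z0) (at z0)" by (rule holomorphic_derivI[OF H(1) open_ball z0b(1)])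
    have "((\<lambda>z. exp (H z)) has_field_derivative exp (H z0) * deriv H z0) (at z0)"
      using dH by (auto intro!: derivative_eq_intros)
    then have "(f0 has_field_derivative exp (H z0) * deriv H z0) (at z0)"
      by (rule has_field_derivative_transform_within_open[OF _ open_ball z0b(1)]) (simp add: H)
    then have "deriv f0 z0 = f0 z0 * deriv H z0" using H(2)[OF z0b(1)] by (simp add: DERIV_imp_deriv)
    then have 1: "deriv H z0 = deriv f0 z0 / f0 z0" using f0nz[OF z0b(2)] by simp
    have "(P k has_field_derivative deriv (P k) z0) (at z0)"
      using holomorphic_derivI[OF P_hol[OF k(1)]] by blast
    then have "(G k has_field_derivative deriv H z0 - deriv (P k) z0) (at z0)"
      unfolding G_def using dH by (auto intro!: derivative_eq_intros)
    then show ?thesis using 1 by (simp add: DERIV_imp_deriv)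
  qed
  then have "conn z0 - deriv (P k) z0 = deriv (G k) z0 - (deriv f0 z0 / f0 z0 - conn z0)" by simp
  then have "cmod (conn z0 - deriv (P k) z0) \<le> cmod (deriv (G k) z0) + cmod (deriv f0 z0 / f0 z0 - conn z0)"
    by (metis norm_triangle_ineq4)
  also have "\<dots> \<le> (18 * kap z1 + (6 + 6 * ln K) / R) + 2 * kap z0"
    by (intro add_mono dG f0_logderiv_conn f0S z0b)
  finally show ?thesis using k(1) by (auto simp: K_def)
qed

end

text \<open>\<open>conn\<close> is a logarithmic derivative and \<open>kap\<close> a projective
  length, so the scalar c drops out of both and the chain rule contributes the derivative of \<psi>.
  It is used with affine maps for rescaling and with z^2 for changing the growth exponent.\<close>

lemma curve_compose:
  assumes "curve I f" and \<psi>: "\<psi> holomorphic_on UNIV" and c: "c \<noteq> 0"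
  defines "g \<equiv> \<lambda>i z. c * f i (\<psi> z)"
  shows "curve I g" "curve.S I g z = (cmod c)\<^sup>2 * curve.S I f (\<psi> z)"
    "curve.app I g d z = c * curve.app I f d (\<psi> z)"
    "curve.conn I g z = deriv \<psi> z * curve.conn I f (\<psi> z)"
    "curve.kap I g z = cmod (deriv \<psi> z) * curve.kap I f (\<psi> z)"
proof -
  interpret f: curve I f by fact
  have hol: "g i holomorphic_on UNIV" if "i \<in> I" for i
  proof -
    have "(f i \<circ> \<psi>) holomorphic_on UNIV"
      by (rule holomorphic_on_compose_gen[OF \<psi> f.hol[OF that]]) auto
    then show ?thesis unfolding g_def by (intro holomorphic_intros) (simp add: o_def)
  qed
  show g: "curve I g"
  proof
    show "finite I" by (rule f.fin)
    show "\<exists>i\<in>I. g i z \<noteq> 0" for z using f.nz[of "\<psi> z"] c by (auto simp: g_def)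
  qed (rule hol)
  interpret g: curve I g by fact
  have S: "g.S z = (cmod c)\<^sup>2 * f.S (\<psi> z)" for z
    unfolding g.S_def f.S_def sum_distrib_left by (simp add: g_def norm_mult power_mult_distrib)
  then show "g.S z = (cmod c)\<^sup>2 * f.S (\<psi> z)" .
  show "g.app d z = c * f.app d (\<psi> z)"
    unfolding g.app_def f.app_def sum_distrib_left by (simp add: g_def mult_ac)
  have d\<psi>: "(\<psi> has_field_derivative deriv \<psi> z) (at z)" for z
    using holomorphic_derivI[OF \<psi>] by blast
  have dg: "deriv (g i) z = c * (deriv (f i) (\<psi> z) * deriv \<psi> z)" if "i \<in> I" for i
    unfolding g_def by (rule DERIV_imp_deriv[OF DERIV_cmult[OF DERIV_chain2[OF f.fd[OF that] d\<psi>]]])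
  have cc: "c * cnj c = of_real ((cmod c)\<^sup>2)" by (rule complex_norm_square[symmetric])
  have "(\<Sum>i\<in>I. deriv (g i) z * cnj (g i z)) = (c * cnj c) * deriv \<psi> z * (\<Sum>i\<in>I. deriv (f i) (\<psi> z) * cnj (f i (\<psi> z)))"
    unfolding sum_distrib_left by (intro sum.cong refl) (simp only: dg, simp add: g_def mult_ac)
  then show co: "g.conn z = deriv \<psi> z * f.conn (\<psi> z)"
    unfolding g.conn_def f.conn_def S cc using c by simp
  have "(\<Sum>i\<in>I. (cmod (deriv (g i) z - g.conn z * g i z))\<^sup>2)
      = (\<Sum>i\<in>I. (cmod c)\<^sup>2 * (cmod (deriv \<psi> z))\<^sup>2 * (cmod (deriv (f i) (\<psi> z) - f.conn (\<psi> z) * f i (\<psi> z)))\<^sup>2)"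
  proof (intro sum.cong refl)
    fix i assume i: "i \<in> I"
    have "deriv (g i) z - g.conn z * g i z = c * deriv \<psi> z * (deriv (f i) (\<psi> z) - f.conn (\<psi> z) * f i (\<psi> z))"
      unfolding dg[OF i] co by (simp add: g_def algebra_simps)
    then show "(cmod (deriv (g i) z - g.conn z * g i z))\<^sup>2
       = (cmod c)\<^sup>2 * (cmod (deriv \<psi> z))\<^sup>2 * (cmod (deriv (f i) (\<psi> z) - f.conn (\<psi> z) * f i (\<psi> z)))\<^sup>2"
      by (simp only: norm_mult power_mult_distrib)
  qed
  then have "(\<Sum>i\<in>I. (cmod (deriv (g i) z - g.conn z * g i z))\<^sup>2) / g.S z
     = (cmod (deriv \<psi> z))\<^sup>2 * ((\<Sum>i\<in>I. (cmod (deriv (f i) (\<psi> z) - f.conn (\<psi> z) * f i (\<psi> z)))\<^sup>2) / f.S (\<psi> z))"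
    unfolding S sum_distrib_left[symmetric] using c by simp
  then show "g.kap z = cmod (deriv \<psi> z) * f.kap (\<psi> z)"
    unfolding g.kap_def f.kap_def by (simp only: real_sqrt_mult real_sqrt_abs abs_norm_cancel)
qed

section \<open>Estimates at infinity for curves of prescribed growth\<close>

lemma filterlim_norm_powr:
  assumes "D > 0"
  shows "filterlim (\<lambda>z::complex. cmod z powr D) at_top at_infinity"
proof -
  have "filterlim (\<lambda>x::real. x powr D) at_top at_top"
    using assms by real_asymp
  from filterlim_compose[OF this filterlim_norm_at_top] show ?thesis .
qed

text \<open>\<open>D\<close> and \<kappa> are parameters because the locale serves for \<sigma> and
  K, for a larger exponent with \<kappa> = 0, and, after composition with z^2, for 2 D + 1 and 2
  \<kappa>. The term \<open>l j * z ^ N\<close> is the part of P_j' of exact order D; it can be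
  present only when D is the natural number N, and otherwise \<open>D_N\<close> makes every
  \<open>l j\<close> vanish.\<close>

locale asymptotic_curve = omitting_curve I f e n a b P for I :: "'i set" and f e n a b P +
  fixes D \<kappa> :: real and N :: nat and l :: "nat \<Rightarrow> complex"
  assumes n_pos: "n > 0" and D_nonneg: "D \<ge> 0" and \<kappa>_nonneg: "\<kappa> \<ge> 0"
    and kap_asymp: "\<And>\<epsilon>. \<epsilon> > 0 \<Longrightarrow> \<forall>\<^sub>F z in at_infinity. kap z \<le> (\<kappa> + \<epsilon>) * cmod z powr D"
    and P_asymp: "\<And>j. j < n \<Longrightarrow> ((\<lambda>z. (deriv (P j) z - l j * z ^ N) / of_real (cmod z powr D)) \<longlongrightarrow> 0) at_infinity"
    and D_N: "D = real N \<or> (\<forall>j<n. l j = 0)"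
begin

lemma deriv_exp_P: "deriv (app (a j)) z = deriv (P j) z * app (a j) z" if "j < n"
proof -
  have "(P j has_field_derivative deriv (P j) z) (at z)"
    using holomorphic_derivI[OF P_hol[OF that]] by blast
  then have "((\<lambda>z. exp (P j z)) has_field_derivative exp (P j z) * deriv (P j) z) (at z)"
    by (auto intro!: derivative_eq_intros)
  moreover have "app (a j) = (\<lambda>z. exp (P j z))" using app_a[OF that] by auto
  ultimately show ?thesis by (simp add: DERIV_imp_deriv mult.commute)
qed

lemma kap_global_bound:
  assumes "\<epsilon> > 0"
  shows "\<exists>k\<ge>0. \<forall>z. kap z \<le> (\<kappa> + \<epsilon>) * cmod z powr D + k"
proof -
  obtain r where r: "\<And>z. cmod z \<ge> r \<Longrightarrow> kap z \<le> (\<kappa> + \<epsilon>) * cmod z powr D"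
    using kap_asymp[OF assms] unfolding eventually_at_infinity by blast
  have "bounded (kap ` cball 0 r)"
    by (intro compact_imp_bounded compact_continuous_image cont_kap) auto
  then obtain k where "\<forall>x\<in>kap ` cball 0 r. norm x \<le> k"
    unfolding bounded_iff by blast
  then have k: "\<bar>kap z\<bar> \<le> k" if "cmod z \<le> r" for z
    using that by simp
  have "kap z \<le> (\<kappa> + \<epsilon>) * cmod z powr D + max k 0" for z
  proof (cases "cmod z \<ge> r")
    case False
    then have "kap z \<le> k" using k[of z] by auto
    moreover have "(\<kappa> + \<epsilon>) * cmod z powr D \<ge> 0" using \<kappa>_nonneg assms by simp
    ultimately show ?thesis by linarith
  qed (use r[of z] in auto)
  then show ?thesis by (intro exI[of _ "max k 0"]) auto
qed

lemma deriv_P_bound: "\<exists>C\<ge>0. \<forall>\<^sub>F z in at_infinity. \<forall>j<n. cmod (deriv (P j) z) \<le> C * cmod z powr D"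
proof -
  define C where "C = 1 + (\<Sum>j<n. cmod (l j))"
  have "\<forall>\<^sub>F z in at_infinity. \<forall>j\<in>{..<n}. cmod (deriv (P j) z) \<le> C * cmod z powr D"
  proof (rule eventually_ball_finite)
    show "\<forall>j\<in>{..<n}. \<forall>\<^sub>F z in at_infinity. cmod (deriv (P j) z) \<le> C * cmod z powr D"
    proof
      fix j assume "j \<in> {..<n}"
      then have j: "j < n" by simp
      have "\<forall>\<^sub>F z in at_infinity. cmod ((deriv (P j) z - l j * z ^ N) / of_real (cmod z powr D)) < 1"
        using tendstoD[OF P_asymp[OF j], of 1] by (simp add: dist_norm)
      moreover have "\<forall>\<^sub>F z::complex in at_infinity. cmod z \<ge> 1"
        unfolding eventually_at_infinity by blast
      ultimately show "\<forall>\<^sub>F z in at_infinity. cmod (deriv (P j) z) \<le> C * cmod z powr D"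
      proof eventually_elim
        case (elim z)
        have p: "cmod z powr D > 0" using elim(2) by auto
        have 1: "cmod (deriv (P j) z - l j * z ^ N) \<le> cmod z powr D"
          using elim(1) p by (simp add: norm_divide divide_less_eq)
        have 2: "cmod (l j * z ^ N) \<le> cmod (l j) * cmod z powr D"
          using D_N
        proof
          assume "D = real N"
          moreover have "0 < cmod z" using elim(2) by linarith
          ultimately have "cmod z powr D = cmod z ^ N" by (simp only: powr_realpow)
          then show ?thesis by (simp add: norm_mult norm_power)
        qed (use j in simp)
        have "cmod (deriv (P j) z) \<le> cmod (deriv (P j) z - l j * z ^ N) + cmod (l j * z ^ N)"
          using norm_triangle_ineq[of "deriv (P j) z - l j * z ^ N" "l j * z ^ N"] by simp
        also have "\<dots> \<le> (1 + cmod (l j)) * cmod z powr D" using 1 2 by (simp add: distrib_right)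
        also have "\<dots> \<le> C * cmod z powr D"
          unfolding C_def using member_le_sum[of j "{..<n}" "\<lambda>j. cmod (l j)"] j by (intro mult_right_mono add_left_mono) auto
        finally show ?case .
      qed
    qed
  qed simp
  moreover have "C \<ge> 0" by (simp add: C_def sum_nonneg add_nonneg_nonneg)
  ultimately show ?thesis by (intro exI[of _ C]) (simp add: Ball_def)
qed

text \<open>If E is empty, f0 has no zeros and exp(P_0) / f0 is bounded and entire, hence constant
  by Liouville. So P_0' = f0'/f0, which is within 2 \<open>kap\<close> of
  \<open>conn\<close>.\<close>

lemma conn_near_exponent_E_empty:
  assumes "E = {}"
  shows "\<exists>j<n. cmod (conn z - deriv (P j) z) \<le> 2 * kap z"
proof -
  have big: "(cmod (f0 z))\<^sup>2 \<ge> S z / 2" for z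
  proof -
    have "z \<notin> E" using assms by simp
    then show ?thesis by (simp add: E_def)
  qed
  have nz: "f0 z \<noteq> 0" for z by (rule f0_logderiv_conn(1)[OF big])
  define q where "q = (\<lambda>z. app (a 0) z / f0 z)"
  have "cmod (q z) \<le> Ka" for z
  proof -
    have "sqrt (S z - (cmod (f0 z))\<^sup>2) \<le> cmod (f0 z)"
      using real_sqrt_le_mono[of "S z - (cmod (f0 z))\<^sup>2" "(cmod (f0 z))\<^sup>2"] big[of z] by simp
    then have "cmod (app (a 0) z) \<le> Ka * cmod (f0 z)"
      unfolding app_a[OF n_pos] using Ka_ge1
      by (intro order_trans[OF exp_P_le[OF n_pos]] mult_left_mono) auto
    then show ?thesis using nz[of z] by (simp add: q_def norm_divide divide_le_eq)
  qed
  then have "bounded (range q)" unfolding bounded_iff by auto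
  moreover have "q holomorphic_on UNIV"
    unfolding q_def by (intro holomorphic_on_divide app_hol f0_hol nz)
  ultimately have "q constant_on UNIV" by (intro Liouville_theorem)
  then obtain k where "\<And>z. q z = k" by (auto simp: constant_on_def)
  moreover have "app (a 0) z = q z * f0 z" for z using nz[of z] by (simp add: q_def)
  ultimately have qk: "app (a 0) z = k * f0 z" for z by simp
  have k: "k \<noteq> 0" using qk[of z] app_a[OF n_pos, of z] by auto
  have "deriv (app (a 0)) z = k * deriv f0 z"
  proof (rule DERIV_imp_deriv)
    have "(f0 has_field_derivative deriv f0 z) (at z)" by (rule holomorphic_derivI[OF f0_hol[of UNIV]]) auto
    from DERIV_cmult[OF this, of k] show "(app (a 0) has_field_derivative k * deriv f0 z) (at z)"
      by (simp add: qk[abs_def])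
  qed
  then have "deriv (P 0) z = deriv f0 z / f0 z"
    unfolding deriv_exp_P[OF n_pos] qk using k nz[of z] by (simp add: field_simps)
  then show ?thesis using f0_logderiv_conn(2)[OF big[of z]] n_pos
    by (metis norm_minus_commute)
qed

lemma nearest_E:
  assumes "E \<noteq> {}"
  obtains z1 where "z1 \<in> E" "ball z (cmod (z1 - z)) \<inter> E = {}"
proof -
  obtain z1 where z1: "z1 \<in> E" "\<And>y. y \<in> E \<Longrightarrow> dist z z1 \<le> dist z y"
    using distance_attains_inf[OF closed_E assms] by blast
  have "ball z (cmod (z1 - z)) \<inter> E = {}"
    using z1(2) by (force simp: dist_norm norm_minus_commute)
  with z1 show thesis by (intro that)
qed

text \<open>Near E the remainder keeps at least a quarter of \<open>S\<close>. An exponent whose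
  derivative is far from \<open>conn\<close> has |exp P_j| small compared with |f|, by
  \<open>app_conn_le\<close>; if all were far, \<open>S_minus_f0_le\<close> would make the remainder
  too short.\<close>

lemma conn_near_exponent_near_E:
  assumes z1: "z1 \<in> E" and k: "\<And>w. w \<in> closed_segment z z1 \<Longrightarrow> kap w \<le> k" and d: "k * cmod (z1 - z) \<le> 1 / 8"
  shows "\<exists>j<n. cmod (conn z - deriv (P j) z) \<le> 4 * Ka * Kb * kap z"
proof (rule ccontr)
  assume neg: "\<not> ?thesis"
  have "\<bar>(cmod (f0 z))\<^sup>2 / S z - (cmod (f0 z1))\<^sup>2 / S z1\<bar> \<le> 2 * (nrm (\<lambda>i. cnj (e i)))\<^sup>2 * k * cmod (z - z1)"
    unfolding f0_def by (rule ratio_lipschitz[of "closed_segment z z1"]) (auto simp: k)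
  then have "(cmod (f0 z))\<^sup>2 / S z \<le> (cmod (f0 z1))\<^sup>2 / S z1 + 1/4"
    using d by (simp add: nrm_e norm_minus_commute)
  moreover have "(cmod (f0 z1))\<^sup>2 / S z1 \<le> 1/2" using z1 S_pos[of z1] by (simp add: E_def field_simps)
  ultimately have "(cmod (f0 z))\<^sup>2 / S z \<le> 3/4" by linarith
  then have "(cmod (f0 z))\<^sup>2 \<le> 3/4 * S z" using S_pos[of z] by (simp add: field_simps)
  then have "S z / 4 \<le> S z - (cmod (f0 z))\<^sup>2" by simp
  then have "sqrt (S z / 4) \<le> sqrt (S z - (cmod (f0 z))\<^sup>2)" by (rule real_sqrt_le_mono)
  then have half: "sqrt (S z) / 2 \<le> sqrt (S z - (cmod (f0 z))\<^sup>2)" by (simp add: real_sqrt_divide)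
  have ss: "sqrt (S z) > 0" using S_pos[of z] by simp
  have "sqrt (S z - (cmod (f0 z))\<^sup>2) \<le> Kb * (sqrt (S z) / (4 * Kb))"
  proof (rule S_minus_f0_le)
    fix j assume j: "j < n"
    have far: "4 * Ka * Kb * kap z < cmod (deriv (P j) z - conn z)" using neg j by (force simp: norm_minus_commute)
    have "cmod (deriv (P j) z - conn z) * cmod (exp (P j z)) = cmod (deriv (app (a j)) z - conn z * app (a j) z)"
      unfolding deriv_exp_P[OF j] app_a[OF j] by (simp only: norm_mult[symmetric] left_diff_distrib)
    also have "\<dots> \<le> nrm (a j) * (kap z * sqrt (S z))"
      using app_conn_le[of "a j" z] by (simp add: mult.assoc)
    also have "\<dots> \<le> Ka * (kap z * sqrt (S z))"
      by (intro mult_right_mono nrm_a_le j) (simp add: kap_nonneg)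
    finally have 1: "cmod (deriv (P j) z - conn z) * cmod (exp (P j z)) \<le> Ka * kap z * sqrt (S z)" by (simp add: mult.assoc)
    show "cmod (exp (P j z)) \<le> sqrt (S z) / (4 * Kb)"
    proof (rule ccontr)
      assume "\<not> ?thesis"
      then have 2: "sqrt (S z) / (4 * Kb) < cmod (exp (P j z))" by simp
      have pos: "cmod (deriv (P j) z - conn z) > 0"
        using far kap_nonneg[of z] Ka_ge1 Kb_ge1 by (meson mult_nonneg_nonneg order_le_less_trans order_trans zero_le_one zero_le_numeral)
      have "Ka * kap z * sqrt (S z) = (4 * Ka * Kb * kap z) * (sqrt (S z) / (4 * Kb))"
        using Kb_ge1 by simp
      also have "\<dots> \<le> cmod (deriv (P j) z - conn z) * (sqrt (S z) / (4 * Kb))"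
        using far ss Kb_ge1 by (intro mult_right_mono) auto
      also have "\<dots> < cmod (deriv (P j) z - conn z) * cmod (exp (P j z))"
        by (rule mult_strict_left_mono[OF 2 pos])
      finally show False using 1 by simp
    qed
  qed (use ss Kb_ge1 in auto)
  also have "\<dots> = sqrt (S z) / 4" using Kb_ge1 by simp
  finally show False using half ss by simp
qed

lemma powr_scale_le:
  assumes "0 \<le> cmod w" "cmod w \<le> 3 * r" "r \<ge> 0"
  shows "cmod w powr D \<le> 3 powr D * r powr D"
  using powr_mono2[OF D_nonneg assms(1,2)] assms by (simp add: powr_mult)

text \<open>Here C may depend on the hyperplanes; its purpose is that the rescaling argument starts
  from a finite infimum. Points within 1 / (8 k1 |z|^D) of E fall under the near estimate, and for
  the others L / dist is at most 8 L k1 |z|^D.\<close>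

lemma conn_apriori: "\<exists>C\<ge>0. \<forall>\<^sub>F z in at_infinity. \<exists>j<n. cmod (conn z - deriv (P j) z) \<le> C * cmod z powr D"
proof (cases "E = {}")
  case True
  have "\<forall>\<^sub>F z in at_infinity. \<exists>j<n. cmod (conn z - deriv (P j) z) \<le> (2 * (\<kappa> + 1)) * cmod z powr D"
    using kap_asymp[OF zero_less_one]
  proof eventually_elim
    case (elim z)
    obtain j where "j < n" "cmod (conn z - deriv (P j) z) \<le> 2 * kap z"
      using conn_near_exponent_E_empty[OF True] by blast
    moreover have "2 * kap z \<le> 2 * (\<kappa> + 1) * cmod z powr D"
      unfolding mult.assoc by (rule mult_left_mono) (use elim in simp_all)
    ultimately show ?case by (meson order_trans)
  qed
  then show ?thesis using \<kappa>_nonneg by (intro exI[of _ "2 * (\<kappa> + 1)"]) auto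
next
  case False
  then obtain e1 where e1: "e1 \<in> E" by blast
  obtain k where k: "k \<ge> 0" "\<And>z. kap z \<le> (\<kappa> + 1) * cmod z powr D + k"
    using kap_global_bound[OF zero_less_one] by blast
  define k1 where "k1 = (\<kappa> + 1) * 3 powr D + k"
  have "(\<kappa> + 1) * 3 powr D > 0" by (rule mult_pos_pos) (use \<kappa>_nonneg in auto)
  then have k1: "k1 > 0" unfolding k1_def using k(1) by linarith
  define L where "L = 6 + 6 * ln (2 * Ka * Kb)"
  have "2 * Ka * Kb \<ge> 1" using Ka_ge1 Kb_ge1 mult_mono[of 1 Ka 1 Kb] by simp
  then have L: "L \<ge> 0" by (simp add: L_def)
  define C where "C = 4 * Ka * Kb * k1 + (20 * k1 + 8 * L * k1)"
  have C: "C \<ge> 0" "4 * Ka * Kb * k1 \<le> C" "20 * k1 + 8 * L * k1 \<le> C"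
    using Ka_ge1 Kb_ge1 k1 L by (auto simp: C_def)
  have "\<exists>j<n. cmod (conn z - deriv (P j) z) \<le> C * cmod z powr D" if z: "cmod z \<ge> 1 + cmod e1" for z
  proof -
    define r where "r = cmod z powr D"
    have r1: "r \<ge> 1" unfolding r_def using z by (intro ge_one_powr_ge_zero D_nonneg) (auto intro: order_trans[of _ "1 + cmod e1"])
    obtain z1 where z1: "z1 \<in> E" "ball z (cmod (z1 - z)) \<inter> E = {}" using nearest_E[OF False] by blast
    have "cmod (z1 - z) \<le> cmod (e1 - z)"
      using z1(2) e1 by (force simp: dist_norm norm_minus_commute not_less)
    also have "\<dots> \<le> 2 * cmod z" using norm_triangle_ineq4[of e1 z] z by simp
    \<comment> \<open>The segment to the nearest point of E thus stays in modulus below 3 |z|, which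
      is the source of the factor \<open>3 powr D\<close>.\<close>
    finally have R: "cmod (z1 - z) \<le> 2 * cmod z" .
    have kw: "kap w \<le> k1 * r" if "w \<in> closed_segment z z1" for w
    proof -
      have "cmod (w - z) \<le> cmod (z1 - z)" using segment_bound(1)[OF that] by simp
      then have "cmod w \<le> 3 * cmod z" using R norm_triangle_ineq[of "w - z" z] by simp
      then have "cmod w powr D \<le> 3 powr D * r" unfolding r_def by (intro powr_scale_le) auto
      then have "(\<kappa> + 1) * cmod w powr D + k \<le> (\<kappa> + 1) * (3 powr D * r) + k * r"
        using \<kappa>_nonneg k(1) r1 by (intro add_mono mult_left_mono) (auto simp: mult_le_cancel_left1)
      then show ?thesis using k(2)[of w] by (simp add: k1_def algebra_simps)
    qed
    show ?thesis
    proof (cases "k1 * r * cmod (z1 - z) \<le> 1 / 8")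
      case True
      from conn_near_exponent_near_E[OF z1(1) kw this]
      obtain j where j: "j < n" "cmod (conn z - deriv (P j) z) \<le> 4 * Ka * Kb * kap z" by blast
      have "4 * Ka * Kb * kap z \<le> 4 * Ka * Kb * (k1 * r)"
        using kw[of z] Ka_ge1 Kb_ge1 by (intro mult_left_mono) auto
      also have "\<dots> = 4 * Ka * Kb * k1 * r" by simp
      also have "\<dots> \<le> C * r" using C r1 by (intro mult_right_mono) auto
      finally show ?thesis using j by (auto simp: r_def)
    next
      case False2: False
      have kr: "k1 * r > 0" using k1 r1 by simp
      have R0: "cmod (z1 - z) > 0" using False2 by (cases "z1 = z") auto
      from conn_near_exponent_off_E[OF z1(2,1) refl R0]
      obtain j where j: "j < n" "cmod (conn z - deriv (P j) z) \<le> 18 * kap z1 + 2 * kap z + L / cmod (z1 - z)"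
        unfolding L_def by blast
      have "L / cmod (z1 - z) \<le> L * (8 * (k1 * r))"
      proof -
        have "1 / cmod (z1 - z) \<le> 8 * (k1 * r)" using False2 R0 by (simp add: field_simps)
        from mult_left_mono[OF this L] show ?thesis by simp
      qed
      then have "cmod (conn z - deriv (P j) z) \<le> 18 * (k1 * r) + 2 * (k1 * r) + L * (8 * (k1 * r))"
        using j(2) kw[of z] kw[of z1] by simp
      also have "\<dots> = (20 * k1 + 8 * L * k1) * r" by (simp add: algebra_simps)
      also have "\<dots> \<le> C * r" using C r1 by (intro mult_right_mono) auto
      finally show ?thesis using j by (auto simp: r_def)
    qed
  qed
  then show ?thesis using C(1) unfolding eventually_at_infinity by blast
qed

text \<open>Supplies the local bound on the variation of log |f| that makes the rescaled curves a
  normal family.\<close>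

lemma conn_bound: "\<exists>C>0. \<forall>\<^sub>F z in at_infinity. cmod (conn z) \<le> C * cmod z powr D"
proof -
  obtain C1 where C1: "C1 \<ge> 0" "\<forall>\<^sub>F z in at_infinity. \<exists>j<n. cmod (conn z - deriv (P j) z) \<le> C1 * cmod z powr D"
    using conn_apriori by blast
  obtain C2 where C2: "C2 \<ge> 0" "\<forall>\<^sub>F z in at_infinity. \<forall>j<n. cmod (deriv (P j) z) \<le> C2 * cmod z powr D"
    using deriv_P_bound by blast
  have "\<forall>\<^sub>F z in at_infinity. cmod (conn z) \<le> (C1 + C2 + 1) * cmod z powr D"
    using C1(2) C2(2)
  proof eventually_elim
    case (elim z)
    then obtain j where j: "j < n" "cmod (conn z - deriv (P j) z) \<le> C1 * cmod z powr D" by blast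
    have "cmod (conn z) \<le> cmod (conn z - deriv (P j) z) + cmod (deriv (P j) z)"
      using norm_triangle_ineq[of "conn z - deriv (P j) z" "deriv (P j) z"] by simp
    also have "\<dots> \<le> C1 * cmod z powr D + C2 * cmod z powr D" using j elim(2) by (intro add_mono) auto
    also have "\<dots> \<le> (C1 + C2 + 1) * cmod z powr D" by (simp add: distrib_right)
    finally show ?case .
  qed
  then show ?thesis using C1(1) C2(1) by (intro exI[of _ "C1 + C2 + 1"]) auto
qed

text \<open>At distance T |z|^(-D) from E the hyperplane-dependent term L / dist is at most
  (\<epsilon>/3) |z|^D for large T, which leaves only the coefficients 18 and 2 of the boundary
  estimate. The nearest point z1 of E may stay bounded, and there \<open>kap\<close> is controlled
  only by a constant k; D > 0 makes the resulting 20 k negligible against |z|^D.\<close>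

lemma conn_near_exponent_far:
  assumes D: "D > 0" and \<epsilon>: "\<epsilon> > 0"
  shows "\<exists>T. \<forall>\<^sub>F z in at_infinity. (\<forall>w\<in>E. T \<le> cmod (w - z) * cmod z powr D) \<longrightarrow>
     (\<exists>j<n. cmod (conn z - deriv (P j) z) \<le> ((18 * 3 powr D + 2) * \<kappa> + \<epsilon>) * cmod z powr D)"
proof -
  define c3 where "c3 = 18 * 3 powr D + 2"
  have c3: "c3 > 0" by (simp add: c3_def add_pos_pos)
  define \<delta> where "\<delta> = \<epsilon> / (3 * c3)"
  have \<delta>: "\<delta> > 0" using \<epsilon> c3 by (simp add: \<delta>_def)
  obtain k where k: "k \<ge> 0" "\<And>z. kap z \<le> (\<kappa> + \<delta>) * cmod z powr D + k"
    using kap_global_bound[OF \<delta>] by blast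
  define L where "L = 6 + 6 * ln (2 * Ka * Kb)"
  have "2 * Ka * Kb \<ge> 1" using Ka_ge1 Kb_ge1 mult_mono[of 1 Ka 1 Kb] by simp
  then have L: "L \<ge> 6" by (simp add: L_def)
  define T where "T = 3 * L / \<epsilon>"
  have T: "T > 0" using L \<epsilon> by (simp add: T_def)
  have lim: "filterlim (\<lambda>z::complex. cmod z powr D) at_top at_infinity"
    using D by (rule filterlim_norm_powr)
  obtain e1 where e1: "E \<noteq> {} \<longrightarrow> e1 \<in> E" by blast
  have ev1: "\<forall>\<^sub>F z in at_infinity. 20 * k / (\<epsilon>/3) + 1 \<le> cmod z powr D"
    using lim unfolding filterlim_at_top by blast
  have ev2: "\<forall>\<^sub>F z in at_infinity. cmod z \<ge> 1 + cmod e1"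
    unfolding eventually_at_infinity by blast
  have "\<forall>\<^sub>F z in at_infinity. (\<forall>w\<in>E. T \<le> cmod (w - z) * cmod z powr D) \<longrightarrow>
     (\<exists>j<n. cmod (conn z - deriv (P j) z) \<le> (c3 * \<kappa> + \<epsilon>) * cmod z powr D)"
    using ev1 ev2
  proof eventually_elim
    case (elim z)
    define r where "r = cmod z powr D"
    have r: "r \<ge> 1" "20 * k \<le> \<epsilon>/3 * r"
    proof -
      have "0 \<le> 20 * k / (\<epsilon>/3)" using k(1) \<epsilon> by simp
      then show "r \<ge> 1" using elim(1) unfolding r_def by linarith
      have "20 * k / (\<epsilon>/3) \<le> r" using elim(1) unfolding r_def by linarith
      then show "20 * k \<le> \<epsilon>/3 * r" using \<epsilon> by (simp add: field_simps)
    qed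
    have e3: "c3 * (\<kappa> + \<delta>) = c3 * \<kappa> + \<epsilon>/3" using c3 by (simp add: \<delta>_def field_simps)
    show ?case
    proof
      assume far: "\<forall>w\<in>E. T \<le> cmod (w - z) * cmod z powr D"
      show "\<exists>j<n. cmod (conn z - deriv (P j) z) \<le> (c3 * \<kappa> + \<epsilon>) * cmod z powr D"
      proof (cases "E = {}")
        case True
        obtain j where j: "j < n" "cmod (conn z - deriv (P j) z) \<le> 2 * kap z"
          using conn_near_exponent_E_empty[OF True] by blast
        have "2 * kap z \<le> 2 * ((\<kappa> + \<delta>) * r) + 2 * k" using k(2)[of z] by (simp add: r_def)
        also have "2 * ((\<kappa> + \<delta>) * r) \<le> c3 * ((\<kappa> + \<delta>) * r)"
          using \<kappa>_nonneg \<delta> r by (intro mult_right_mono) (auto simp: c3_def)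
        also have "\<dots> = (c3 * \<kappa> + \<epsilon>/3) * r" by (simp only: e3[symmetric] mult.assoc)
        also have "(c3 * \<kappa> + \<epsilon>/3) * r + 2 * k \<le> (c3 * \<kappa> + \<epsilon>/3) * r + \<epsilon>/3 * r"
          using r k(1) by simp
        also have "\<dots> \<le> (c3 * \<kappa> + \<epsilon>) * r"
          using r \<epsilon> by (simp add: distrib_right)
        finally show ?thesis using j by (auto simp: r_def)
      next
        case False
        obtain z1 where z1: "z1 \<in> E" "ball z (cmod (z1 - z)) \<inter> E = {}" using nearest_E[OF False] by blast
        have "cmod (z1 - z) \<le> cmod (e1 - z)"
          using z1(2) e1 False by (force simp: dist_norm norm_minus_commute not_less)
        also have "\<dots> \<le> 2 * cmod z" using norm_triangle_ineq4[of e1 z] elim by simp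
        finally have "cmod z1 \<le> 3 * cmod z" using norm_triangle_ineq[of "z1 - z" z] by simp
        then have "cmod z1 powr D \<le> 3 powr D * r" unfolding r_def by (intro powr_scale_le) auto
        then have "(\<kappa> + \<delta>) * cmod z1 powr D \<le> (\<kappa> + \<delta>) * (3 powr D * r)"
          using \<kappa>_nonneg \<delta> by (intro mult_left_mono) auto
        then have kz1: "kap z1 \<le> (\<kappa> + \<delta>) * (3 powr D * r) + k" using k(2)[of z1] by simp
        have Tr: "T \<le> cmod (z1 - z) * r" using far z1(1) by (simp add: r_def)
        have R0: "cmod (z1 - z) > 0" using Tr T by (cases "z1 = z") auto
        from conn_near_exponent_off_E[OF z1(2,1) refl R0]
        obtain j where j: "j < n" "cmod (conn z - deriv (P j) z) \<le> 18 * kap z1 + 2 * kap z + L / cmod (z1 - z)"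
          unfolding L_def by blast
        have kz: "kap z \<le> (\<kappa> + \<delta>) * r + k" using k(2)[of z] by (simp add: r_def)
        have Lr: "L / cmod (z1 - z) \<le> \<epsilon>/3 * r"
          using Tr R0 \<epsilon> by (simp add: T_def field_simps)
        have "cmod (conn z - deriv (P j) z) \<le> 18 * ((\<kappa> + \<delta>) * (3 powr D * r) + k) + 2 * ((\<kappa> + \<delta>) * r + k) + \<epsilon>/3 * r"
          by (rule order_trans[OF j(2)]) (intro add_mono mult_left_mono kz1 kz Lr; simp)
        also have "\<dots> = (c3 * (\<kappa> + \<delta>)) * r + 20 * k + \<epsilon>/3 * r" by (simp add: c3_def algebra_simps)
        also have "\<dots> \<le> (c3 * \<kappa> + \<epsilon>/3) * r + \<epsilon>/3 * r + \<epsilon>/3 * r"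
          unfolding e3 using r by simp
        also have "\<dots> = (c3 * \<kappa> + \<epsilon>) * r" by (simp add: algebra_simps)
        finally show ?thesis using j by (auto simp: r_def)
      qed
    qed
  qed
  then show ?thesis unfolding c3_def by blast
qed

end

section \<open>Rescaling\<close>

lemma Montel_finite_family:
  fixes F :: "nat \<Rightarrow> 'i \<Rightarrow> complex \<Rightarrow> complex"
  assumes "finite I"
    and "\<And>k i. i \<in> I \<Longrightarrow> F k i holomorphic_on UNIV"
    and "\<And>i X. i \<in> I \<Longrightarrow> \<exists>B. \<forall>k. \<forall>z\<in>cball 0 X. cmod (F k i z) \<le> B"
  shows "\<exists>\<phi> r. strict_mono (r :: nat \<Rightarrow> nat) \<and>
    (\<forall>i\<in>I. \<phi> i holomorphic_on UNIV \<and> (\<forall>K. compact K \<longrightarrow> uniform_limit K (\<lambda>k. F (r k) i) (\<phi> i) sequentially))"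
  using assms
proof (induction I rule: finite_induct)
  case empty
  show ?case by (rule exI, rule exI[of _ id]) (auto simp: strict_mono_def)
next
  case (insert x J)
  then obtain \<phi> r where r: "strict_mono (r :: nat \<Rightarrow> nat)"
    and \<phi>: "\<And>i. i \<in> J \<Longrightarrow> \<phi> i holomorphic_on UNIV"
      "\<And>i K. i \<in> J \<Longrightarrow> compact K \<Longrightarrow> uniform_limit K (\<lambda>k. F (r k) i) (\<phi> i) sequentially"
    by (metis insertCI)
  obtain g q where g: "g holomorphic_on UNIV" "strict_mono (q :: nat \<Rightarrow> nat)"
    "\<And>K. compact K \<Longrightarrow> uniform_limit K ((\<lambda>k. F (r k) x) \<circ> q) g sequentially"
  proof (rule Montel[of UNIV "range (\<lambda>k. F k x)" "\<lambda>k. F (r k) x"])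
    show "\<exists>B. \<forall>h\<in>range (\<lambda>k. F k x). \<forall>z\<in>K. cmod (h z) \<le> B" if K: "compact K" for K
    proof -
      obtain X where X: "\<forall>z\<in>K. norm z \<le> X" using compact_imp_bounded[OF K] by (auto simp: bounded_iff)
      obtain B where "\<forall>k. \<forall>z\<in>cball 0 X. cmod (F k x z) \<le> B" using insert.prems(2)[of x X] by blast
      then show ?thesis using X by (intro exI[of _ B]) auto
    qed
  qed (use insert.prems(1) in auto)
  have sub: "uniform_limit K (\<lambda>k. F (r (q k)) i) (\<phi> i) sequentially" if "i \<in> J" "compact K" for i K
    using filterlim_compose[OF \<phi>(2)[OF that] filterlim_subseq[OF g(2)]] by (simp add: o_def)
  show ?case
  proof (intro exI[of _ "\<phi>(x := g)"] exI[of _ "r \<circ> q"] conjI ballI allI impI)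
    show "strict_mono (r \<circ> q)" using r g(2) by (rule strict_mono_o)
    fix i assume i: "i \<in> insert x J"
    show "(\<phi>(x := g)) i holomorphic_on UNIV" using g(1) \<phi>(1) i by (cases "i = x") auto
    show "uniform_limit K (\<lambda>k. F ((r \<circ> q) k) i) ((\<phi>(x := g)) i) sequentially" if "compact K" for K
      using g(3)[OF that] sub[OF _ that] i by (cases "i = x") (auto simp: o_def)
  qed
qed

lemma curve_limit:
  fixes F :: "nat \<Rightarrow> 'i \<Rightarrow> complex \<Rightarrow> complex"
  assumes F: "\<And>k. curve I (F k)" and \<phi>: "curve I \<phi>"
    and lim: "\<And>i K. i \<in> I \<Longrightarrow> compact K \<Longrightarrow> uniform_limit K (\<lambda>k. F k i) (\<phi> i) sequentially"
  shows "(\<lambda>k. curve.S I (F k) z) \<longlonglongrightarrow> curve.S I \<phi> z"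
    and "(\<lambda>k. curve.conn I (F k) z) \<longlonglongrightarrow> curve.conn I \<phi> z"
    and "(\<lambda>k. curve.kap I (F k) z) \<longlonglongrightarrow> curve.kap I \<phi> z"
    and "(\<lambda>k. curve.app I (F k) c z) \<longlonglongrightarrow> curve.app I \<phi> c z"
    and "(\<lambda>k. deriv (curve.app I (F k) c) z) \<longlonglongrightarrow> deriv (curve.app I \<phi> c) z"
proof -
  interpret \<phi>: curve I \<phi> by fact
  have 0: "(\<lambda>k. F k i z) \<longlonglongrightarrow> \<phi> i z" if "i \<in> I" for i
    by (rule tendsto_uniform_limitI[OF lim[OF that, of "{z}"]]) auto
  have 1: "(\<lambda>k. deriv (F k i) z) \<longlonglongrightarrow> deriv (\<phi> i) z" if "i \<in> I" for i
  proof (rule deriv_complex_uniform_limit[where A = "ball z 1"])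
    show "uniform_limit (ball z 1) (\<lambda>k. F k i) (\<phi> i) sequentially"
      by (rule uniform_limit_on_subset[OF lim[OF that compact_cball[of z 1]]]) auto
    show "\<forall>\<^sub>F k in sequentially. F k i holomorphic_on ball z 1"
      by (intro always_eventually allI holomorphic_on_subset[OF curve.hol[OF F that]]) simp
  qed auto
  show S: "(\<lambda>k. curve.S I (F k) z) \<longlonglongrightarrow> \<phi>.S z"
    unfolding \<phi>.S_def curve.S_def[OF F] by (intro tendsto_intros 0)
  have nzS: "\<phi>.S z \<noteq> 0" "complex_of_real (\<phi>.S z) \<noteq> 0" using \<phi>.S_pos[of z] by auto
  show conn: "(\<lambda>k. curve.conn I (F k) z) \<longlonglongrightarrow> \<phi>.conn z"
    unfolding \<phi>.conn_def curve.conn_def[OF F] by (intro tendsto_intros 0 1 S nzS)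
  show "(\<lambda>k. curve.kap I (F k) z) \<longlonglongrightarrow> \<phi>.kap z"
    unfolding \<phi>.kap_def curve.kap_def[OF F] by (intro tendsto_intros 0 1 S conn nzS)
  show "(\<lambda>k. curve.app I (F k) c z) \<longlonglongrightarrow> \<phi>.app c z"
    unfolding \<phi>.app_def curve.app_def[OF F] by (intro tendsto_intros 0)
  show "(\<lambda>k. deriv (curve.app I (F k) c) z) \<longlonglongrightarrow> deriv (\<phi>.app c) z"
    unfolding \<phi>.deriv_app curve.deriv_app[OF F] by (intro tendsto_intros 1)
qed

lemma uniform_limit_tendsto_at:
  fixes g :: "'a::metric_space \<Rightarrow> 'b::real_normed_vector"
  assumes ul: "uniform_limit K F g sequentially" and cont: "continuous_on K g"
    and ev: "\<forall>\<^sub>F k in sequentially. x k \<in> K" and x: "x \<longlonglongrightarrow> l" and l: "l \<in> K"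
  shows "(\<lambda>k. F k (x k)) \<longlonglongrightarrow> g l"
proof -
  have 1: "(\<lambda>k. g (x k)) \<longlonglongrightarrow> g l" by (rule continuous_on_tendsto_compose[OF cont x l ev])
  have 2: "(\<lambda>k. F k (x k) - g (x k)) \<longlonglongrightarrow> 0"
  proof (rule tendstoI)
    fix \<epsilon> :: real assume "\<epsilon> > 0"
    from uniform_limitD[OF ul this] ev show "\<forall>\<^sub>F k in sequentially. dist (F k (x k) - g (x k)) 0 < \<epsilon>"
      by eventually_elim (simp add: dist_norm)
  qed
  from tendsto_add[OF 2 1] show ?thesis by simp
qed

text \<open>Montel's theorem wants a bound for all members of the sequence, whereas the rescaled
  curves are uniformly bounded only from some index on.\<close>

lemma eventually_bounded_imp_bounded:
  fixes g :: "nat \<Rightarrow> 'a \<Rightarrow> real"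
  assumes "\<And>k. \<exists>B. \<forall>x\<in>A. g k x \<le> B" and "\<forall>\<^sub>F k in sequentially. \<forall>x\<in>A. g k x \<le> B0"
  shows "\<exists>B. \<forall>k. \<forall>x\<in>A. g k x \<le> B"
proof -
  obtain b where b: "\<And>k x. x \<in> A \<Longrightarrow> g k x \<le> b k" using assms(1) by metis
  obtain m where m: "\<And>k x. k \<ge> m \<Longrightarrow> x \<in> A \<Longrightarrow> g k x \<le> B0"
    using assms(2) unfolding eventually_sequentially by blast
  have "g k x \<le> \<bar>B0\<bar> + (\<Sum>i<m. \<bar>b i\<bar>)" if x: "x \<in> A" for k x
  proof (cases "k < m")
    case True
    then have "\<bar>b k\<bar> \<le> (\<Sum>i<m. \<bar>b i\<bar>)" by (intro member_le_sum) auto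
    then show ?thesis using b[OF x, of k] by linarith
  next
    case False
    moreover have "0 \<le> (\<Sum>i<m. \<bar>b i\<bar>)" by (intro sum_nonneg) auto
    ultimately show ?thesis using m[of k x] x by linarith
  qed
  then show ?thesis by blast
qed

section \<open>Normal families: limits of rescaled curves violate the gap\<close>

context asymptotic_curve
begin

text \<open>Let M be the infimum of the admissible constants, finite by \<open>conn_apriori\<close>,
  and suppose c is not admissible, so M >= c. Points where M is nearly attained lie close to E, by
  \<open>conn_near_exponent_far\<close>. Rescaling there by 1 / (M |z|^D) yields a limit curve with
  \<open>kap\<close> <= \<kappa> / M <= t. Its \<open>conn\<close> is within 1 of some frequency
  everywhere, because M is the infimum, and at least 1 away from all of them at the origin; a limit
  of points of E serves as x0. This is what \<open>BT\<close> forbids.\<close>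

lemma conn_limsup_aux:
  assumes D: "D > 0" and t: "t > 0"
    and BT: "\<And>\<phi> \<mu> x0. \<lbrakk>curve I \<phi>; \<And>z. curve.kap I \<phi> z \<le> t;
       \<And>c. (\<Sum>i\<in>I. c i * e i) = 0 \<Longrightarrow> \<exists>\<beta>. \<forall>z. curve.app I \<phi> c z = (\<Sum>j<n. \<beta> j * exp (\<mu> j * z));
       \<And>z. \<exists>j<n. cmod (curve.conn I \<phi> z - \<mu> j) \<le> 1;
       \<And>j. j < n \<Longrightarrow> 1 \<le> cmod (curve.conn I \<phi> 0 - \<mu> j);
       (cmod (curve.app I \<phi> (\<lambda>i. cnj (e i)) x0))\<^sup>2 \<le> curve.S I \<phi> x0 / 2\<rbrakk> \<Longrightarrow> False"
    and c: "c > (18 * 3 powr D + 2 + 1 / t) * \<kappa>"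
  shows "\<forall>\<^sub>F z in at_infinity. \<exists>j<n. cmod (conn z - deriv (P j) z) \<le> c * cmod z powr D"
proof (rule ccontr)
  assume notgood: "\<not> ?thesis"
  define good where "good = (\<lambda>c. \<forall>\<^sub>F z in at_infinity. \<exists>j<n. cmod (conn z - deriv (P j) z) \<le> c * cmod z powr D)"
  have mono: "good c'" if "good c" "c \<le> c'" for c c'
    using that(1) unfolding good_def
  proof eventually_elim
    case (elim z)
    then obtain j where "j < n" "cmod (conn z - deriv (P j) z) \<le> c * cmod z powr D" by blast
    moreover have "c * cmod z powr D \<le> c' * cmod z powr D" using that(2) by (intro mult_right_mono) auto
    ultimately show ?case by (meson order_trans)
  qed
  define G where "G = {c. good c \<and> c \<ge> 0}"
  obtain C where C: "C \<in> G" using conn_apriori by (auto simp: G_def good_def)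
  have lb: "c \<le> x" if "x \<in> G" for x
    using mono[of x c] that notgood by (force simp: G_def good_def)
  have bdd: "bdd_below G" using lb by (meson bdd_belowI)
  define M where "M = Inf G"
  have cM: "c \<le> M" unfolding M_def using C lb by (intro cInf_greatest) auto
  have goodM: "good x" if xM: "x > M" for x
  proof -
    have "\<exists>y\<in>G. y < x" using cInf_lessD[of G x] xM C unfolding M_def by blast
    then obtain y where "y \<in> G" "y < x" by blast
    then show ?thesis using mono[of y x] by (auto simp: G_def)
  qed
  have badM: "\<not> good x" if "x < M" "x \<ge> 0" for x
    using cInf_lower[OF _ bdd, of x] that by (auto simp: G_def M_def)
  define c0 where "c0 = 18 * 3 powr D + 2"
  have c00: "c0 > 0" by (simp add: c0_def add_pos_pos)
  \<comment> \<open>The threshold for c adds up two requirements: M > c0 \<kappa>, so that points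
    far from E satisfy the bound with a constant below M, and \<kappa> / M <= t, so that the limit
    curve falls under the gap.\<close>
  have M: "M > c0 * \<kappa>" "\<kappa> / M \<le> t" "M > 0"
  proof -
    have 1: "(18 * 3 powr D + 2 + 1 / t) * \<kappa> = c0 * \<kappa> + \<kappa> / t" by (simp add: c0_def distrib_right)
    have 2: "\<kappa> / t \<ge> 0" "c0 * \<kappa> \<ge> 0" using t c00 \<kappa>_nonneg by auto
    show "M > c0 * \<kappa>" using c cM 1 2 by linarith
    then show M0: "M > 0" using 2 by linarith
    have "M > \<kappa> / t" using c cM 1 2 by linarith
    then show "\<kappa> / M \<le> t" using M0 t by (simp add: field_simps)
  qed
  define \<epsilon> where "\<epsilon> = (M - c0 * \<kappa>) / 2"
  have \<epsilon>: "\<epsilon> > 0" using M by (simp add: \<epsilon>_def)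
  obtain T where T: "\<forall>\<^sub>F z in at_infinity. (\<forall>w\<in>E. T \<le> cmod (w - z) * cmod z powr D) \<longrightarrow>
     (\<exists>j<n. cmod (conn z - deriv (P j) z) \<le> (c0 * \<kappa> + \<epsilon>) * cmod z powr D)"
    using conn_near_exponent_far[OF D \<epsilon>] unfolding c0_def by blast
  \<comment> \<open>These constants increase to M and are not admissible, yet they are at least c0
    \<kappa> + \<epsilon>, so a point violating the bound with one of them cannot be far from
    E.\<close>
  define d where "d = (\<lambda>k. M - \<epsilon> / (real k + 1))"
  have d: "d k < M" "d k \<ge> c0 * \<kappa> + \<epsilon>" for k
  proof -
    show "d k < M" using \<epsilon> by (simp add: d_def)
    have "\<epsilon> / (real k + 1) \<le> \<epsilon> / 1" using \<epsilon> by (intro divide_left_mono) auto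
    then show "d k \<ge> c0 * \<kappa> + \<epsilon>" by (simp add: d_def \<epsilon>_def field_simps)
  qed
  have d0: "d k \<ge> 0" for k using d(2)[of k] c00 \<kappa>_nonneg \<epsilon> by (smt (verit) mult_nonneg_nonneg)
  have "\<exists>z w. cmod z \<ge> real k + 1 \<and> w \<in> E \<and> cmod (w - z) * cmod z powr D < T \<and>
      (\<forall>j<n. d k * cmod z powr D < cmod (conn z - deriv (P j) z))" for k
  proof (rule ccontr)
    assume neg: "\<not> ?thesis"
    have "\<forall>\<^sub>F z::complex in at_infinity. cmod z \<ge> real k + 1" unfolding eventually_at_infinity by blast
    with T have "\<forall>\<^sub>F z in at_infinity. \<exists>j<n. cmod (conn z - deriv (P j) z) \<le> d k * cmod z powr D"
    proof eventually_elim
      case (elim z)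
      show ?case
      proof (cases "\<forall>w\<in>E. T \<le> cmod (w - z) * cmod z powr D")
        case True
        then obtain j where "j < n" "cmod (conn z - deriv (P j) z) \<le> (c0 * \<kappa> + \<epsilon>) * cmod z powr D" using elim(1) by blast
        moreover have "(c0 * \<kappa> + \<epsilon>) * cmod z powr D \<le> d k * cmod z powr D" using d(2) by (intro mult_right_mono) auto
        ultimately show ?thesis by (meson order_trans)
      next
        case False
        then show ?thesis using neg elim(2) by (meson not_le)
      qed
    qed
    then show False using badM[OF d(1) d0] by (simp add: good_def)
  qed
  then obtain Z0 w0 where Z0: "\<And>k. cmod (Z0 k) \<ge> real k + 1" "\<And>k. w0 k \<in> E"
    "\<And>k. cmod (w0 k - Z0 k) * cmod (Z0 k) powr D < T"
    "\<And>k j. j < n \<Longrightarrow> d k * cmod (Z0 k) powr D < cmod (conn (Z0 k) - deriv (P j) (Z0 k))"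
    by metis
  \<comment> \<open>The position of the nearby point of E in the rescaled coordinate. It stays in
    the disc of radius T M, so it converges along a subsequence, simultaneously with the direction
    of the centres.\<close>
  define \<zeta>0 where "\<zeta>0 = (\<lambda>k. (w0 k - Z0 k) * of_real (M * cmod (Z0 k) powr D))"
  have inK: "\<forall>k. (sgn (Z0 k), \<zeta>0 k) \<in> cball 0 1 \<times> cball 0 (T * M)"
  proof
    fix k
    have "cmod (\<zeta>0 k) = (cmod (w0 k - Z0 k) * cmod (Z0 k) powr D) * M" using M by (simp add: \<zeta>0_def norm_mult)
    also have "\<dots> \<le> T * M" using Z0(3)[of k] M by (intro mult_right_mono) auto
    finally show "(sgn (Z0 k), \<zeta>0 k) \<in> cball 0 1 \<times> cball 0 (T * M)" by (simp add: norm_sgn)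
  qed
  obtain lz s where s: "strict_mono (s :: nat \<Rightarrow> nat)"
    and lz: "((\<lambda>k. (sgn (Z0 k), \<zeta>0 k)) \<circ> s) \<longlonglongrightarrow> lz"
    using seq_compactE[OF compact_imp_seq_compact[OF compact_Times[OF compact_cball compact_cball]] inK] by blast
  define \<omega> where "\<omega> = fst lz"
  define \<zeta>l where "\<zeta>l = snd lz"
  have sk: "k \<le> s k" for k using s by (rule seq_suble)
  define Z where "Z = Z0 \<circ> s"
  define \<rho> where "\<rho> = (\<lambda>k. 1 / (M * cmod (Z k) powr D))"
  have Zge: "cmod (Z k) \<ge> real k + 1" for k using Z0(1)[of "s k"] sk[of k] by (simp add: Z_def)
  have Zpos: "cmod (Z k) > 0" "cmod (Z k) \<ge> 1" for k using Zge[of k] by auto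
  have Zn: "Z k \<noteq> 0" for k using Zpos[of k] by auto
  have Ztop: "filterlim (\<lambda>k. cmod (Z k)) at_top sequentially"
  proof (rule filterlim_at_top_mono[OF filterlim_real_sequentially], intro always_eventually allI)
    show "real k \<le> cmod (Z k)" for k using Zge[of k] by linarith
  qed
  have \<rho>: "\<rho> k > 0" "\<rho> k \<le> 1 / M" "\<rho> k * cmod (Z k) powr D = 1 / M" for k
  proof -
    have p: "cmod (Z k) powr D \<ge> 1" using Zpos[of k] D by (intro ge_one_powr_ge_zero) auto
    then have "cmod (Z k) powr D > 0" by linarith
    then show "\<rho> k > 0" "\<rho> k * cmod (Z k) powr D = 1 / M" using M(3) by (simp_all add: \<rho>_def)
    have "M * 1 \<le> M * cmod (Z k) powr D" using p M by (intro mult_left_mono) auto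
    then show "\<rho> k \<le> 1 / M" unfolding \<rho>_def using M p by (intro divide_left_mono mult_pos_pos) auto
  qed
  have sgnlim: "(\<lambda>k. sgn (Z k)) \<longlonglongrightarrow> \<omega>"
    using tendsto_fst[OF lz] by (simp add: o_def Z_def \<omega>_def)
  have \<zeta>lim: "(\<lambda>k. \<zeta>0 (s k)) \<longlonglongrightarrow> \<zeta>l"
    using tendsto_snd[OF lz] by (simp add: o_def \<zeta>l_def)
  have \<omega>1: "cmod \<omega> = 1"
    using LIMSEQ_unique[OF tendsto_norm[OF sgnlim], of 1] Zn by (simp add: norm_sgn)
  define W where "W = (\<lambda>k \<zeta>. Z k + of_real (\<rho> k) * \<zeta>)"
  have Wnear: "cmod (W k \<zeta> - Z k) \<le> X / M" if "cmod \<zeta> \<le> X" for k \<zeta> X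
  proof -
    have "cmod (W k \<zeta> - Z k) = \<rho> k * cmod \<zeta>" using \<rho>(1)[of k] by (simp add: W_def norm_mult)
    also have "\<dots> \<le> 1 / M * X" using that \<rho>[of k] M by (intro mult_mono) auto
    finally show ?thesis by simp
  qed
  have Wge: "cmod (W k \<zeta>) \<ge> cmod (Z k) - cmod \<zeta> / M" for k \<zeta>
    using Wnear[of \<zeta> "cmod \<zeta>" k] norm_triangle_ineq2[of "Z k" "Z k - W k \<zeta>"] by (simp add: norm_minus_commute)
  have Wtop: "filterlim (\<lambda>k. W k \<zeta>) at_infinity sequentially" for \<zeta>
  proof (rule filterlim_norm_at_top_imp_at_infinity)
    have "filterlim (\<lambda>k. - (cmod \<zeta> / M) + cmod (Z k)) at_top sequentially"
      by (rule filterlim_tendsto_add_at_top[OF tendsto_const Ztop])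
    then show "filterlim (\<lambda>k. cmod (W k \<zeta>)) at_top sequentially"
      by (rule filterlim_at_top_mono) (use Wge in \<open>auto simp: algebra_simps\<close>)
  qed
  have WZ: "(\<lambda>k. W k \<zeta> / of_real (cmod (Z k))) \<longlonglongrightarrow> \<omega>" for \<zeta>
  proof -
    have "(\<lambda>k. sgn (Z k) + of_real (\<rho> k) * \<zeta> / of_real (cmod (Z k))) \<longlonglongrightarrow> \<omega> + 0"
    proof (rule tendsto_add[OF sgnlim])
      have "(\<lambda>k. (cmod \<zeta> / M) / cmod (Z k)) \<longlonglongrightarrow> 0"
        by (rule real_tendsto_divide_at_top[OF tendsto_const Ztop])
      then show "(\<lambda>k. of_real (\<rho> k) * \<zeta> / of_real (cmod (Z k))) \<longlonglongrightarrow> 0"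
      proof (rule Lim_null_comparison[rotated], intro always_eventually allI)
        fix k
        have "\<rho> k * cmod \<zeta> \<le> 1 / M * cmod \<zeta>" using \<rho>(2)[of k] by (intro mult_right_mono) auto
        then have "\<rho> k * cmod \<zeta> / cmod (Z k) \<le> (cmod \<zeta> / M) / cmod (Z k)"
          by (intro divide_right_mono) auto
        then show "cmod (of_real (\<rho> k) * \<zeta> / of_real (cmod (Z k))) \<le> (cmod \<zeta> / M) / cmod (Z k)"
          using \<rho>(1)[of k] by (simp only: norm_mult norm_divide norm_of_real abs_norm_cancel abs_of_pos)
      qed
    qed
    moreover have "sgn (Z k) + of_real (\<rho> k) * \<zeta> / of_real (cmod (Z k)) = W k \<zeta> / of_real (cmod (Z k))" for k
      by (simp add: W_def sgn_eq add_divide_distrib)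
    ultimately show ?thesis by simp
  qed
  have ratio: "(\<lambda>k. \<rho> k * cmod (W k \<zeta>) powr D) \<longlonglongrightarrow> 1 / M" for \<zeta>
  proof -
    have "(\<lambda>k. (cmod (W k \<zeta> / of_real (cmod (Z k)))) powr D) \<longlonglongrightarrow> cmod \<omega> powr D"
      by (intro tendsto_powr tendsto_norm WZ tendsto_const) (simp add: \<omega>1)
    then have "(\<lambda>k. 1 / M * (cmod (W k \<zeta>) / cmod (Z k)) powr D) \<longlonglongrightarrow> 1 / M * 1"
      by (intro tendsto_mult tendsto_const) (simp add: \<omega>1 norm_divide)
    moreover have "1 / M * (cmod (W k \<zeta>) / cmod (Z k)) powr D = \<rho> k * cmod (W k \<zeta>) powr D" for k
      by (simp add: \<rho>_def powr_divide)
    ultimately show ?thesis by simp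
  qed
  \<comment> \<open>Under rescaling P_j' tends to a constant: if D = N, the power |Z|^N cancels
    against \<rho> and only the limit direction \<omega> remains. If all \<open>l j\<close> vanish,
    so do all \<mu> j.\<close>
  define \<mu> where "\<mu> = (\<lambda>j. l j * \<omega> ^ N / of_real M)"
  have P\<mu>: "(\<lambda>k. of_real (\<rho> k) * deriv (P j) (W k \<zeta>)) \<longlonglongrightarrow> \<mu> j" if j: "j < n" for j \<zeta>
  proof -
    define h where "h = (\<lambda>z. (deriv (P j) z - l j * z ^ N) / of_real (cmod z powr D))"
    have h: "(\<lambda>k. h (W k \<zeta>)) \<longlonglongrightarrow> 0"
      unfolding h_def by (rule filterlim_compose[OF P_asymp[OF j] Wtop])
    have 1: "(\<lambda>k. h (W k \<zeta>) * of_real (\<rho> k * cmod (W k \<zeta>) powr D)) \<longlonglongrightarrow> 0 * of_real (1 / M)"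
      by (intro tendsto_mult h tendsto_of_real ratio)
    have 2: "(\<lambda>k. of_real (\<rho> k) * (l j * W k \<zeta> ^ N)) \<longlonglongrightarrow> \<mu> j"
      using D_N
    proof
      assume DN: "D = real N"
      have "of_real (\<rho> k) * (l j * W k \<zeta> ^ N) = l j * (W k \<zeta> / of_real (cmod (Z k))) ^ N / of_real M" for k
        using Zpos[of k] by (simp add: \<rho>_def DN powr_realpow power_divide)
      moreover have "(\<lambda>k. l j * (W k \<zeta> / of_real (cmod (Z k))) ^ N / of_real M) \<longlonglongrightarrow> \<mu> j"
        unfolding \<mu>_def using M by (intro tendsto_intros WZ) auto
      ultimately show ?thesis by simp
    qed (use j in \<open>simp add: \<mu>_def\<close>)
    have "\<forall>\<^sub>F k in sequentially. cmod (W k \<zeta>) > 0"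
      using filterlim_compose[OF filterlim_norm_at_top Wtop[of \<zeta>]] unfolding filterlim_at_top_dense by blast
    then have "\<forall>\<^sub>F k in sequentially. h (W k \<zeta>) * of_real (\<rho> k * cmod (W k \<zeta>) powr D) + of_real (\<rho> k) * (l j * W k \<zeta> ^ N)
       = of_real (\<rho> k) * deriv (P j) (W k \<zeta>)"
      by eventually_elim (simp add: h_def field_simps)
    with tendsto_add[OF 1 2] show ?thesis
      by (simp add: tendsto_cong)
  qed
  define cc where "cc = (\<lambda>k. 1 / complex_of_real (sqrt (S (Z k))))"
  define F where "F = (\<lambda>k i \<zeta>. cc k * f i (W k \<zeta>))"
  have cc0: "cc k \<noteq> 0" for k by (simp add: cc_def)
  have ncc: "(cmod (cc k))\<^sup>2 = 1 / S (Z k)" for k by (simp add: cc_def norm_divide power_divide)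
  have Whol: "W k holomorphic_on UNIV" for k unfolding W_def by (intro holomorphic_intros)
  have dW: "deriv (W k) \<zeta> = of_real (\<rho> k)" for k \<zeta>
    unfolding W_def by (rule DERIV_imp_deriv) (auto intro!: derivative_eq_intros)
  have F: "curve I (F k)" and FS: "curve.S I (F k) \<zeta> = S (W k \<zeta>) / S (Z k)"
    and Fapp: "curve.app I (F k) v \<zeta> = cc k * app v (W k \<zeta>)"
    and Fconn: "curve.conn I (F k) \<zeta> = of_real (\<rho> k) * conn (W k \<zeta>)"
    and Fkap: "curve.kap I (F k) \<zeta> = \<rho> k * kap (W k \<zeta>)" for k \<zeta> v
    using curve_compose[OF curve_axioms Whol cc0, of k k] \<rho>(1)[of k]
    by (auto simp: F_def dW ncc)
  obtain C1 where C1: "C1 > 0" "\<forall>\<^sub>F z in at_infinity. cmod (conn z) \<le> C1 * cmod z powr D"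
    using conn_bound by blast
  then obtain r0 where r0: "\<And>z. cmod z \<ge> r0 \<Longrightarrow> cmod (conn z) \<le> C1 * cmod z powr D"
    unfolding eventually_at_infinity by blast
  define B where "B = (\<lambda>X. C1 * 3 powr D * X / M)"
  \<comment> \<open>The factor \<open>cc\<close> normalises \<open>S\<close> to 1 at the origin. The
    upper bound gives normality; the lower bound prevents the limit functions from vanishing
    simultaneously, so that the limit is again a curve.\<close>
  have Sbound: "\<forall>\<^sub>F k in sequentially. \<forall>\<zeta>\<in>cball 0 X. exp (- 2 * B X) \<le> curve.S I (F k) \<zeta> \<and> curve.S I (F k) \<zeta> \<le> exp (2 * B X)" for X
  proof (cases "X \<ge> 0")
    case False
    then have "cball (0::complex) X = {}" by simp
    then show ?thesis by simp
  next
    case X: True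
    have "\<forall>\<^sub>F k in sequentially. cmod (Z k) \<ge> \<bar>r0\<bar> + X / M"
      using Ztop unfolding filterlim_at_top by blast
    then show ?thesis
    proof eventually_elim
      case (elim k)
      show ?case
      proof
        fix \<zeta> assume z: "\<zeta> \<in> cball (0::complex) X"
        have Cb: "cmod (conn v) \<le> C1 * 3 powr D * cmod (Z k) powr D" if v: "v \<in> cball (Z k) (\<rho> k * X)" for v
        proof -
          have vz: "cmod (v - Z k) \<le> X / M"
          proof -
            have "cmod (v - Z k) \<le> \<rho> k * X" using v by (simp add: dist_norm norm_minus_commute)
            also have "\<dots> \<le> 1 / M * X" using \<rho>(2)[of k] X by (intro mult_right_mono) auto
            finally show ?thesis by simp
          qed
          have "cmod v \<ge> r0" using vz elim norm_triangle_ineq2[of "Z k" "Z k - v"] by (simp add: norm_minus_commute)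
          then have "cmod (conn v) \<le> C1 * cmod v powr D" by (rule r0)
          also have "cmod v powr D \<le> 3 powr D * cmod (Z k) powr D"
          proof (rule powr_scale_le)
            have "X / M \<le> cmod (Z k)" using elim by linarith
            then show "cmod v \<le> 3 * cmod (Z k)" using vz norm_triangle_ineq[of "v - Z k" "Z k"] Zpos[of k] by simp
          qed auto
          finally show ?thesis using C1(1) by (simp add: mult.assoc mult_left_mono)
        qed
        have "\<bar>lognorm (W k \<zeta>) - lognorm (Z k)\<bar> \<le> (C1 * 3 powr D * cmod (Z k) powr D) * cmod (W k \<zeta> - Z k)"
          by (rule lognorm_lipschitz[of "cball (Z k) (\<rho> k * X)"])
             (use Cb X \<rho>(1)[of k] z in \<open>auto simp: W_def dist_norm norm_mult\<close>)
        also have "cmod (W k \<zeta> - Z k) \<le> \<rho> k * X"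
          using \<rho>(1)[of k] z by (simp add: W_def norm_mult)
        also have "C1 * 3 powr D * cmod (Z k) powr D * (\<rho> k * X) = C1 * 3 powr D * X * (\<rho> k * cmod (Z k) powr D)" by simp
        also have "\<dots> = B X" unfolding \<rho>(3) by (simp add: B_def)
        finally have "\<bar>lognorm (W k \<zeta>) - lognorm (Z k)\<bar> \<le> B X" using C1(1) by (simp add: mult_left_mono)
        then have "\<bar>ln (S (W k \<zeta>) / S (Z k))\<bar> \<le> 2 * B X"
          using S_pos by (simp add: lognorm_def ln_div)
        moreover have "S (W k \<zeta>) / S (Z k) > 0" using S_pos by simp
        ultimately show "exp (- 2 * B X) \<le> curve.S I (F k) \<zeta> \<and> curve.S I (F k) \<zeta> \<le> exp (2 * B X)"
          unfolding FS by (metis abs_le_iff exp_le_cancel_iff exp_ln minus_le_iff mult_minus_left)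
      qed
    qed
  qed
  have Fle: "cmod (F k i \<zeta>) \<le> sqrt (curve.S I (F k) \<zeta>)" if "i \<in> I" for k i \<zeta>
    unfolding curve.S_def[OF F] using that fin
    by (intro real_le_rsqrt member_le_sum) auto
  have Fbd: "\<exists>B. \<forall>k. \<forall>z\<in>cball 0 X. cmod (F k i z) \<le> B" if i: "i \<in> I" for i X
  proof (rule eventually_bounded_imp_bounded)
    fix k
    have "bounded (F k i ` cball 0 X)"
      by (intro compact_imp_bounded compact_continuous_image curve.cont_f[OF F i]) auto
    then show "\<exists>B. \<forall>z\<in>cball 0 X. cmod (F k i z) \<le> B" by (auto simp: bounded_iff)
  next
    show "\<forall>\<^sub>F k in sequentially. \<forall>z\<in>cball 0 X. cmod (F k i z) \<le> sqrt (exp (2 * B X))"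
      using Sbound[of X] by eventually_elim (use Fle[OF i] in \<open>meson order_trans real_sqrt_le_mono\<close>)
  qed
  have "\<exists>\<phi> r. strict_mono (r :: nat \<Rightarrow> nat) \<and>
    (\<forall>i\<in>I. \<phi> i holomorphic_on UNIV \<and> (\<forall>K. compact K \<longrightarrow> uniform_limit K (\<lambda>k. F (r k) i) (\<phi> i) sequentially))"
    by (rule Montel_finite_family[where F = F, OF fin]) (fact curve.hol[OF F], fact Fbd)
  then obtain \<phi> r where r: "strict_mono (r :: nat \<Rightarrow> nat)"
    and \<phi>: "\<And>i. i \<in> I \<Longrightarrow> \<phi> i holomorphic_on UNIV"
      "\<And>i K. i \<in> I \<Longrightarrow> compact K \<Longrightarrow> uniform_limit K (\<lambda>k. F (r k) i) (\<phi> i) sequentially"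
    by blast
  note sub = LIMSEQ_subseq_LIMSEQ[OF _ r, unfolded o_def]
  have Slim: "(\<lambda>k. curve.S I (F (r k)) z) \<longlonglongrightarrow> (\<Sum>i\<in>I. (cmod (\<phi> i z))\<^sup>2)" for z
    unfolding curve.S_def[OF F]
    by (intro tendsto_intros tendsto_uniform_limitI[OF \<phi>(2)[OF _ compact_sing[of z]]]) auto
  have curve\<phi>: "curve I \<phi>"
  proof
    show "\<exists>i\<in>I. \<phi> i z \<noteq> 0" for z
    proof (rule ccontr)
      assume "\<not> ?thesis"
      then have z0: "(\<Sum>i\<in>I. (cmod (\<phi> i z))\<^sup>2) = 0" by simp
      have "\<forall>\<^sub>F k in sequentially. exp (- 2 * B (cmod z)) \<le> curve.S I (F (r k)) z"
        using eventually_subseq[OF r Sbound[of "cmod z"]] by eventually_elim auto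
      from tendsto_lowerbound[OF Slim this] show False by (simp add: z0 not_le)
    qed
  qed (use fin \<phi> in auto)
  interpret \<phi>: curve I \<phi> by (rule curve\<phi>)
  note cl = curve_limit[OF F curve\<phi> \<phi>(2)]
  have Mconn: "(\<lambda>k. of_real (\<rho> (r k)) * conn (W (r k) z) - of_real (\<rho> (r k)) * deriv (P j) (W (r k) z)) \<longlonglongrightarrow> \<phi>.conn z - \<mu> j" if "j < n" for j z
    by (intro tendsto_diff cl(2)[unfolded Fconn] sub P\<mu> that)
  show False
  proof (rule BT[OF curve\<phi>])
    fix z
    show "\<phi>.kap z \<le> t"
    proof (rule field_le_epsilon)
      fix \<delta> :: real assume \<delta>: "\<delta> > 0"
      have ev: "\<forall>\<^sub>F k in sequentially. kap (W (r k) z) \<le> (\<kappa> + \<delta> * M) * cmod (W (r k) z) powr D"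
        using filterlim_compose[OF Wtop[of z] filterlim_subseq[OF r]] kap_asymp[of "\<delta> * M"] \<delta> M
        by (auto simp: filterlim_iff)
      have "\<phi>.kap z \<le> (\<kappa> + \<delta> * M) * (1 / M)"
      proof (rule tendsto_le[OF _ tendsto_mult[OF tendsto_const sub[OF ratio]] cl(3)[unfolded Fkap]])
        show "\<forall>\<^sub>F k in sequentially. \<rho> (r k) * kap (W (r k) z) \<le> (\<kappa> + \<delta> * M) * (\<rho> (r k) * cmod (W (r k) z) powr D)"
          using ev by eventually_elim (use \<rho>(1) in \<open>simp add: mult.left_commute mult_left_mono\<close>)
      qed simp
      also have "\<dots> = \<kappa> / M + \<delta>" using M by (simp add: field_simps)
      finally show "\<phi>.kap z \<le> t + \<delta>" using M by simp
    qed
  next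
    fix v assume v: "(\<Sum>i\<in>I. v i * e i) = 0"
    define \<gamma> where "\<gamma> = (\<lambda>j. \<phi>.app (a j))"
    \<comment> \<open>The rescaled exponents themselves may diverge. The limit is taken in the
      equation y' = P_j' y instead, and it yields \<gamma>' = \<mu> \<gamma>, whose solutions are
      the multiples, possibly zero, of exp(\<mu> z).\<close>
    have \<gamma>exp: "\<gamma> j z = \<gamma> j 0 * exp (\<mu> j * z)" if j: "j < n" for j z
    proof -
      have d\<gamma>: "deriv (\<gamma> j) z = \<mu> j * \<gamma> j z" for z
      proof (rule LIMSEQ_unique)
        show "(\<lambda>k. deriv (curve.app I (F (r k)) (a j)) z) \<longlonglongrightarrow> deriv (\<gamma> j) z"
          unfolding \<gamma>_def by (rule cl(5))
        have "deriv (curve.app I (F k) (a j)) z = (of_real (\<rho> k) * deriv (P j) (W k z)) * curve.app I (F k) (a j) z" for k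
        proof (rule DERIV_imp_deriv)
          have eq: "curve.app I (F k) (a j) = (\<lambda>z. cc k * app (a j) (W k z))" by (rule ext) (rule Fapp)
          have "(W k has_field_derivative of_real (\<rho> k)) (at z)"
            unfolding W_def by (auto intro!: derivative_eq_intros)
          from DERIV_cmult[OF DERIV_chain2[OF app_fd this], of "cc k" "a j"]
          show "(curve.app I (F k) (a j) has_field_derivative (of_real (\<rho> k) * deriv (P j) (W k z)) * curve.app I (F k) (a j) z) (at z)"
            unfolding eq deriv_exp_P[OF j] by (simp add: mult_ac)
        qed
        then show "(\<lambda>k. deriv (curve.app I (F (r k)) (a j)) z) \<longlonglongrightarrow> \<mu> j * \<gamma> j z"
          unfolding \<gamma>_def by (simp only:) (intro tendsto_mult sub P\<mu> j cl(4))
      qed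
      have "((\<lambda>z. \<gamma> j z * exp (- \<mu> j * z)) has_field_derivative 0) (at z)" for z
      proof -
        have "(\<gamma> j has_field_derivative deriv (\<gamma> j) z) (at z)" unfolding \<gamma>_def by (rule \<phi>.app_fd)
        then have "(\<gamma> j has_field_derivative \<mu> j * \<gamma> j z) (at z)" unfolding d\<gamma> .
        then show ?thesis by (auto intro!: derivative_eq_intros)
      qed
      then have "\<exists>c. \<forall>z\<in>UNIV. \<gamma> j z * exp (- \<mu> j * z) = c"
        by (intro has_field_derivative_zero_constant) auto
      then have "\<gamma> j z * exp (- \<mu> j * z) = \<gamma> j 0 * exp (- \<mu> j * 0)" by (metis UNIV_I)
      then show ?thesis by (simp add: exp_minus field_simps)
    qed
    have app_v: "\<phi>.app v z = (\<Sum>j<n. (\<Sum>i\<in>I. v i * b j i) * \<gamma> j z)" for z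
    proof (rule LIMSEQ_unique[OF cl(4)])
      have "curve.app I (F k) v z = (\<Sum>j<n. (\<Sum>i\<in>I. v i * b j i) * curve.app I (F k) (a j) z)" for k
        unfolding Fapp app_orth[OF v] sum_distrib_left by (intro sum.cong refl) (simp add: app_a mult_ac)
      then show "(\<lambda>k. curve.app I (F (r k)) v z) \<longlonglongrightarrow> (\<Sum>j<n. (\<Sum>i\<in>I. v i * b j i) * \<gamma> j z)"
        unfolding \<gamma>_def by (simp only:) (intro tendsto_intros cl(4))
    qed
    have "\<phi>.app v z = (\<Sum>j<n. ((\<Sum>i\<in>I. v i * b j i) * \<gamma> j 0) * exp (\<mu> j * z))" for z
      unfolding app_v by (intro sum.cong refl) (metis \<gamma>exp mult.assoc lessThan_iff)
    then show "\<exists>\<beta>. \<forall>z. \<phi>.app v z = (\<Sum>j<n. \<beta> j * exp (\<mu> j * z))"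
      by (intro exI[of _ "\<lambda>j. (\<Sum>i\<in>I. v i * b j i) * \<gamma> j 0"] allI)
  next
    fix z
    show "\<exists>j<n. cmod (\<phi>.conn z - \<mu> j) \<le> 1"
    proof (rule ccontr)
      assume "\<not> ?thesis"
      then have gt: "cmod (\<phi>.conn z - \<mu> j) > 1" if "j < n" for j using that by force
      define m where "m = Min ((\<lambda>j. cmod (\<phi>.conn z - \<mu> j)) ` {..<n})"
      have m: "m > 1" "\<And>j. j < n \<Longrightarrow> m \<le> cmod (\<phi>.conn z - \<mu> j)"
      proof -
        have ne: "(\<lambda>j. cmod (\<phi>.conn z - \<mu> j)) ` {..<n} \<noteq> {}" using n_pos by auto
        then show "m > 1" unfolding m_def using gt by (subst Min_gr_iff) auto
        show "m \<le> cmod (\<phi>.conn z - \<mu> j)" if "j < n" for j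
          unfolding m_def using that by (intro Min_le) auto
      qed
      \<comment> \<open>Strictly between 1 and m. Then M (1 + m2) / 2 exceeds M, so it is
        admissible, and after rescaling it still gives a distance below m2.\<close>
      define m2 where "m2 = (1 + m) / 2"
      have m2: "1 < m2" "m2 < m" using m by (auto simp: m2_def)
      have "\<forall>\<^sub>F k in sequentially. \<forall>j\<in>{..<n}. m2 < cmod (of_real (\<rho> (r k)) * conn (W (r k) z) - of_real (\<rho> (r k)) * deriv (P j) (W (r k) z))"
      proof (rule eventually_ball_finite, simp, intro ballI)
        fix j assume "j \<in> {..<n}"
        then have j: "j < n" by simp
        show "\<forall>\<^sub>F k in sequentially. m2 < cmod (of_real (\<rho> (r k)) * conn (W (r k) z) - of_real (\<rho> (r k)) * deriv (P j) (W (r k) z))"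
          by (rule order_tendstoD(1)[OF tendsto_norm[OF Mconn[OF j]]]) (use m2 m(2)[OF j] in linarith)
      qed
      moreover have "good (M * ((1 + m2) / 2))" using M m2 by (intro goodM) (simp add: field_simps)
      then have "\<forall>\<^sub>F k in sequentially. \<exists>j<n. cmod (conn (W (r k) z) - deriv (P j) (W (r k) z)) \<le> (M * ((1 + m2) / 2)) * cmod (W (r k) z) powr D"
        unfolding good_def using filterlim_compose[OF Wtop[of z] filterlim_subseq[OF r]]
        by (auto simp: filterlim_iff)
      moreover have "\<forall>\<^sub>F k in sequentially. (M * ((1 + m2) / 2)) * (\<rho> (r k) * cmod (W (r k) z) powr D) < m2"
        by (rule order_tendstoD(2)[OF tendsto_mult[OF tendsto_const sub[OF ratio]]]) (use M m2 in \<open>simp add: field_simps\<close>)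
      ultimately have "\<forall>\<^sub>F k in sequentially. False"
      proof eventually_elim
        case (elim k)
        then obtain j where j: "j < n" "cmod (conn (W (r k) z) - deriv (P j) (W (r k) z)) \<le> (M * ((1 + m2) / 2)) * cmod (W (r k) z) powr D" by blast
        have "m2 < cmod (of_real (\<rho> (r k)) * (conn (W (r k) z) - deriv (P j) (W (r k) z)))"
          using elim(1) j(1) by (simp add: right_diff_distrib)
        also have "\<dots> = \<rho> (r k) * cmod (conn (W (r k) z) - deriv (P j) (W (r k) z))" using \<rho>(1)[of "r k"] by (simp add: norm_mult)
        also have "\<dots> \<le> \<rho> (r k) * ((M * ((1 + m2) / 2)) * cmod (W (r k) z) powr D)"
          using \<rho>(1)[of "r k"] j(2) by (intro mult_left_mono) auto
        also have "\<dots> = (M * ((1 + m2) / 2)) * (\<rho> (r k) * cmod (W (r k) z) powr D)" by simp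
        finally show False using elim(3) by simp
      qed
      then show False by simp
    qed
  next
    fix j assume j: "j < n"
    have W0: "W k 0 = Z k" for k by (simp add: W_def)
    have "(\<lambda>k. (M - \<epsilon> / (real (s (r k)) + 1)) * (1 / M)) \<longlonglongrightarrow> (M - 0) * (1 / M)"
    proof (intro tendsto_intros)
      have "(\<lambda>k. \<epsilon> / (real k + 1)) \<longlonglongrightarrow> 0" by real_asymp
      from LIMSEQ_subseq_LIMSEQ[OF LIMSEQ_subseq_LIMSEQ[OF this s] r]
      show "(\<lambda>k. \<epsilon> / (real (s (r k)) + 1)) \<longlonglongrightarrow> 0" by (simp add: o_def)
    qed
    then have 1: "(\<lambda>k. d (s (r k)) * (1 / M)) \<longlonglongrightarrow> 1" using M by (simp add: d_def)
    show "1 \<le> cmod (\<phi>.conn 0 - \<mu> j)"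
    proof (rule tendsto_le[OF _ tendsto_norm[OF Mconn[OF j]] 1])
      show "\<forall>\<^sub>F k in sequentially. d (s (r k)) * (1 / M) \<le> cmod (of_real (\<rho> (r k)) * conn (W (r k) 0) - of_real (\<rho> (r k)) * deriv (P j) (W (r k) 0))"
      proof (intro always_eventually allI)
        fix k
        have "d (s (r k)) * (1 / M) = \<rho> (r k) * (d (s (r k)) * cmod (Z (r k)) powr D)"
          unfolding \<rho>(3)[of "r k", symmetric] by simp
        also have "\<dots> \<le> \<rho> (r k) * cmod (conn (Z (r k)) - deriv (P j) (Z (r k)))"
          using Z0(4)[OF j, of "s (r k)"] \<rho>(1)[of "r k"] by (intro mult_left_mono) (auto simp: Z_def)
        also have "\<dots> = cmod (of_real (\<rho> (r k)) * (conn (Z (r k)) - deriv (P j) (Z (r k))))"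
          using \<rho>(1)[of "r k"] by (simp add: norm_mult)
        finally show "d (s (r k)) * (1 / M) \<le> cmod (of_real (\<rho> (r k)) * conn (W (r k) 0) - of_real (\<rho> (r k)) * deriv (P j) (W (r k) 0))"
          unfolding W0 right_diff_distrib .
      qed
    qed simp
  next
    define X where "X = cmod \<zeta>l + 1"
    have \<zeta>r: "(\<lambda>k. \<zeta>0 (s (r k))) \<longlonglongrightarrow> \<zeta>l" by (rule sub[OF \<zeta>lim])
    have Flim: "(\<lambda>k. F (r k) i (\<zeta>0 (s (r k)))) \<longlonglongrightarrow> \<phi> i \<zeta>l" if i: "i \<in> I" for i
    proof -
      have "\<forall>\<^sub>F k in sequentially. \<zeta>0 (s (r k)) \<in> ball \<zeta>l 1"
        using tendstoD[OF \<zeta>r, of 1] by (simp add: dist_commute)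
      then have ev: "\<forall>\<^sub>F k in sequentially. \<zeta>0 (s (r k)) \<in> cball \<zeta>l 1" by eventually_elim auto
      show ?thesis
        by (rule uniform_limit_tendsto_at[OF \<phi>(2)[OF i compact_cball[of \<zeta>l 1]] _ ev \<zeta>r])
           (simp_all add: \<phi>.cont_f[OF i])
    qed
    \<comment> \<open>The rescaled points are the chosen points of E, so the closed inequality
      defining E passes to the limit.\<close>
    have Wz: "W k (\<zeta>0 (s k)) = w0 (s k)" for k
    proof -
      have "of_real (\<rho> k) * \<zeta>0 (s k) = (w0 (s k) - Z k) * of_real (\<rho> k * (M * cmod (Z k) powr D))"
        by (simp add: \<zeta>0_def Z_def)
      also have "\<rho> k * (M * cmod (Z k) powr D) = M * (\<rho> k * cmod (Z k) powr D)" by simp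
      also have "\<dots> = 1" unfolding \<rho>(3) using M(3) by simp
      finally show ?thesis by (simp add: W_def)
    qed
    show "(cmod (\<phi>.app (\<lambda>i. cnj (e i)) \<zeta>l))\<^sup>2 \<le> \<phi>.S \<zeta>l / 2"
    proof (rule tendsto_le)
      show "(\<lambda>k. (cmod (curve.app I (F (r k)) (\<lambda>i. cnj (e i)) (\<zeta>0 (s (r k)))))\<^sup>2) \<longlonglongrightarrow> (cmod (\<phi>.app (\<lambda>i. cnj (e i)) \<zeta>l))\<^sup>2"
        unfolding \<phi>.app_def curve.app_def[OF F] by (intro tendsto_intros Flim)
      show "(\<lambda>k. curve.S I (F (r k)) (\<zeta>0 (s (r k))) / 2) \<longlonglongrightarrow> \<phi>.S \<zeta>l / 2"
        unfolding \<phi>.S_def curve.S_def[OF F] by (intro tendsto_intros Flim) simp_all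
      show "\<forall>\<^sub>F k in sequentially. (cmod (curve.app I (F (r k)) (\<lambda>i. cnj (e i)) (\<zeta>0 (s (r k)))))\<^sup>2 \<le> curve.S I (F (r k)) (\<zeta>0 (s (r k))) / 2"
      proof (intro always_eventually allI)
        fix k
        have "(cmod (f0 (w0 (s (r k)))))\<^sup>2 \<le> S (w0 (s (r k))) / 2" using Z0(2)[of "s (r k)"] by (simp add: E_def)
        then show "(cmod (curve.app I (F (r k)) (\<lambda>i. cnj (e i)) (\<zeta>0 (s (r k)))))\<^sup>2 \<le> curve.S I (F (r k)) (\<zeta>0 (s (r k))) / 2"
          unfolding Fapp FS Wz norm_mult power_mult_distrib ncc f0_def[symmetric]
          using S_pos[of "Z (r k)"] by (simp add: field_simps)
      qed
    qed simp
  qed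
qed

end

section \<open>Extension to the exponent zero, and a single exponent near infinity\<close>

lemma filterlim_power2_at_infinity: "filterlim (\<lambda>z::complex. z\<^sup>2) at_infinity at_infinity"
proof (rule filterlim_norm_at_top_imp_at_infinity)
  have "filterlim (\<lambda>x::real. x ^ 2) at_top at_top" by real_asymp
  from filterlim_compose[OF this filterlim_norm_at_top]
  show "filterlim (\<lambda>z::complex. cmod (z\<^sup>2)) at_top at_infinity" by (simp add: norm_power)
qed

lemma powr_cmod_square: "cmod (z\<^sup>2) powr D * cmod z = cmod z powr (2 * D + 1)" if "z \<noteq> 0"
proof -
  have "cmod (z\<^sup>2) powr D = cmod z powr (2 * D)"
    using that by (simp add: norm_power powr_powr[symmetric] powr_realpow[symmetric] flip: powr_numeral)
  then show ?thesis using that by (simp add: powr_add)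
qed

context asymptotic_curve
begin

text \<open>Substituting \<open>z\<^sup>2\<close> for \<open>z\<close> makes the exponent positive; for \<open>D = 0\<close> the bound on the
  Fubini--Study derivative at points of bounded modulus would not be negligible.\<close>

lemma asymptotic_curve_square:
  "asymptotic_curve I (\<lambda>i z. 1 * f i (z\<^sup>2)) e n a b (\<lambda>j z. P j (z\<^sup>2)) (2 * D + 1) (2 * \<kappa>) (2 * N + 1) (\<lambda>j. 2 * l j)"
proof -
  have sq: "(\<lambda>z::complex. z\<^sup>2) holomorphic_on UNIV" by (intro holomorphic_intros)
  have dsq: "deriv (\<lambda>z::complex. z\<^sup>2) z = 2 * z" for z
    by (rule DERIV_imp_deriv) (auto intro!: derivative_eq_intros)
  note cc = curve_compose[OF curve_axioms sq, of 1, simplified dsq, OF one_neq_zero]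
  have dP: "deriv (\<lambda>z. P j (z\<^sup>2)) z = 2 * z * deriv (P j) (z\<^sup>2)" if "j < n" for j z
  proof -
    have "(P j has_field_derivative deriv (P j) (z\<^sup>2)) (at (z\<^sup>2))"
      using holomorphic_derivI[OF P_hol[OF that]] by blast
    moreover have "((\<lambda>z::complex. z\<^sup>2) has_field_derivative 2 * z) (at z)"
      by (auto intro!: derivative_eq_intros)
    ultimately have "((\<lambda>z. P j (z\<^sup>2)) has_field_derivative deriv (P j) (z\<^sup>2) * (2 * z)) (at z)"
      by (rule DERIV_chain2)
    then show ?thesis by (simp add: DERIV_imp_deriv mult.commute)
  qed
  have nz: "\<forall>\<^sub>F z::complex in at_infinity. z \<noteq> 0"
    unfolding eventually_at_infinity by (intro exI[of _ 1]) auto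
  interpret g: curve I "\<lambda>i z. 1 * f i (z\<^sup>2)" using cc(1) by simp
  show ?thesis
  proof
    show "(\<Sum>i\<in>I. (cmod (e i))\<^sup>2) = 1" by (rule e_unit)
    show "(\<lambda>z. P j (z\<^sup>2)) holomorphic_on UNIV" if "j < n" for j
      using holomorphic_on_compose_gen[OF sq P_hol[OF that]] by (simp add: o_def)
    show "g.app (a j) z = exp (P j (z\<^sup>2))" if "j < n" for j z
      using cc(3)[of "a j" z] app_a[OF that, of "z\<^sup>2"] by simp
    show "(\<Sum>i\<in>I. a j i * e i) = 0" if "j < n" for j by (rule a_e[OF that])
    show "1 * f i (z\<^sup>2) = g.app (\<lambda>i. cnj (e i)) z * e i + (\<Sum>j<n. b j i * exp (P j (z\<^sup>2)))" if "i \<in> I" for i z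
      using cc(3)[of "\<lambda>i. cnj (e i)" z] decomp[OF that, of "z\<^sup>2"] by simp
    show "0 < n" by (rule n_pos)
    show "0 \<le> 2 * D + 1" "0 \<le> 2 * \<kappa>" using D_nonneg \<kappa>_nonneg by auto
    show "2 * D + 1 = real (2 * N + 1) \<or> (\<forall>j<n. 2 * l j = 0)" using D_N by auto
  next
    fix \<epsilon> :: real assume \<epsilon>: "\<epsilon> > 0"
    have "\<forall>\<^sub>F z in at_infinity. kap z \<le> (\<kappa> + \<epsilon> / 2) * cmod z powr D" by (rule kap_asymp) (use \<epsilon> in simp)
    then have "\<forall>\<^sub>F z in at_infinity. kap (z\<^sup>2) \<le> (\<kappa> + \<epsilon> / 2) * cmod (z\<^sup>2) powr D"
      using filterlim_power2_at_infinity unfolding filterlim_iff by blast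
    with nz show "\<forall>\<^sub>F z in at_infinity. g.kap z \<le> (2 * \<kappa> + \<epsilon>) * cmod z powr (2 * D + 1)"
    proof eventually_elim
      case (elim z)
      have "g.kap z = 2 * cmod z * kap (z\<^sup>2)" using cc(5)[of z] by (simp add: norm_mult)
      also have "\<dots> \<le> 2 * cmod z * ((\<kappa> + \<epsilon> / 2) * cmod (z\<^sup>2) powr D)"
        using elim(2) by (intro mult_left_mono) auto
      also have "\<dots> = (2 * \<kappa> + \<epsilon>) * (cmod (z\<^sup>2) powr D * cmod z)" by (simp add: algebra_simps)
      finally show ?case unfolding powr_cmod_square[OF elim(1)] .
    qed
  next
    fix j assume j: "j < n"
    define h where "h = (\<lambda>z. (deriv (P j) z - l j * z ^ N) / of_real (cmod z powr D))"
    have "((\<lambda>z. h (z\<^sup>2)) \<longlongrightarrow> 0) at_infinity"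
      unfolding h_def by (rule filterlim_compose[OF P_asymp[OF j] filterlim_power2_at_infinity])
    then have "((\<lambda>z. 2 * cmod (h (z\<^sup>2))) \<longlongrightarrow> 2 * 0) at_infinity"
      by (intro tendsto_intros tendsto_norm_zero)
    then have lim: "((\<lambda>z. 2 * cmod (h (z\<^sup>2))) \<longlongrightarrow> 0) at_infinity" by simp
    show "((\<lambda>z. (deriv (\<lambda>z. P j (z\<^sup>2)) z - 2 * l j * z ^ (2 * N + 1)) / of_real (cmod z powr (2 * D + 1))) \<longlongrightarrow> 0) at_infinity"
    proof (rule Lim_null_comparison[OF _ lim])
      show "\<forall>\<^sub>F z in at_infinity. cmod ((deriv (\<lambda>z. P j (z\<^sup>2)) z - 2 * l j * z ^ (2 * N + 1)) / of_real (cmod z powr (2 * D + 1))) \<le> 2 * cmod (h (z\<^sup>2))"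
        using nz
      proof eventually_elim
        case (elim z)
        have "deriv (\<lambda>z. P j (z\<^sup>2)) z - 2 * l j * z ^ (2 * N + 1) = 2 * z * (deriv (P j) (z\<^sup>2) - l j * (z\<^sup>2) ^ N)"
          unfolding dP[OF j] by (simp add: power_mult[symmetric] algebra_simps)
        then have "cmod ((deriv (\<lambda>z. P j (z\<^sup>2)) z - 2 * l j * z ^ (2 * N + 1)) / of_real (cmod z powr (2 * D + 1)))
           = 2 * cmod z * cmod (deriv (P j) (z\<^sup>2) - l j * (z\<^sup>2) ^ N) / (cmod (z\<^sup>2) powr D * cmod z)"
          unfolding powr_cmod_square[OF elim] by (simp add: norm_mult norm_divide)
        also have "\<dots> = 2 * cmod (h (z\<^sup>2))" using elim by (simp add: h_def norm_divide)
        finally show ?case by simp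
      qed
    qed
  qed
qed

text \<open>The case of positive exponent is applied to f(z^2) and read back through a square root.
  The distance from \<open>conn\<close> to P_j' gains the factor 2 z and \<kappa> the factor 2, so
  the factors 2 cancel and |z| is absorbed by the exponent 2 D + 1, which remains visible in the
  constant.\<close>

lemma conn_limsup:
  assumes t: "t > 0"
    and BT: "\<And>\<phi> \<mu> x0. \<lbrakk>curve I \<phi>; \<And>z. curve.kap I \<phi> z \<le> t;
       \<And>c. (\<Sum>i\<in>I. c i * e i) = 0 \<Longrightarrow> \<exists>\<beta>. \<forall>z. curve.app I \<phi> c z = (\<Sum>j<n. \<beta> j * exp (\<mu> j * z));
       \<And>z. \<exists>j<n. cmod (curve.conn I \<phi> z - \<mu> j) \<le> 1;
       \<And>j. j < n \<Longrightarrow> 1 \<le> cmod (curve.conn I \<phi> 0 - \<mu> j);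
       (cmod (curve.app I \<phi> (\<lambda>i. cnj (e i)) x0))\<^sup>2 \<le> curve.S I \<phi> x0 / 2\<rbrakk> \<Longrightarrow> False"
    and c: "c > (18 * 3 powr (2 * D + 1) + 2 + 1 / t) * \<kappa>"
  shows "\<forall>\<^sub>F z in at_infinity. \<exists>j<n. cmod (conn z - deriv (P j) z) \<le> c * cmod z powr D"
proof -
  interpret g: asymptotic_curve I "\<lambda>i z. 1 * f i (z\<^sup>2)" e n a b "\<lambda>j z. P j (z\<^sup>2)" "2 * D + 1" "2 * \<kappa>" "2 * N + 1" "\<lambda>j. 2 * l j"
    by (rule asymptotic_curve_square)
  have sq: "(\<lambda>z::complex. z\<^sup>2) holomorphic_on UNIV" by (intro holomorphic_intros)
  have dsq: "deriv (\<lambda>z::complex. z\<^sup>2) z = 2 * z" for z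
    by (rule DERIV_imp_deriv) (auto intro!: derivative_eq_intros)
  have gconn: "g.conn z = 2 * z * conn (z\<^sup>2)" for z
    using curve_compose(4)[OF curve_axioms sq, of 1 z] by (simp add: dsq)
  have dP: "deriv (\<lambda>z. P j (z\<^sup>2)) z = 2 * z * deriv (P j) (z\<^sup>2)" if "j < n" for j z
  proof -
    have "(P j has_field_derivative deriv (P j) (z\<^sup>2)) (at (z\<^sup>2))"
      using holomorphic_derivI[OF P_hol[OF that]] by blast
    moreover have "((\<lambda>z::complex. z\<^sup>2) has_field_derivative 2 * z) (at z)"
      by (auto intro!: derivative_eq_intros)
    ultimately have "((\<lambda>z. P j (z\<^sup>2)) has_field_derivative deriv (P j) (z\<^sup>2) * (2 * z)) (at z)"
      by (rule DERIV_chain2)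
    then show ?thesis by (simp add: DERIV_imp_deriv mult.commute)
  qed
  have "\<forall>\<^sub>F z in at_infinity. \<exists>j<n. cmod (g.conn z - deriv (\<lambda>z. P j (z\<^sup>2)) z) \<le> (2 * c) * cmod z powr (2 * D + 1)"
  proof (rule g.conn_limsup_aux[OF _ t BT])
    show "2 * D + 1 > 0" using D_nonneg by simp
    have "(18 * 3 powr (2 * D + 1) + 2 + 1 / t) * (2 * \<kappa>) = 2 * ((18 * 3 powr (2 * D + 1) + 2 + 1 / t) * \<kappa>)"
      by (simp only: mult.left_commute)
    then show "(18 * 3 powr (2 * D + 1) + 2 + 1 / t) * (2 * \<kappa>) < 2 * c" using c by linarith
  qed
  then obtain r where r: "\<And>z. r \<le> cmod z \<Longrightarrow> \<exists>j<n. cmod (g.conn z - deriv (\<lambda>z. P j (z\<^sup>2)) z) \<le> (2 * c) * cmod z powr (2 * D + 1)"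
    unfolding eventually_at_infinity by blast
  have "\<exists>j<n. cmod (conn w - deriv (P j) w) \<le> c * cmod w powr D" if w: "cmod w \<ge> (\<bar>r\<bar> + 1)\<^sup>2" for w
  proof -
    define z where "z = csqrt w"
    have zw: "z\<^sup>2 = w" by (simp add: z_def)
    have "(\<bar>r\<bar> + 1)\<^sup>2 \<le> (cmod z)\<^sup>2" using w by (simp add: zw[symmetric] norm_power)
    then have rz: "\<bar>r\<bar> + 1 \<le> cmod z" by (rule power2_le_imp_le) simp
    then have z0: "z \<noteq> 0" by auto
    have "r \<le> cmod z" using rz by linarith
    from r[OF this] obtain j where j: "j < n" "cmod (g.conn z - deriv (\<lambda>z. P j (z\<^sup>2)) z) \<le> (2 * c) * cmod z powr (2 * D + 1)"
      by blast
    have "g.conn z - deriv (\<lambda>z. P j (z\<^sup>2)) z = 2 * z * (conn w - deriv (P j) w)"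
      unfolding gconn dP[OF j(1)] zw by (simp add: algebra_simps)
    then have "cmod (g.conn z - deriv (\<lambda>z. P j (z\<^sup>2)) z) = 2 * cmod z * cmod (conn w - deriv (P j) w)"
      by (simp only: norm_mult norm_numeral)
    then have "2 * cmod z * cmod (conn w - deriv (P j) w) \<le> 2 * c * (cmod w powr D * cmod z)"
      using j(2) unfolding powr_cmod_square[OF z0, symmetric] zw by simp
    also have "\<dots> = 2 * cmod z * (c * cmod w powr D)" by simp
    finally have "2 * cmod z * cmod (conn w - deriv (P j) w) \<le> 2 * cmod z * (c * cmod w powr D)" .
    then show ?thesis using z0 j(1) by auto
  qed
  then show ?thesis unfolding eventually_at_infinity by blast
qed

text \<open>The quotient \<open>conn z / z ^ N\<close> maps the connected complement of a disc into
  n discs of radius 2 c about the \<open>l j\<close>. Its image has diameter at most 4 n c, so it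
  stays within (4 n + 2) c of one fixed \<open>l j\<close>; returning from
  \<open>l j * z ^ N\<close> to P_j' costs another c. If all \<open>l j\<close> vanish, any index
  will do.\<close>

lemma conn_near_single_exponent:
  fixes c :: real
  assumes c: "c > 0" and near: "\<forall>\<^sub>F z in at_infinity. \<exists>j<n. cmod (conn z - deriv (P j) z) \<le> c * cmod z powr D"
  shows "\<exists>j<n. \<forall>\<^sub>F z in at_infinity. cmod (conn z - deriv (P j) z) \<le> (4 * n + 3) * c * cmod z powr D"
proof -
  have "\<forall>\<^sub>F z in at_infinity. \<forall>j\<in>{..<n}. cmod (deriv (P j) z - l j * z ^ N) \<le> c * cmod z powr D"
  proof (rule eventually_ball_finite, simp, intro ballI)
    fix j assume "j \<in> {..<n}"
    then have j: "j < n" by simp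
    have "\<forall>\<^sub>F z in at_infinity. cmod ((deriv (P j) z - l j * z ^ N) / of_real (cmod z powr D)) < c"
      using tendstoD[OF P_asymp[OF j] c] by (simp add: dist_norm)
    moreover have "\<forall>\<^sub>F z::complex in at_infinity. z \<noteq> 0"
      unfolding eventually_at_infinity by (intro exI[of _ 1]) auto
    ultimately show "\<forall>\<^sub>F z in at_infinity. cmod (deriv (P j) z - l j * z ^ N) \<le> c * cmod z powr D"
      by eventually_elim (simp add: norm_divide divide_less_eq)
  qed
  with near have "\<forall>\<^sub>F z in at_infinity. (\<forall>j<n. cmod (deriv (P j) z - l j * z ^ N) \<le> c * cmod z powr D) \<and>
      (\<exists>j<n. cmod (conn z - deriv (P j) z) \<le> c * cmod z powr D)"
    by eventually_elim auto
  then obtain r where r: "\<And>z j. r \<le> cmod z \<Longrightarrow> j < n \<Longrightarrow> cmod (deriv (P j) z - l j * z ^ N) \<le> c * cmod z powr D"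
    "\<And>z. r \<le> cmod z \<Longrightarrow> \<exists>j<n. cmod (conn z - deriv (P j) z) \<le> c * cmod z powr D"
    unfolding eventually_at_infinity by blast
  have r2: "\<exists>j<n. cmod (conn z - l j * z ^ N) \<le> 2 * c * cmod z powr D" if z: "r \<le> cmod z" for z
  proof -
    obtain j where j: "j < n" "cmod (conn z - deriv (P j) z) \<le> c * cmod z powr D" using r(2)[OF z] by blast
    have "cmod (conn z - l j * z ^ N) \<le> cmod (conn z - deriv (P j) z) + cmod (deriv (P j) z - l j * z ^ N)"
      using norm_triangle_ineq[of "conn z - deriv (P j) z" "deriv (P j) z - l j * z ^ N"] by simp
    also have "\<dots> \<le> 2 * c * cmod z powr D" using j r(1)[OF z j(1)] by simp
    finally show ?thesis using j by blast
  qed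
  define U where "U = - cball (0::complex) (\<bar>r\<bar> + 1)"
  have U: "r \<le> cmod z" "1 \<le> cmod z" "z \<noteq> 0" if "z \<in> U" for z using that by (auto simp: U_def)
  have "\<exists>j<n. \<forall>z\<in>U. cmod (conn z - l j * z ^ N) \<le> (4 * n + 2) * c * cmod z powr D"
    using D_N
  proof
    assume l0: "\<forall>j<n. l j = 0"
    have "cmod (conn z - l 0 * z ^ N) \<le> (4 * n + 2) * c * cmod z powr D" if "r \<le> cmod z" for z
    proof -
      have "cmod (conn z) \<le> 2 * c * cmod z powr D" using r2[OF that] l0 by auto
      also have "\<dots> \<le> (4 * n + 2) * c * cmod z powr D" using c by (intro mult_right_mono) auto
      finally show ?thesis using l0 n_pos by simp
    qed
    then show ?thesis using n_pos U(1) by (intro exI[of _ 0] conjI ballI) blast+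
  next
    assume DN: "D = real N"
    define q where "q = (\<lambda>z. conn z / z ^ N)"
    have qU: "cmod (q z - l j) = cmod (conn z - l j * z ^ N) / cmod z powr D" if "z \<noteq> 0" for z j
    proof -
      have "q z - l j = (conn z - l j * z ^ N) / z ^ N" using that by (simp add: q_def field_simps)
      then show ?thesis using that by (simp add: norm_divide norm_power DN powr_realpow)
    qed
    have conU: "connected (q ` U)"
    proof (rule connected_continuous_image)
      show "continuous_on U q" unfolding q_def by (intro continuous_intros cont_conn) (use U in auto)
      show "connected U" unfolding U_def by (rule connected_complement_bounded_convex) auto
    qed
    have subU: "q ` U \<subseteq> (\<Union>j<n. cball (l j) (2 * c))"
    proof
      fix w assume "w \<in> q ` U"
      then obtain z where z: "z \<in> U" "w = q z" by blast
      obtain j where j: "j < n" "cmod (conn z - l j * z ^ N) \<le> 2 * c * cmod z powr D" using r2 U(1)[OF z(1)] by blast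
      have "cmod (q z - l j) \<le> 2 * c" unfolding qU[OF U(3)[OF z(1)]] using j(2) U(3)[OF z(1)] by (simp add: divide_le_eq)
      then show "w \<in> (\<Union>j<n. cball (l j) (2 * c))" using j(1) z(2) by (auto simp: dist_norm norm_minus_commute)
    qed
    define z0 where "z0 = complex_of_real (\<bar>r\<bar> + 2)"
    have z0: "z0 \<in> U" by (simp add: z0_def U_def norm_of_real del: of_real_add)
    then obtain j where j: "j < n" "cmod (q z0 - l j) \<le> 2 * c"
      using subU by (force simp: dist_norm norm_minus_commute)
    have "cmod (conn z - l j * z ^ N) \<le> (4 * n + 2) * c * cmod z powr D" if z: "z \<in> U" for z
    proof -
      have "cmod (q z - q z0) \<le> 2 * n * (2 * c)"
        using connected_cballs_diam[OF conU subU, of "q z0" "q z"] z z0 c by auto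
      then have "cmod (q z - l j) \<le> (4 * n + 2) * c"
        using j(2) norm_triangle_ineq[of "q z - q z0" "q z0 - l j"] by (simp add: algebra_simps)
      then show ?thesis unfolding qU[OF U(3)[OF z]] using U(3)[OF z] by (simp add: divide_le_eq)
    qed
    then show ?thesis using j(1) by blast
  qed
  then obtain j where j: "j < n" "\<And>z. z \<in> U \<Longrightarrow> cmod (conn z - l j * z ^ N) \<le> (4 * n + 2) * c * cmod z powr D" by blast
  have "cmod (conn z - deriv (P j) z) \<le> (4 * n + 3) * c * cmod z powr D" if z: "\<bar>r\<bar> + 2 \<le> cmod z" for z
  proof -
    have zU: "z \<in> U" using z by (simp add: U_def)
    have "cmod (conn z - deriv (P j) z) \<le> cmod (conn z - l j * z ^ N) + cmod (deriv (P j) z - l j * z ^ N)"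
      using norm_triangle_ineq4[of "conn z - l j * z ^ N" "deriv (P j) z - l j * z ^ N"] by simp
    also have "\<dots> \<le> (4 * n + 2) * c * cmod z powr D + c * cmod z powr D"
      by (intro add_mono j zU r U(1)[OF zU])
    also have "\<dots> = (4 * n + 3) * c * cmod z powr D" by (simp add: algebra_simps)
    finally show ?thesis .
  qed
  then show ?thesis using j(1) unfolding eventually_at_infinity by blast
qed

text \<open>The differential of \<open>lognorm\<close> - Re P_j is the real part of conn - P_j', so
  it is integrated along the radius from a fixed circle; the compact disc inside that circle
  contributes the constant B.\<close>

lemma lognorm_near_Re_P:
  assumes j: "j < n" and c: "c \<ge> 0"
    and near: "\<forall>\<^sub>F z in at_infinity. cmod (conn z - deriv (P j) z) \<le> c * cmod z powr D"
  shows "\<exists>B. \<forall>z. \<bar>lognorm z - Re (P j z)\<bar> \<le> c * cmod z powr (D + 1) + B"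
proof -
  obtain r0 where r0: "\<And>z. r0 \<le> cmod z \<Longrightarrow> cmod (conn z - deriv (P j) z) \<le> c * cmod z powr D"
    using near unfolding eventually_at_infinity by blast
  define r where "r = \<bar>r0\<bar> + 1"
  define Y where "Y = (\<lambda>z. lognorm z - Re (P j z))"
  have contP: "continuous_on UNIV (P j)" by (rule holomorphic_on_imp_continuous_on[OF P_hol[OF j]])
  have "continuous_on UNIV Y" unfolding Y_def by (intro continuous_intros cont_lognorm contP)
  then have "bounded (Y ` cball 0 r)"
    by (intro compact_imp_bounded compact_continuous_image) (auto intro: continuous_on_subset)
  then obtain B where "\<forall>x\<in>Y ` cball 0 r. norm x \<le> B" unfolding bounded_iff by blast
  then have B: "\<bar>Y z\<bar> \<le> B" if "cmod z \<le> r" for z using that by simp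
  have dY: "(Y has_derivative (\<lambda>h. Re ((conn z - deriv (P j) z) * h))) (at z)" for z
  proof -
    have "(P j has_field_derivative deriv (P j) z) (at z)" using holomorphic_derivI[OF P_hol[OF j]] by blast
    then have "(P j has_derivative (\<lambda>h. deriv (P j) z * h)) (at z)" by (simp add: has_field_derivative_def)
    from has_derivative_diff[OF lognorm_has_derivative has_derivative_Re[OF this]]
    show ?thesis unfolding Y_def by (simp add: left_diff_distrib)
  qed
  have "\<bar>Y z\<bar> \<le> c * cmod z powr (D + 1) + B" for z
  proof (cases "cmod z \<le> r")
    case True
    then show ?thesis using B[OF True] c by (simp add: add_increasing)
  next
    case False
    define w where "w = of_real (r / cmod z) * z"
    have zr: "cmod z > r" "cmod z > 0" using False by (auto simp: r_def)
    have cw: "cmod w = r" using zr by (simp add: w_def norm_mult norm_divide r_def)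
    have seg: "r \<le> cmod v \<and> cmod v \<le> cmod z" if "v \<in> closed_segment w z" for v
    proof -
      obtain u where u: "0 \<le> u" "u \<le> 1" "v = (1 - u) *\<^sub>R w + u *\<^sub>R z" using \<open>v \<in> closed_segment w z\<close> by (auto simp: closed_segment_def)
      have "v = of_real ((1 - u) * (r / cmod z) + u) * z"
        by (simp add: u(3) w_def scaleR_conv_of_real algebra_simps)
      moreover have nn: "(1 - u) * (r / cmod z) + u \<ge> 0" using u zr by (simp add: r_def)
      ultimately have "cmod v = ((1 - u) * (r / cmod z) + u) * cmod z" by (simp only: norm_mult norm_of_real abs_of_nonneg)
      also have "\<dots> = (1 - u) * r + u * cmod z" using zr by (simp add: field_simps)
      finally have cv: "cmod v = (1 - u) * r + u * cmod z" .
      have "(1 - u) * r + u * r \<le> cmod v" unfolding cv using u zr by (intro add_left_mono mult_left_mono) auto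
      moreover have "cmod v \<le> (1 - u) * cmod z + u * cmod z" unfolding cv using u zr by (intro add_right_mono mult_left_mono) auto
      ultimately show ?thesis by (simp add: algebra_simps)
    qed
    have "norm (Y z - Y w) \<le> (c * cmod z powr D) * norm (z - w)"
    proof (rule differentiable_bound[of "closed_segment w z" Y])
      fix v assume v: "v \<in> closed_segment w z"
      show "(Y has_derivative (\<lambda>h. Re ((conn v - deriv (P j) v) * h))) (at v within closed_segment w z)"
        by (rule has_derivative_at_withinI[OF dY])
      have "cmod (conn v - deriv (P j) v) \<le> c * cmod v powr D" using seg[OF v] unfolding r_def by (intro r0) linarith
      also have "\<dots> \<le> c * cmod z powr D" using seg[OF v] c D_nonneg by (intro mult_left_mono powr_mono2) auto
      finally have le: "cmod (conn v - deriv (P j) v) \<le> c * cmod z powr D" .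
      show "onorm (\<lambda>h. Re ((conn v - deriv (P j) v) * h)) \<le> c * cmod z powr D"
      proof (rule onorm_bound)
        fix h
        show "norm (Re ((conn v - deriv (P j) v) * h)) \<le> c * cmod z powr D * norm h"
          using abs_Re_le_cmod[of "(conn v - deriv (P j) v) * h"] mult_right_mono[OF le, of "cmod h"]
          by (simp add: norm_mult)
      qed (use c in simp)
    qed auto
    also have "norm (z - w) \<le> cmod z"
    proof -
      have "z - w = of_real (1 - r / cmod z) * z" by (simp add: w_def algebra_simps)
      moreover have "\<bar>1 - r / cmod z\<bar> \<le> 1" using zr by (simp add: abs_le_iff r_def)
      ultimately show ?thesis using mult_right_mono[of "\<bar>1 - r / cmod z\<bar>" 1 "cmod z"] by (simp only: norm_mult norm_of_real) simp
    qed
    also have "c * cmod z powr D * cmod z = c * cmod z powr (D + 1)" using zr by (simp add: powr_add)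
    finally have "\<bar>Y z - Y w\<bar> \<le> c * cmod z powr (D + 1)" using c by (simp add: mult_left_mono)
    moreover have "\<bar>Y w\<bar> \<le> B" using B[of w] cw by simp
    ultimately show ?thesis by linarith
  qed
  then show ?thesis unfolding Y_def by blast
qed

end

section \<open>Fourier coefficients of the exponents\<close>

lemma integral_circle_01:
  fixes H :: "complex \<Rightarrow> real"
  assumes H: "continuous_on UNIV H" and r: "r \<ge> 0"
  shows "integral {-pi..pi} (\<lambda>\<theta>. H (cis \<theta> * of_real r)) = 2 * pi * integral {0..1} (\<lambda>x. H (circlepath 0 r x))"
proof -
  \<comment> \<open>The sign matches the two parametrisations: angles start at -pi, the circle path
    at angle 0, and cis (2 pi x - pi) times -r is the point of the path at x.\<close>
  define h where "h = (\<lambda>\<theta>. H (cis \<theta> * (- of_real r)))"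
  have "integral {-pi..pi} (\<lambda>\<theta>. H (cis \<theta> * of_real r)) = integral {-pi..pi} h"
    unfolding h_def integral_circle_shift[OF H, of "- of_real r"] using r by simp
  also have "\<dots> = 2 * pi * integral {0..1} (\<lambda>x. h (2 * pi * x - pi))"
  proof -
    have "((\<lambda>x. (2 * pi) *\<^sub>R h (2 * pi * x - pi)) has_integral
        (integral {2 * pi * 0 - pi..2 * pi * 1 - pi} h)) {0..1}"
    proof (rule has_integral_substitution[of 0 1 "\<lambda>x. 2 * pi * x - pi" "-pi" pi])
      show "continuous_on {-pi..pi} h"
        unfolding h_def by (intro continuous_on_compose2[OF H] continuous_intros) auto
      show "((\<lambda>x. 2 * pi * x - pi) has_field_derivative 2 * pi) (at x within {0..1})" for x :: real
        by (auto intro!: derivative_eq_intros)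
      show "(\<lambda>x. 2 * pi * x - pi) ` {0..1} \<subseteq> {- pi..pi}"
        using pi_ge_zero by (auto simp: mult_left_le)
    qed auto
    from has_integral_mult_right[OF this, of "1 / (2 * pi)"]
    have "((\<lambda>x. h (2 * pi * x - pi)) has_integral integral {-pi..pi} h / (2 * pi)) {0..1}" by simp
    then show ?thesis by (simp add: integral_unique)
  qed
  also have "(\<lambda>x. h (2 * pi * x - pi)) = (\<lambda>x. H (circlepath 0 r x))"
  proof
    fix x
    have "cis (2 * pi * x - pi) * (- of_real r) = circlepath 0 r x"
      by (simp add: circlepath cis_conv_exp exp_diff mult_ac diff_divide_distrib right_diff_distrib exp_minus) 
    then show "h (2 * pi * x - pi) = H (circlepath 0 r x)" by (simp add: h_def)
  qed
  finally show ?thesis .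
qed

lemma circlepath_coefficient:
  assumes P: "P holomorphic_on UNIV" and r: "r > 0"
  shows "((\<lambda>x. P (circlepath 0 r x) / circlepath 0 r x ^ m) has_integral (deriv ^^ m) P 0 / fact m) {0..1}"
    and "m > 0 \<Longrightarrow> ((\<lambda>x. P (circlepath 0 r x) * circlepath 0 r x ^ m) has_integral 0) {0..1}"
proof -
  have vd: "vector_derivative (circlepath 0 r) (at x within {0..1}) = 2 * of_real pi * \<i> * circlepath 0 r x"
    if "x \<in> {0..1}" for x
    using vector_derivative_circlepath01[of x 0 r] that by (simp add: circlepath mult_ac)
  have nz: "circlepath 0 r x \<noteq> 0" for x using r by (simp add: circlepath)
  have "((\<lambda>u. P u / (u - 0) ^ Suc m) has_contour_integral (2 * pi * \<i> / fact m * (deriv ^^ m) P 0)) (circlepath 0 r)"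
    by (rule Cauchy_has_contour_integral_higher_derivative_circlepath)
       (use P r in \<open>auto intro: holomorphic_on_subset holomorphic_on_imp_continuous_on\<close>)
  then have "((\<lambda>x. P (circlepath 0 r x) / circlepath 0 r x ^ Suc m * (2 * of_real pi * \<i> * circlepath 0 r x)) has_integral
      (2 * pi * \<i> / fact m * (deriv ^^ m) P 0)) {0..1}"
    unfolding has_contour_integral_def by (rule has_integral_eq[rotated]) (simp add: vd)
  from has_integral_mult_right[OF this, of "1 / (2 * of_real pi * \<i>)"]
  show "((\<lambda>x. P (circlepath 0 r x) / circlepath 0 r x ^ m) has_integral (deriv ^^ m) P 0 / fact m) {0..1}"
    using nz by (simp add: field_simps)
  assume m: "m > 0"
  have "((\<lambda>u. P u * u ^ (m - 1)) has_contour_integral 0) (circlepath 0 r)"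
  proof (rule Cauchy_theorem_convex_simple[of _ UNIV])
    show "(\<lambda>u. P u * u ^ (m - 1)) holomorphic_on UNIV" by (intro holomorphic_intros P)
  qed auto
  then have "((\<lambda>x. P (circlepath 0 r x) * circlepath 0 r x ^ (m - 1) * (2 * of_real pi * \<i> * circlepath 0 r x)) has_integral 0) {0..1}"
    unfolding has_contour_integral_def by (rule has_integral_eq[rotated]) (simp add: vd)
  from has_integral_mult_right[OF this, of "1 / (2 * of_real pi * \<i>)"]
  have "((\<lambda>x. P (circlepath 0 r x) * (circlepath 0 r x ^ (m - 1) * circlepath 0 r x)) has_integral 0) {0..1}"
    by (simp add: mult_ac)
  moreover have "w ^ (m - 1) * w = w ^ m" for w :: complex using m by (metis power_minus_mult)
  ultimately show "((\<lambda>x. P (circlepath 0 r x) * circlepath 0 r x ^ m) has_integral 0) {0..1}" by simp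
qed

text \<open>On the circle the conjugate of z is r^2 / z, so conjugating the vanishing integral of P
  z^m shows that the conjugate of P contributes nothing to the m-th coefficient. Hence P may be
  replaced by 2 Re P under the integral.\<close>

lemma coefficient_le_mean_Re:
  assumes P: "P holomorphic_on UNIV" and r: "r > 0" and m: "m > 0"
  shows "cmod ((deriv ^^ m) P 0 / fact m) * r ^ m \<le> 2 * integral {0..1} (\<lambda>x. \<bar>Re (P (circlepath 0 r x))\<bar>)"
proof -
  define g where "g = circlepath 0 r"
  have ng: "cmod (g x) = r" for x using r by (simp add: g_def circlepath norm_mult)
  have gc: "cnj (g x) = of_real (r\<^sup>2) / g x" for x
  proof -
    have "g x * cnj (g x) = of_real (r\<^sup>2)" using complex_norm_square[of "g x"] by (simp add: ng)
    moreover have "g x \<noteq> 0" using ng[of x] r by auto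
    ultimately show ?thesis by (simp add: field_simps)
  qed
  have 1: "((\<lambda>x. P (g x) / g x ^ m) has_integral (deriv ^^ m) P 0 / fact m) {0..1}"
    unfolding g_def by (rule circlepath_coefficient(1)[OF P r])
  have "((\<lambda>x. P (g x) * g x ^ m) has_integral 0) {0..1}"
    unfolding g_def by (rule circlepath_coefficient(2)[OF P r m])
  then have "((cnj \<circ> (\<lambda>x. P (g x) * g x ^ m)) has_integral cnj 0) {0..1}"
    by (rule has_integral_linear[OF _ bounded_linear_cnj])
  then have "((\<lambda>x. cnj (P (g x)) * (of_real (r\<^sup>2) / g x) ^ m) has_integral 0) {0..1}"
    by (simp add: o_def gc)
  from has_integral_mult_right[OF this, of "1 / of_real (r\<^sup>2) ^ m"]
  have 2: "((\<lambda>x. cnj (P (g x)) / g x ^ m) has_integral 0) {0..1}"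
    using r by (simp add: power_divide)
  have s: "((\<lambda>x. 2 * of_real (Re (P (g x))) / g x ^ m) has_integral (deriv ^^ m) P 0 / fact m) {0..1}"
    using has_integral_add[OF 1 2] by (simp add: add_divide_distrib[symmetric] complex_add_cnj)
  have cont: "continuous_on {0..1} (\<lambda>x. \<bar>Re (P (g x))\<bar>)"
    unfolding g_def circlepath
    by (intro continuous_intros continuous_on_compose2[OF holomorphic_on_imp_continuous_on[OF P]]) auto
  have int: "(\<lambda>x. 2 / r ^ m * \<bar>Re (P (g x))\<bar>) integrable_on {0..1}"
    by (intro integrable_on_mult_right integrable_continuous_real cont)
  have "norm (integral {0..1} (\<lambda>x. 2 * of_real (Re (P (g x))) / g x ^ m)) \<le> integral {0..1} (\<lambda>x. 2 / r ^ m * \<bar>Re (P (g x))\<bar>)"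
    by (rule integral_norm_bound_integral[OF has_integral_integrable[OF s] int])
       (use r in \<open>simp add: norm_divide norm_mult norm_power ng\<close>)
  then have "cmod ((deriv ^^ m) P 0 / fact m) \<le> 2 / r ^ m * integral {0..1} (\<lambda>x. \<bar>Re (P (g x))\<bar>)"
    unfolding integral_unique[OF s] by simp
  then show ?thesis using r by (simp add: g_def field_simps)
qed

text \<open>A one-sided bound suffices: the mean of Re P is the constant Re P(0), and |x| <= 2 u - x
  whenever x <= u and 0 <= u.\<close>

lemma mean_abs_Re:
  assumes P: "P holomorphic_on UNIV" and r: "r > 0"
    and u: "continuous_on UNIV u" "\<And>z. cmod z = r \<Longrightarrow> 0 \<le> u z" "\<And>z. cmod z = r \<Longrightarrow> Re (P z) \<le> u z"
  shows "integral {0..1} (\<lambda>x. Re (P (circlepath 0 r x))) = Re (P 0)"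
    and "integral {0..1} (\<lambda>x. \<bar>Re (P (circlepath 0 r x))\<bar>) \<le> 2 * integral {0..1} (\<lambda>x. u (circlepath 0 r x)) - Re (P 0)"
proof -
  define g where "g = circlepath 0 r"
  have ng: "cmod (g x) = r" for x using r by (simp add: g_def circlepath norm_mult)
  have "((\<lambda>x. P (g x)) has_integral P 0) {0..1}"
    using circlepath_coefficient(1)[OF P r, of 0] by (simp add: g_def)
  from has_integral_linear[OF this bounded_linear_Re]
  have RP: "((\<lambda>x. Re (P (g x))) has_integral Re (P 0)) {0..1}" by (simp add: o_def)
  then show "integral {0..1} (\<lambda>x. Re (P (circlepath 0 r x))) = Re (P 0)" by (simp add: g_def integral_unique)
  have gcont: "continuous_on {0..1} g" unfolding g_def circlepath by (intro continuous_intros)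
  have ui: "(\<lambda>x. u (g x)) integrable_on {0..1}"
    by (intro integrable_continuous_real continuous_on_compose2[OF u(1) gcont]) auto
  have ai: "(\<lambda>x. \<bar>Re (P (g x))\<bar>) integrable_on {0..1}"
    by (intro integrable_continuous_real continuous_intros continuous_on_compose2[OF holomorphic_on_imp_continuous_on[OF P] gcont]) auto
  have "integral {0..1} (\<lambda>x. \<bar>Re (P (g x))\<bar>) \<le> integral {0..1} (\<lambda>x. 2 * u (g x) - Re (P (g x)))"
  proof (rule integral_le[OF ai])
    show "(\<lambda>x. 2 * u (g x) - Re (P (g x))) integrable_on {0..1}"
      by (intro integrable_diff integrable_on_mult_right ui has_integral_integrable[OF RP])
    show "\<bar>Re (P (g x))\<bar> \<le> 2 * u (g x) - Re (P (g x))" for x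
      using u(2,3)[OF ng[of x]] by linarith
  qed
  also have "\<dots> = 2 * integral {0..1} (\<lambda>x. u (g x)) - Re (P 0)"
    using has_integral_diff[OF has_integral_mult_right[OF integrable_integral[OF ui], of 2] RP] by (simp add: integral_unique)
  finally show "integral {0..1} (\<lambda>x. \<bar>Re (P (circlepath 0 r x))\<bar>) \<le> 2 * integral {0..1} (\<lambda>x. u (circlepath 0 r x)) - Re (P 0)"
    by (simp add: g_def)
qed

lemma entire_coefficients_zero:
  assumes P: "P holomorphic_on UNIV" and 0: "\<And>m. m > d \<Longrightarrow> (deriv ^^ m) P 0 = 0"
  shows "P z = (\<Sum>k\<le>d. (deriv ^^ k) P 0 / fact k * z ^ k)"
proof -
  have "(\<lambda>k. (deriv ^^ k) P 0 / fact k * (z - 0) ^ k) sums P z"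
    by (rule holomorphic_power_series[of P 0 "cmod z + 1"]) (auto intro: holomorphic_on_subset[OF P])
  moreover have "(\<lambda>k. (deriv ^^ k) P 0 / fact k * (z - 0) ^ k) sums (\<Sum>k\<le>d. (deriv ^^ k) P 0 / fact k * (z - 0) ^ k)"
    by (rule sums_finite) (use 0 in \<open>auto simp: not_le\<close>)
  ultimately show ?thesis using sums_unique2 by fastforce
qed

section \<open>Forms in general position\<close>

text \<open>Elimination: one equation is solved for the coefficient of a pivot p, which leaves one
  equation and one unknown fewer.\<close>

lemma nontrivial_relation:
  fixes x :: "'a \<Rightarrow> 'b \<Rightarrow> complex"
  assumes "finite K" "finite J" "card J > card K"
  shows "\<exists>c. (\<exists>j\<in>J. c j \<noteq> 0) \<and> (\<forall>k\<in>K. (\<Sum>j\<in>J. c j * x j k) = 0)"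
  using assms
proof (induction K arbitrary: J x rule: finite_induct)
  case empty
  then have "J \<noteq> {}" by auto
  then show ?case by (intro exI[of _ "\<lambda>_. 1"]) auto
next
  case (insert k0 K)
  show ?case
  proof (cases "\<forall>j\<in>J. x j k0 = 0")
    case True
    have "card J > card K" using insert.prems insert.hyps by simp
    then show ?thesis using insert.IH[OF insert.prems(1), of x] True by auto
  next
    case False
    then obtain p where p: "p \<in> J" "x p k0 \<noteq> 0" by blast
    define J' where "J' = J - {p}"
    have J': "finite J'" "card J' > card K" "p \<notin> J'" "J = insert p J'"
      using insert.prems insert.hyps p by (auto simp: J'_def)
    obtain c where c: "\<exists>j\<in>J'. c j \<noteq> 0" "\<And>k. k \<in> K \<Longrightarrow> (\<Sum>j\<in>J'. c j * (x j k - x j k0 / x p k0 * x p k)) = 0"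
      using insert.IH[OF J'(1,2), of "\<lambda>j k. x j k - x j k0 / x p k0 * x p k"] by blast
    define s where "s = (\<Sum>j\<in>J'. c j * x j k0 / x p k0)"
    define c' where "c' = c(p := - s)"
    have sum: "(\<Sum>j\<in>J. c' j * x j k) = (\<Sum>j\<in>J'. c j * (x j k - x j k0 / x p k0 * x p k))" for k
    proof -
      have "(\<Sum>j\<in>J. c' j * x j k) = - s * x p k + (\<Sum>j\<in>J'. c' j * x j k)"
        unfolding J'(4) by (subst sum.insert[OF J'(1,3)]) (simp add: c'_def)
      also have "(\<Sum>j\<in>J'. c' j * x j k) = (\<Sum>j\<in>J'. c j * x j k)"
        by (intro sum.cong refl) (use J'(3) in \<open>auto simp: c'_def\<close>)
      also have "- s * x p k = (\<Sum>j\<in>J'. - (c j * x j k0 / x p k0 * x p k))"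
        by (simp add: s_def sum_distrib_right sum_negf)
      also have "\<dots> + (\<Sum>j\<in>J'. c j * x j k) = (\<Sum>j\<in>J'. c j * (x j k - x j k0 / x p k0 * x p k))"
        unfolding sum.distrib[symmetric] by (intro sum.cong refl) (simp add: right_diff_distrib)
      finally show ?thesis .
    qed
    have "(\<Sum>j\<in>J. c' j * x j k0) = 0" unfolding sum using p(2) by simp
    then have "\<forall>k\<in>insert k0 K. (\<Sum>j\<in>J. c' j * x j k) = 0" using c(2) sum by auto
    moreover have "\<exists>j\<in>J. c' j \<noteq> 0" using c(1) J' by (auto simp: c'_def)
    ultimately show ?thesis by blast
  qed
qed

lemma lin_indep_formsD:
  assumes "lin_indep_forms n m a" "\<And>j. j \<le> n \<Longrightarrow> (\<Sum>i<m. c i * a i j) = 0" "i < m"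
  shows "c i = 0"
  using assms unfolding lin_indep_forms_def by simp

text \<open>By independence, the last form minus its combination of the earlier ones is nonzero at
  some coordinate k0. A multiple of that coordinate vector, corrected by the earlier dual vectors,
  is the new dual vector w, and the old ones are then corrected by w.\<close>

lemma lin_indep_forms_dual:
  assumes "lin_indep_forms n m a"
  shows "\<exists>b. \<forall>i<m. \<forall>j<m. linear_form n (a i) (b j) = (if i = j then 1 else 0)"
  using assms
proof (induction m)
  case (Suc m)
  have "lin_indep_forms n m a"
    unfolding lin_indep_forms_def
  proof (intro allI impI)
    fix c :: "nat \<Rightarrow> complex" and i assume c: "\<forall>j\<le>n. (\<Sum>i<m. c i * a i j) = 0" and i: "i < m"
    have "(if i < m then c i else 0) = 0"
      by (rule lin_indep_formsD[OF Suc.prems, of "\<lambda>i. if i < m then c i else 0"]) (use c i in simp_all)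
    then show "c i = 0" using i by simp
  qed
  from Suc.IH[OF this] obtain b where b: "\<And>i j. i < m \<Longrightarrow> j < m \<Longrightarrow> linear_form n (a i) (b j) = (if i = j then 1 else 0)"
    by blast
  define a' where "a' = (\<lambda>k. a m k - (\<Sum>j<m. linear_form n (a m) (b j) * a j k))"
  have "\<exists>k\<le>n. a' k \<noteq> 0"
  proof (rule ccontr)
    assume "\<not> ?thesis"
    then have z: "\<And>k. k \<le> n \<Longrightarrow> a' k = 0" by blast
    have "(if m < m then - linear_form n (a m) (b m) else 1) = 0"
      by (rule lin_indep_formsD[OF Suc.prems, of "\<lambda>i. if i < m then - linear_form n (a m) (b i) else 1"])
         (use z in \<open>simp_all add: a'_def sum_negf\<close>)
    then show False by simp
  qed
  then obtain k0 where k0: "k0 \<le> n" "a' k0 \<noteq> 0" by blast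
  define u where "u = (\<lambda>k. if k = k0 then 1 / a' k0 else 0)"
  define w where "w = (\<lambda>k. u k - (\<Sum>j<m. linear_form n (a j) u * b j k))"
  have fu: "linear_form n v u = v k0 / a' k0" for v
    using k0 by (simp add: linear_form_def u_def if_distrib[of "\<lambda>x. _ * x"] cong: if_cong)
  have lw: "linear_form n v w = linear_form n v u - (\<Sum>j<m. linear_form n (a j) u * linear_form n v (b j))" for v
  proof -
    have "linear_form n v w = linear_form n v u - (\<Sum>k\<le>n. \<Sum>j<m. linear_form n (a j) u * (v k * b j k))"
      by (simp add: linear_form_def w_def right_diff_distrib sum_subtractf sum_distrib_left mult_ac)
    also have "(\<Sum>k\<le>n. \<Sum>j<m. linear_form n (a j) u * (v k * b j k)) = (\<Sum>j<m. linear_form n (a j) u * linear_form n v (b j))"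
      by (subst sum.swap) (simp add: linear_form_def sum_distrib_left)
    finally show ?thesis .
  qed
  have w0: "linear_form n (a i) w = 0" if "i < m" for i
    unfolding lw using b[OF that] that by (simp add: if_distrib[of "\<lambda>x. _ * x"] cong: if_cong)
  have w1: "linear_form n (a m) w = 1"
  proof -
    have "linear_form n (a m) w = (a m k0 - (\<Sum>j<m. a j k0 * linear_form n (a m) (b j))) / a' k0"
      unfolding lw fu by (simp add: diff_divide_distrib sum_divide_distrib)
    also have "a m k0 - (\<Sum>j<m. a j k0 * linear_form n (a m) (b j)) = a' k0" by (simp add: a'_def mult.commute)
    finally show ?thesis using k0 by simp
  qed
  define b' where "b' = (\<lambda>j k. if j < m then b j k - linear_form n (a m) (b j) * w k else w k)"
  have lb: "linear_form n v (b' j) = (if j < m then linear_form n v (b j) - linear_form n (a m) (b j) * linear_form n v w else linear_form n v w)" for v j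
  proof -
    have "linear_form n v (\<lambda>k. x k - t * y k) = linear_form n v x - t * linear_form n v y" for x y t
      by (simp add: linear_form_def right_diff_distrib sum_subtractf sum_distrib_left mult_ac)
    then show ?thesis by (simp add: b'_def)
  qed
  have "linear_form n (a i) (b' j) = (if i = j then 1 else 0)" if "i < Suc m" "j < Suc m" for i j
    using that b[of i j] w0[of i] w1 unfolding lb by (auto simp: less_Suc_eq)
  then show ?case by blast
qed simp

text \<open>n forms in n + 1 variables have a common kernel vector e. The form v -> <v, e> is
  nonzero at e, where the others vanish, so the n + 1 forms are independent and their dual basis
  expands every v. Its last vector is e itself, since e has coordinates 0, ..., 0, 1.\<close>

lemma lin_indep_forms_orthogonal_decomposition:
  assumes a: "lin_indep_forms n n a"
  shows "\<exists>e b. (\<Sum>i\<le>n. (cmod (e i))\<^sup>2) = 1 \<and> (\<forall>j<n. linear_form n (a j) e = 0) \<and>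
    (\<forall>v i. i \<le> n \<longrightarrow> v i = (\<Sum>k\<le>n. cnj (e k) * v k) * e i + (\<Sum>j<n. b j i * linear_form n (a j) v))"
proof -
  obtain c where c: "\<exists>j\<in>{..n}. c j \<noteq> 0" "\<forall>k\<in>{..<n}. (\<Sum>j\<in>{..n}. c j * a k j) = 0"
    using nontrivial_relation[of "{..<n}" "{..n}" "\<lambda>j k. a k j"] by auto
  define r where "r = sqrt (\<Sum>i\<le>n. (cmod (c i))\<^sup>2)"
  have r2: "r\<^sup>2 = (\<Sum>i\<le>n. (cmod (c i))\<^sup>2)" by (simp add: r_def sum_nonneg)
  have r: "r > 0"
  proof -
    obtain j where "j \<in> {..n}" "c j \<noteq> 0" using c(1) by blast
    then have "0 < (\<Sum>i\<le>n. (cmod (c i))\<^sup>2)" by (intro sum_pos2[of _ j]) auto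
    then show ?thesis by (simp add: r_def)
  qed
  define e where "e = (\<lambda>i. c i / of_real r)"
  have e1: "(\<Sum>i\<le>n. (cmod (e i))\<^sup>2) = 1"
    using r by (simp add: e_def norm_divide power_divide sum_divide_distrib[symmetric] r2[symmetric])
  have ae: "linear_form n (a j) e = 0" if "j < n" for j
    using c(2) that by (simp add: linear_form_def e_def sum_divide_distrib[symmetric] mult.commute)
  define a' where "a' = (\<lambda>j. if j < n then a j else (\<lambda>k. cnj (e k)))"
  have ee: "linear_form n (\<lambda>k. cnj (e k)) e = 1"
    using arg_cong[OF e1, of complex_of_real] by (simp add: linear_form_def of_real_cmod_power2 mult.commute)
  have "lin_indep_forms n (Suc n) a'"
    unfolding lin_indep_forms_def
  proof (intro allI impI)
    fix d :: "nat \<Rightarrow> complex" and i assume d: "\<forall>j\<le>n. (\<Sum>i<Suc n. d i * a' i j) = 0" and i: "i < Suc n"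
    have d': "(\<Sum>i<n. d i * a i k) + d n * cnj (e k) = 0" if "k \<le> n" for k
      using d that by (simp add: a'_def)
    have "0 = (\<Sum>k\<le>n. ((\<Sum>i<n. d i * a i k) + d n * cnj (e k)) * e k)" using d' by simp
    also have "\<dots> = (\<Sum>k\<le>n. \<Sum>i<n. d i * (a i k * e k)) + d n * linear_form n (\<lambda>k. cnj (e k)) e"
      by (simp add: linear_form_def distrib_right distrib_left sum.distrib sum_distrib_left sum_distrib_right mult_ac)
    also have "(\<Sum>k\<le>n. \<Sum>i<n. d i * (a i k * e k)) = (\<Sum>i<n. d i * linear_form n (a i) e)"
      by (subst sum.swap) (simp add: linear_form_def sum_distrib_left)
    also have "\<dots> = 0" using ae by simp
    finally have dn: "d n = 0" by (simp add: ee)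
    have "d i = 0" if "i < n" for i
      by (rule lin_indep_formsD[OF a, of d]) (use d' that \<open>d n = 0\<close> in simp_all)
    then show "d i = 0" using dn i by (auto simp: less_Suc_eq)
  qed
  from lin_indep_forms_dual[OF this] obtain b where
    b: "\<And>i j. i < Suc n \<Longrightarrow> j < Suc n \<Longrightarrow> linear_form n (a' i) (b j) = (if i = j then 1 else 0)" by blast
  have expand: "v k = (\<Sum>j<Suc n. linear_form n (a' j) v * b j k)" if k: "k \<le> n" for v k
  proof -
    \<comment> \<open>n + 2 vectors with n + 1 coordinates are dependent. Applying the forms
      \<open>a'\<close> to the relation expresses every other coefficient through that of v, which
      therefore is not zero.\<close>
    define x where "x = (\<lambda>j. if j < Suc n then b j else v)"
    obtain c where c: "\<exists>j\<in>{..Suc n}. c j \<noteq> 0" "\<forall>k\<in>{..n}. (\<Sum>j\<in>{..Suc n}. c j * x j k) = 0"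
      using nontrivial_relation[of "{..n}" "{..Suc n}" x] by auto
    have rel: "(\<Sum>j<Suc n. c j * b j k) + c (Suc n) * v k = 0" if "k \<le> n" for k
    proof -
      have "(\<Sum>j\<in>{..Suc n}. c j * x j k) = (\<Sum>j<Suc n. c j * x j k) + c (Suc n) * x (Suc n) k"
        by (simp add: lessThan_Suc_atMost)
      also have "(\<Sum>j<Suc n. c j * x j k) = (\<Sum>j<Suc n. c j * b j k)" by (intro sum.cong) (auto simp: x_def)
      finally have eq: "(\<Sum>j\<in>{..Suc n}. c j * x j k) = (\<Sum>j<Suc n. c j * b j k) + c (Suc n) * x (Suc n) k" .
      have "(\<Sum>j\<in>{..Suc n}. c j * x j k) = 0" by (rule bspec[OF c(2)]) (use that in simp)
      moreover have "x (Suc n) = v" by (simp add: x_def)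
      ultimately show ?thesis using eq by (simp only:)
    qed
    have ci: "c i = - c (Suc n) * linear_form n (a' i) v" if i: "i < Suc n" for i
    proof -
      have "0 = (\<Sum>k\<le>n. a' i k * ((\<Sum>j<Suc n. c j * b j k) + c (Suc n) * v k))" using rel by simp
      also have "\<dots> = (\<Sum>k\<le>n. \<Sum>j<Suc n. c j * (a' i k * b j k)) + c (Suc n) * linear_form n (a' i) v"
        by (simp add: linear_form_def distrib_left sum.distrib sum_distrib_left mult_ac del: sum.lessThan_Suc)
      also have "(\<Sum>k\<le>n. \<Sum>j<Suc n. c j * (a' i k * b j k)) = (\<Sum>j<Suc n. c j * linear_form n (a' i) (b j))"
        by (subst sum.swap) (simp add: linear_form_def sum_distrib_left del: sum.lessThan_Suc)
      also have "\<dots> = (\<Sum>j<Suc n. if j = i then c j else 0)"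
        by (intro sum.cong refl) (use b[OF i] in auto)
      also have "\<dots> = c i" using i by simp
      finally show ?thesis by (simp add: eq_neg_iff_add_eq_0)
    qed
    have cn: "c (Suc n) \<noteq> 0"
    proof
      assume "c (Suc n) = 0"
      then have "c j = 0" if "j \<in> {..Suc n}" for j using ci[of j] that by (cases "j = Suc n") auto
      then show False using c(1) by blast
    qed
    have "c (Suc n) * v k = - (\<Sum>j<Suc n. c j * b j k)" using rel[OF k] unfolding eq_neg_iff_add_eq_0 by (simp only: add.commute)
    also have "\<dots> = c (Suc n) * (\<Sum>j<Suc n. linear_form n (a' j) v * b j k)"
      unfolding sum_distrib_left sum_negf[symmetric]
      by (intro sum.cong refl) (use ci in simp)
    finally show ?thesis using cn by simp
  qed
  have ben: "b n k = e k" if "k \<le> n" for k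
    using expand[OF that, of e] ae ee by (simp add: a'_def)
  have "v i = (\<Sum>k\<le>n. cnj (e k) * v k) * e i + (\<Sum>j<n. b j i * linear_form n (a j) v)" if "i \<le> n" for v i
  proof -
    have "v i = (\<Sum>j<n. linear_form n (a' j) v * b j i) + linear_form n (a' n) v * b n i"
      using expand[OF that, of v] by simp
    also have "(\<Sum>j<n. linear_form n (a' j) v * b j i) = (\<Sum>j<n. b j i * linear_form n (a j) v)"
      by (intro sum.cong) (auto simp: a'_def)
    also have "linear_form n (a' n) v = (\<Sum>k\<le>n. cnj (e k) * v k)" by (simp add: a'_def linear_form_def)
    finally show ?thesis by (simp add: ben[OF that] add.commute)
  qed
  then show ?thesis using e1 ae by blast
qed

section \<open>The characteristic\<close>

lemma powr_growth_compare:
  fixes \<alpha> B C s q :: real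
  assumes "\<And>r. r \<ge> 1 \<Longrightarrow> \<alpha> * r powr s \<le> B * r powr s + C * r powr q" "q < s"
  shows "\<alpha> \<le> B"
proof (rule tendsto_lowerbound)
  have "((\<lambda>r::real. r powr (q - s)) \<longlongrightarrow> 0) at_top"
    by (rule tendsto_neg_powr[OF _ filterlim_ident]) (use assms(2) in simp)
  from tendsto_add[OF tendsto_const[of B] tendsto_mult[OF tendsto_const[of C] this]]
  show "((\<lambda>r. B + C * r powr (q - s)) \<longlongrightarrow> B) at_top" by simp
  show "\<forall>\<^sub>F r in at_top. \<alpha> \<le> B + C * r powr (q - s)"
    using eventually_ge_at_top[of 1]
  proof eventually_elim
    case (elim r)
    have p: "r powr s > 0" using elim by simp
    have "\<alpha> * r powr s \<le> (B + C * r powr (q - s)) * r powr s"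
      using assms(1)[OF elim] elim by (simp add: distrib_right powr_diff)
    then show ?case using p by simp
  qed
qed simp

context curve
begin

definition char :: "real \<Rightarrow> real" where
  "char r = (LINT t:{0<..r}|lborel. (1 / t) * ((1 / pi) * area t))"

lemma char_eq_mean:
  assumes "r \<ge> 0"
  shows "char r = integral {0..1} (\<lambda>x. lognorm (circlepath 0 r x)) - lognorm 0"
  unfolding char_def jensen[OF assms] circle_mean_def integral_circle_01[OF cont_lognorm assms] by simp

text \<open>A crude area estimate: its exponent is twice the final one, but it suffices to force the
  exponents P_j to be polynomials.\<close>

lemma char_le:
  assumes kap: "\<And>z. kap z \<le> A * cmod z powr \<sigma> + k" and nn: "A \<ge> 0" "k \<ge> 0" "\<sigma> \<ge> 0" and r: "r \<ge> 1"
  shows "char r \<le> (A + k)\<^sup>2 * r powr (2 * \<sigma> + 2)"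
proof -
  define m where "m = (A + k) * r powr \<sigma>"
  have r1: "r powr \<sigma> \<ge> 1" using r nn by (simp add: ge_one_powr_ge_zero)
  have m0: "m \<ge> 0" using nn by (simp add: m_def)
  have km: "kap z \<le> m" if "cmod z \<le> r" for z
  proof -
    have "A * cmod z powr \<sigma> \<le> A * r powr \<sigma>" using that nn by (intro mult_left_mono powr_mono2) auto
    moreover have "k * 1 \<le> k * r powr \<sigma>" using r1 nn by (intro mult_left_mono) auto
    ultimately show ?thesis using kap[of z] by (simp add: m_def distrib_right)
  qed
  have area: "area t \<le> m\<^sup>2 * (pi * t\<^sup>2)" if t: "0 \<le> t" "t \<le> r" for t
  proof -
    have fin: "emeasure lborel (cball (0::complex) t) < \<infinity>" by (rule emeasure_bounded_finite) auto
    have "area t \<le> (LINT z:cball (0::complex) t|lborel. m\<^sup>2)"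
      unfolding area_def
    proof (rule set_integral_mono)
      show "set_integrable lborel (cball 0 t) (\<lambda>z. (kap z)\<^sup>2)"
        by (intro set_integrable_continuous_compact continuous_intros cont_kap) auto
      show "set_integrable lborel (cball (0::complex) t) (\<lambda>z. m\<^sup>2)"
        by (intro set_integrable_continuous_compact) auto
      show "(kap z)\<^sup>2 \<le> m\<^sup>2" if "z \<in> cball 0 t" for z
        using that t kap_nonneg by (intro power_mono km) auto
    qed
    also have "\<dots> = m\<^sup>2 * (pi * t\<^sup>2)"
      using set_integral_const[of "cball (0::complex) t" lborel "m\<^sup>2"] fin content_complex_cball[OF t(1)] by simp
    finally show ?thesis .
  qed
  have le: "(1 / t) * ((1 / pi) * area t) \<le> m\<^sup>2 * r" if t: "t \<in> {0<..r}" for t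
  proof -
    have "(1 / t) * ((1 / pi) * area t) \<le> (1 / t) * ((1 / pi) * (m\<^sup>2 * (pi * t\<^sup>2)))"
      using area[of t] t by (intro mult_left_mono) auto
    also have "\<dots> = m\<^sup>2 * t" using t by (simp add: power2_eq_square)
    also have "\<dots> \<le> m\<^sup>2 * r" using t by (intro mult_left_mono) auto
    finally show ?thesis .
  qed
  have "char r \<le> m\<^sup>2 * r * r"
  proof (cases "set_integrable lborel {0<..r} (\<lambda>t. (1 / t) * ((1 / pi) * area t))")
    case True
    have "char r \<le> (LINT t:{0<..r}|lborel. m\<^sup>2 * r)"
      unfolding char_def
    proof (rule set_integral_mono[OF True _ le])
      show "set_integrable lborel {0<..r} (\<lambda>t. m\<^sup>2 * r)"
        by (rule set_integrable_subset[OF set_integrable_continuous_compact[of _ "{0..r}"]]) auto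
    qed
    then show ?thesis using r set_integral_const[of "{0<..r}" lborel "m\<^sup>2"] set_integral_const[of "{0<..r}" lborel r]
      by (simp add: mult_ac)
  next
    \<comment> \<open>The integral of a function that is not integrable is 0 by convention, and 0
      satisfies the bound.\<close>
    case False
    then have "char r = 0"
      unfolding char_def set_lebesgue_integral_def set_integrable_def by (rule not_integrable_integral_eq)
    then show ?thesis using r by simp
  qed
  also have "\<dots> = (A + k)\<^sup>2 * r powr (2 * \<sigma> + 2)"
  proof -
    have "r powr (2 * \<sigma> + 2) = r powr \<sigma> * r powr \<sigma> * (r * r)"
    proof -
      have "r powr (2 * \<sigma> + 2) = r powr (\<sigma> + \<sigma> + (1 + 1))" by simp
      also have "\<dots> = r powr \<sigma> * r powr \<sigma> * (r powr 1 * r powr 1)" by (simp only: powr_add)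
      finally show ?thesis using r by simp
    qed
    then show ?thesis by (simp add: m_def power2_eq_square mult_ac)
  qed
  finally show ?thesis .
qed

end

section \<open>Degrees of the exponents and the bound for the characteristic\<close>

context omitting_curve
begin

lemma Re_P_le_lognorm:
  assumes "j < n"
  shows "Re (P j z) \<le> lognorm z + ln Ka"
proof -
  have "exp (Re (P j z)) = cmod (app (a j) z)" using app_a[OF assms] by simp
  also have "\<dots> \<le> nrm (a j) * sqrt (S z)" by (rule app_le)
  also have "\<dots> \<le> Ka * sqrt (S z)" by (intro mult_right_mono nrm_a_le assms) simp
  finally have "ln (exp (Re (P j z))) \<le> ln (Ka * sqrt (S z))"
    using Ka_ge1 S_pos[of z] by (subst ln_le_cancel_iff) auto
  also have "\<dots> = ln Ka + ln (S z) / 2"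
    using Ka_ge1 S_pos[of z] by (simp add: ln_mult ln_sqrt)
  finally show ?thesis by (simp add: lognorm_def)
qed

lemma coefficient_diff_le:
  assumes j: "j < n" and k: "k < n" and m: "m > 0" and r: "r > 0"
    and u: "continuous_on UNIV u" "\<And>z. cmod z = r \<Longrightarrow> 0 \<le> u z" "\<And>z. cmod z = r \<Longrightarrow> Re (P k z) - Re (P j z) \<le> u z"
  shows "cmod ((deriv ^^ m) (P k) 0 / fact m - (deriv ^^ m) (P j) 0 / fact m) * r ^ m
    \<le> 4 * integral {0..1} (\<lambda>x. u (circlepath 0 r x)) - 2 * (Re (P k 0) - Re (P j 0))"
proof -
  have hol: "(\<lambda>z. P k z - P j z) holomorphic_on UNIV" by (intro holomorphic_intros P_hol j k)
  have "(deriv ^^ m) (\<lambda>z. P k z - P j z) 0 = (deriv ^^ m) (P k) 0 - (deriv ^^ m) (P j) 0"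
    by (rule higher_deriv_diff[OF P_hol[OF k] P_hol[OF j]]) auto
  then have "cmod ((deriv ^^ m) (P k) 0 / fact m - (deriv ^^ m) (P j) 0 / fact m) * r ^ m
      = cmod ((deriv ^^ m) (\<lambda>z. P k z - P j z) 0 / fact m) * r ^ m"
    by (simp add: diff_divide_distrib)
  also have "\<dots> \<le> 2 * integral {0..1} (\<lambda>x. \<bar>Re (P k (circlepath 0 r x) - P j (circlepath 0 r x))\<bar>)"
    by (rule coefficient_le_mean_Re[OF hol r m])
  also have "\<dots> \<le> 2 * (2 * integral {0..1} (\<lambda>x. u (circlepath 0 r x)) - Re (P k 0 - P j 0))"
    by (intro mult_left_mono mean_abs_Re(2)[OF hol r u(1)]) (use u in auto)
  finally show ?thesis by simp
qed

text \<open>Because P_0 = 0, the function \<open>lognorm\<close> + ln Ka dominates both 0 and Re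
  P_j. Its circle mean is the characteristic up to a constant, so the m-th coefficient times r^m is
  O(r^q), which is impossible for m > q unless it vanishes.\<close>

lemma P_coefficients_zero:
  assumes n: "n > 0" and P0: "P 0 = (\<lambda>_. 0)" and C: "\<And>r. r \<ge> 1 \<Longrightarrow> char r \<le> C * r powr q" and q: "q \<ge> 0"
    and j: "j < n" and m: "real m > q"
  shows "(deriv ^^ m) (P j) 0 = 0"
proof -
  have m0: "m > 0" using m q by (cases m) auto
  define u where "u = (\<lambda>z. lognorm z + ln Ka)"
  have cu: "continuous_on UNIV u" unfolding u_def by (intro continuous_intros cont_lognorm)
  define p where "p = (deriv ^^ m) (P j) 0 / fact m"
  define B where "B = \<bar>4 * (lognorm 0 + ln Ka)\<bar> + \<bar>2 * Re (P j 0)\<bar>"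
  have z0: "(deriv ^^ m) (\<lambda>_. 0::complex) 0 = 0" by (simp add: higher_deriv_const)
  have "cmod p * r powr real m \<le> 0 * r powr real m + (4 * C + B) * r powr q" if r: "r \<ge> 1" for r
  proof -
    have r0: "r > 0" "r \<ge> 0" using r by auto
    have "cmod ((deriv ^^ m) (P j) 0 / fact m - (deriv ^^ m) (P 0) 0 / fact m) * r ^ m
      \<le> 4 * integral {0..1} (\<lambda>x. u (circlepath 0 r x)) - 2 * (Re (P j 0) - Re (P 0 0))"
    proof (rule coefficient_diff_le[OF n j m0 r0(1) cu])
      show "0 \<le> u z" "Re (P j z) - Re (P 0 z) \<le> u z" for z
        using Re_P_le_lognorm[OF n, of z] Re_P_le_lognorm[OF j, of z] by (auto simp: u_def P0)
    qed
    then have "cmod p * r ^ m \<le> 4 * integral {0..1} (\<lambda>x. u (circlepath 0 r x)) - 2 * Re (P j 0)"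
      by (simp add: P0 z0 p_def)
    also have "integral {0..1} (\<lambda>x. u (circlepath 0 r x)) = integral {0..1} (\<lambda>x. lognorm (circlepath 0 r x)) + ln Ka"
    proof -
      have "(\<lambda>x. lognorm (circlepath 0 r x)) integrable_on {0..1}"
        unfolding circlepath
        by (intro integrable_continuous_real continuous_on_compose2[OF cont_lognorm[of UNIV]] continuous_intros) auto
      then show ?thesis unfolding u_def by (subst Henstock_Kurzweil_Integration.integral_add) auto
    qed
    also have "integral {0..1} (\<lambda>x. lognorm (circlepath 0 r x)) = char r + lognorm 0"
      using char_eq_mean[OF r0(2)] by simp
    also have "4 * (char r + lognorm 0 + ln Ka) - 2 * Re (P j 0) \<le> 4 * (C * r powr q) + B"
      using C[OF r] abs_ge_self[of "4 * (lognorm 0 + ln Ka)"] abs_ge_minus_self[of "2 * Re (P j 0)"]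
      by (simp add: B_def distrib_left)
    also have "B \<le> B * r powr q"
      using ge_one_powr_ge_zero[OF r q] by (simp add: B_def mult_le_cancel_left1)
    finally have "cmod p * r ^ m \<le> (4 * C + B) * r powr q" by (simp add: distrib_right)
    then show ?thesis using r0 by (simp add: powr_realpow)
  qed
  from powr_growth_compare[OF this m] have "p = 0" by simp
  then show ?thesis by (simp add: p_def)
qed

end

lemma polynomial_deriv_asymp:
  fixes c :: "nat \<Rightarrow> complex"
  assumes "\<And>k. 1 \<le> k \<Longrightarrow> k \<le> d \<Longrightarrow> c k \<noteq> 0 \<Longrightarrow> real k < D + 1"
  shows "((\<lambda>z. (\<Sum>k\<le>d. c k * (of_nat k * z ^ (k - 1))) / of_real (cmod z powr D)) \<longlongrightarrow> 0) at_infinity"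
proof -
  have "((\<lambda>z. c k * (of_nat k * z ^ (k - 1)) / of_real (cmod z powr D)) \<longlongrightarrow> 0) at_infinity" if k: "k \<le> d" for k
  proof (cases "k = 0 \<or> c k = 0")
    case False
    then have kD: "real k < D + 1" "k \<ge> 1" using assms[OF _ k] by auto
    have "((\<lambda>z::complex. cmod z powr (real (k - 1) - D)) \<longlongrightarrow> 0) at_infinity"
      by (rule tendsto_neg_powr[OF _ filterlim_norm_at_top]) (use kD in \<open>simp add: of_nat_diff\<close>)
    from tendsto_mult[OF tendsto_const[of "cmod (c k * of_nat k)"] this]
    have lim: "((\<lambda>z::complex. cmod (c k * of_nat k) * cmod z powr (real (k - 1) - D)) \<longlongrightarrow> 0) at_infinity"
      by simp
    show ?thesis
    proof (rule Lim_null_comparison[OF _ lim])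
      have "\<forall>\<^sub>F z::complex in at_infinity. z \<noteq> 0" unfolding eventually_at_infinity by (intro exI[of _ 1]) auto
      then show "\<forall>\<^sub>F z in at_infinity. cmod (c k * (of_nat k * z ^ (k - 1)) / of_real (cmod z powr D))
         \<le> cmod (c k * of_nat k) * cmod z powr (real (k - 1) - D)"
        by eventually_elim (simp add: norm_mult norm_divide norm_power powr_diff powr_realpow)
    qed
  qed auto
  then have "((\<lambda>z. \<Sum>k\<le>d. c k * (of_nat k * z ^ (k - 1)) / of_real (cmod z powr D)) \<longlongrightarrow> 0) at_infinity"
    by (intro tendsto_null_sum) auto
  then show ?thesis by (simp add: sum_divide_distrib)
qed

context omitting_curve
begin

text \<open>At order D only the coefficient of z^(D + 1) contributes to P_j', and only when D is a
  natural number; the lower terms are o(|z|^D).\<close>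

lemma asymptotic_curveI:
  assumes n: "n > 0" and \<kappa>: "\<kappa> \<ge> 0" and D: "D \<ge> 0"
    and kap: "\<And>\<epsilon>. \<epsilon> > 0 \<Longrightarrow> \<forall>\<^sub>F z in at_infinity. kap z \<le> (\<kappa> + \<epsilon>) * cmod z powr D"
    and P: "\<And>j z. j < n \<Longrightarrow> P j z = (\<Sum>k\<le>d. p j k * z ^ k)"
    and top: "\<And>j k. j < n \<Longrightarrow> k \<le> d \<Longrightarrow> p j k \<noteq> 0 \<Longrightarrow> real k \<le> D + 1"
  shows "\<exists>N l. asymptotic_curve I f e n a b P D \<kappa> N l \<and> (\<forall>j<n. D = real N \<longrightarrow> N < d \<longrightarrow> l j = of_nat (N + 1) * p j (N + 1))"
proof -
  have dP: "deriv (P j) z = (\<Sum>k\<le>d. p j k * (of_nat k * z ^ (k - 1)))" if j: "j < n" for j z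
  proof (rule DERIV_imp_deriv)
    have "((\<lambda>z. \<Sum>k\<le>d. p j k * z ^ k) has_field_derivative (\<Sum>k\<le>d. p j k * (of_nat k * z ^ (k - 1)))) (at z)"
      by (auto intro!: derivative_eq_intros sum.cong)
    then show "(P j has_field_derivative (\<Sum>k\<le>d. p j k * (of_nat k * z ^ (k - 1)))) (at z)"
      unfolding ext[of "P j", OF P[OF j]] .
  qed
  show ?thesis
  proof (cases "\<exists>N. D = real N")
    case True
    then obtain N where N: "D = real N" by blast
    define l where "l = (\<lambda>j. if N < d then of_nat (N + 1) * p j (N + 1) else 0)"
    have "asymptotic_curve I f e n a b P D \<kappa> N l"
    proof (unfold_locales)
      fix j assume j: "j < n"
      define c where "c = (\<lambda>k. if k = N + 1 then 0 else p j k)"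
      have "deriv (P j) z - l j * z ^ N = (\<Sum>k\<le>d. c k * (of_nat k * z ^ (k - 1)))" for z
      proof (cases "N < d")
        case True
        have "(\<Sum>k\<le>d. p j k * (of_nat k * z ^ (k - 1))) = p j (N + 1) * (of_nat (N + 1) * z ^ N) + (\<Sum>k\<in>{..d} - {N + 1}. p j k * (of_nat k * z ^ (k - 1)))"
          using True by (subst sum.remove[of _ "N + 1"]) auto
        also have "(\<Sum>k\<in>{..d} - {N + 1}. p j k * (of_nat k * z ^ (k - 1))) = (\<Sum>k\<in>{..d} - {N + 1}. c k * (of_nat k * z ^ (k - 1)))"
          by (intro sum.cong) (auto simp: c_def)
        also have "\<dots> = (\<Sum>k\<le>d. c k * (of_nat k * z ^ (k - 1)))"
          by (rule sum.mono_neutral_left) (auto simp: c_def)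
        finally show ?thesis using True unfolding dP[OF j] by (simp add: l_def mult_ac)
      next
        case False
        have "(\<Sum>k\<le>d. p j k * (of_nat k * z ^ (k - 1))) = (\<Sum>k\<le>d. c k * (of_nat k * z ^ (k - 1)))"
          by (intro sum.cong) (use False in \<open>auto simp: c_def\<close>)
        then show ?thesis using False unfolding dP[OF j] by (simp add: l_def)
      qed
      moreover have "((\<lambda>z. (\<Sum>k\<le>d. c k * (of_nat k * z ^ (k - 1))) / of_real (cmod z powr D)) \<longlongrightarrow> 0) at_infinity"
      proof (rule polynomial_deriv_asymp)
        fix k assume "k \<le> d" "c k \<noteq> 0"
        then show "real k < D + 1" using top[OF j, of k] by (auto simp: c_def N split: if_splits)
      qed
      ultimately show "((\<lambda>z. (deriv (P j) z - l j * z ^ N) / of_real (cmod z powr D)) \<longlongrightarrow> 0) at_infinity" by simp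
    qed (use n \<kappa> D kap N in auto)
    then show ?thesis using N by (intro exI[of _ N] exI[of _ l]) (auto simp: l_def)
  next
    case False
    have "asymptotic_curve I f e n a b P D \<kappa> 0 (\<lambda>_. 0)"
    proof (unfold_locales)
      fix j assume j: "j < n"
      have "((\<lambda>z. (\<Sum>k\<le>d. p j k * (of_nat k * z ^ (k - 1))) / of_real (cmod z powr D)) \<longlongrightarrow> 0) at_infinity"
      proof (rule polynomial_deriv_asymp)
        fix k assume k: "1 \<le> k" "k \<le> d" "p j k \<noteq> 0"
        have "real k \<noteq> D + 1"
        proof
          assume "real k = D + 1"
          then have "D = real (k - 1)" using k(1) by (simp add: of_nat_diff)
          then show False using False by blast
        qed
        then show "real k < D + 1" using top[OF j k(2,3)] by simp
      qed
      then show "((\<lambda>z. (deriv (P j) z - 0 * z ^ 0) / of_real (cmod z powr D)) \<longlongrightarrow> 0) at_infinity"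
        by (simp add: dP[OF j])
    qed (use n \<kappa> D kap in auto)
    then show ?thesis using False by blast
  qed
qed

text \<open>The degree bound \<open>top\<close> must come first: only it makes the asymptotic
  estimates available with D = \<sigma> and \<kappa> = K. It is itself obtained from these estimates
  with D = m - 1, m the largest offending degree, for which the top order of P_j' is exactly
  D.\<close>

lemma char_upper_bound:
  fixes t \<sigma> K c :: real
  assumes n: "n > 0" and P0: "P 0 = (\<lambda>_. 0)" and \<sigma>: "\<sigma> \<ge> 0" and K: "K \<ge> 0"
    and kap: "\<And>\<epsilon>. \<epsilon> > 0 \<Longrightarrow> \<forall>\<^sub>F z in at_infinity. kap z \<le> (K + \<epsilon>) * cmod z powr \<sigma>"
    and t: "t > 0"
    and BT: "\<And>\<phi> \<mu> x0. \<lbrakk>curve I \<phi>; \<And>z. curve.kap I \<phi> z \<le> t;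
       \<And>c. (\<Sum>i\<in>I. c i * e i) = 0 \<Longrightarrow> \<exists>\<beta>. \<forall>z. curve.app I \<phi> c z = (\<Sum>j<n. \<beta> j * exp (\<mu> j * z));
       \<And>z. \<exists>j<n. cmod (curve.conn I \<phi> z - \<mu> j) \<le> 1;
       \<And>j. j < n \<Longrightarrow> 1 \<le> cmod (curve.conn I \<phi> 0 - \<mu> j);
       (cmod (curve.app I \<phi> (\<lambda>i. cnj (e i)) x0))\<^sup>2 \<le> curve.S I \<phi> x0 / 2\<rbrakk> \<Longrightarrow> False"
    and c: "c > (18 * 3 powr (2 * \<sigma> + 1) + 2 + 1 / t) * K"
  shows "\<exists>B. \<forall>r>0. char r \<le> (4 * real n + 3) * c * r powr (\<sigma> + 1) + B"
proof -
  have "(18 * 3 powr (2 * \<sigma> + 1) + 2 + 1 / t) * K \<ge> 0" using K t by (intro mult_nonneg_nonneg) auto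
  then have c0: "c > 0" using c by linarith
  obtain k0 where k0: "k0 \<ge> 0" "\<And>z. kap z \<le> (K + 1) * cmod z powr \<sigma> + k0"
  proof -
    obtain r where r: "\<And>z. cmod z \<ge> r \<Longrightarrow> kap z \<le> (K + 1) * cmod z powr \<sigma>"
      using kap[of 1] unfolding eventually_at_infinity by auto
    have "bounded (kap ` cball 0 r)"
      by (intro compact_imp_bounded compact_continuous_image cont_kap) auto
    then obtain k where "\<forall>x\<in>kap ` cball 0 r. norm x \<le> k" unfolding bounded_iff by blast
    then have k: "kap z \<le> \<bar>k\<bar>" if "cmod z \<le> r" for z using that by force
    have "kap z \<le> (K + 1) * cmod z powr \<sigma> + \<bar>k\<bar>" for z
    proof (cases "cmod z \<ge> r")
      case False
      moreover have "(K + 1) * cmod z powr \<sigma> \<ge> 0" using K by simp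
      ultimately show ?thesis using k[of z] by linarith
    qed (use r[of z] in auto)
    then show thesis by (intro that[of "\<bar>k\<bar>"]) auto
  qed
  define q where "q = 2 * \<sigma> + 2"
  have ch: "char r \<le> (K + 1 + k0)\<^sup>2 * r powr q" if "r \<ge> 1" for r
    unfolding q_def using char_le[OF k0(2) _ k0(1) \<sigma> that] K by simp
  define d where "d = nat \<lceil>q\<rceil>"
  define p where "p = (\<lambda>j k. (deriv ^^ k) (P j) 0 / fact k)"
  have P: "P j z = (\<Sum>k\<le>d. p j k * z ^ k)" if j: "j < n" for j z
    unfolding p_def
  proof (rule entire_coefficients_zero[OF P_hol[OF j]])
    fix m assume "m > d"
    then have "real m > q" unfolding d_def by linarith
    then show "(deriv ^^ m) (P j) 0 = 0" using \<sigma> by (intro P_coefficients_zero[OF n P0 ch _ j]) (auto simp: q_def)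
  qed
  have single: "\<exists>j<n. \<exists>B. \<forall>z. \<bar>lognorm z - Re (P j z)\<bar> \<le> (4 * n + 3) * c' * cmod z powr (D + 1) + B"
    if ac: "asymptotic_curve I f e n a b P D \<kappa> N l" and c': "c' > (18 * 3 powr (2 * D + 1) + 2 + 1 / t) * \<kappa>" "c' > 0"
    for D \<kappa> c' :: real and N l
  proof -
    interpret ac: asymptotic_curve I f e n a b P D \<kappa> N l by (rule ac)
    have lim: "\<forall>\<^sub>F z in at_infinity. \<exists>j<n. cmod (conn z - deriv (P j) z) \<le> c' * cmod z powr D"
      by (rule ac.conn_limsup[OF t _ c'(1)]) (rule BT, assumption+)
    obtain j where j: "j < n" "\<forall>\<^sub>F z in at_infinity. cmod (conn z - deriv (P j) z) \<le> (4 * n + 3) * c' * cmod z powr D"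
      using ac.conn_near_single_exponent[OF c'(2) lim] by blast
    show ?thesis using ac.lognorm_near_Re_P[OF j(1) _ j(2)] c'(2) j(1) by auto
  qed
  have top: "real m \<le> \<sigma> + 1" if m: "m \<le> d" "j < n" "p j m \<noteq> 0" for j m
  proof (rule ccontr)
    assume neg: "\<not> ?thesis"
    define H where "H = {m. m \<le> d \<and> real m > \<sigma> + 1 \<and> (\<exists>j<n. p j m \<noteq> 0)}"
    have "m \<in> H" using that neg unfolding H_def by (intro CollectI conjI exI[of _ j]) auto
    then have H: "finite H" "H \<noteq> {}" by (auto simp: H_def)
    \<comment> \<open>With D = m - 1 > \<sigma> the length \<open>kap\<close> is o(|z|^D), so
      \<kappa> = 0 and every positive constant is admissible.\<close>
    define m where "m = Max H"
    have mH: "m \<in> H" unfolding m_def by (rule Max_in[OF H])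
    have mmax: "p j k = 0" if "j < n" "k \<le> d" "k > m" for j k
    proof (rule ccontr)
      assume "p j k \<noteq> 0"
      moreover have "real k > \<sigma> + 1" using mH that(3) by (auto simp: H_def)
      ultimately have "k \<in> H" using that by (auto simp: H_def)
      then show False using Max_ge[OF H(1), of k] that(3) by (simp add: m_def)
    qed
    have m1: "m \<ge> 1" "m \<le> d" "real (m - 1) > \<sigma>" using mH \<sigma> by (auto simp: H_def of_nat_diff)
    define D where "D = real (m - 1)"
    have "\<exists>N l. asymptotic_curve I f e n a b P D 0 N l \<and> (\<forall>j<n. D = real N \<longrightarrow> N < d \<longrightarrow> l j = of_nat (N + 1) * p j (N + 1))"
    proof (rule asymptotic_curveI[OF n _ _ _ P])
      fix \<epsilon> :: real assume \<epsilon>: "\<epsilon> > 0"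
      have "filterlim (\<lambda>z::complex. cmod z powr (D - \<sigma>)) at_top at_infinity"
        by (rule filterlim_norm_powr) (use m1 in \<open>simp add: D_def\<close>)
      then have "\<forall>\<^sub>F z::complex in at_infinity. (K + 1) / \<epsilon> \<le> cmod z powr (D - \<sigma>)"
        unfolding filterlim_at_top by blast
      moreover have "\<forall>\<^sub>F z::complex in at_infinity. z \<noteq> 0" unfolding eventually_at_infinity by (intro exI[of _ 1]) auto
      ultimately show "\<forall>\<^sub>F z in at_infinity. kap z \<le> (0 + \<epsilon>) * cmod z powr D"
        using kap[OF zero_less_one]
      proof eventually_elim
        case (elim z)
        have "K + 1 \<le> \<epsilon> * cmod z powr (D - \<sigma>)" using elim(1) \<epsilon> by (simp add: divide_le_eq mult.commute)
        then have "(K + 1) * cmod z powr \<sigma> \<le> \<epsilon> * cmod z powr (D - \<sigma>) * cmod z powr \<sigma>" by (rule mult_right_mono) simp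
        also have "\<dots> = \<epsilon> * cmod z powr D" using elim(2) by (simp add: powr_add[symmetric])
        finally show ?case using elim(3) by simp
      qed
    next
      fix j k assume jk: "j < n" "k \<le> d" "p j k \<noteq> 0"
      then have "k \<le> m" using mmax[of j k] by force
      then show "real k \<le> D + 1" using m1 by (simp add: D_def of_nat_diff)
    qed (auto simp: D_def)
    then obtain N l where ac: "asymptotic_curve I f e n a b P D 0 N l" by blast
    obtain i where i: "i < n" "p i m \<noteq> 0" using mH by (auto simp: H_def)
    \<comment> \<open>The factor 4 n + 3 cancels the loss in \<open>single\<close>, and the 16 is 4
      from \<open>coefficient_diff_le\<close> times 4, so each z^m coefficient lies within |p i m| /
      4 of that of P_j. As P_0 has coefficient 0, comparing i with 0 through j gives |p i m| <= |p i
      m| / 2.\<close>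
    define \<delta> where "\<delta> = cmod (p i m) / (16 * (4 * n + 3))"
    have \<delta>: "\<delta> > 0" using i by (simp add: \<delta>_def)
    obtain j B where j: "j < n" and B: "\<And>z. \<bar>lognorm z - Re (P j z)\<bar> \<le> (4 * n + 3) * \<delta> * cmod z powr (D + 1) + B"
      using single[OF ac, of \<delta>] \<delta> by auto
    have D1: "D + 1 = real m" using m1 by (simp add: D_def of_nat_diff)
    have le: "cmod (p k m - p j m) \<le> cmod (p i m) / 4" if k: "k < n" for k
    proof (rule powr_growth_compare)
      fix r :: real assume r: "r \<ge> 1"
      define w where "w = (\<lambda>z::complex. cmod (p i m) / 16 * r powr real m + \<bar>B\<bar> + ln Ka)"
      have w: "w z \<ge> 0" for z using Ka_ge1 by (simp add: w_def)
      have cwz: "continuous_on UNIV w" unfolding w_def by (intro continuous_intros)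
      have "cmod ((deriv ^^ m) (P k) 0 / fact m - (deriv ^^ m) (P j) 0 / fact m) * r ^ m
         \<le> 4 * integral {0..1} (\<lambda>x. w (circlepath 0 r x)) - 2 * (Re (P k 0) - Re (P j 0))"
      proof (rule coefficient_diff_le[OF j k _ _ cwz w])
        show "m > 0" "r > 0" using m1 r by auto
        show "Re (P k z) - Re (P j z) \<le> w z" if z: "cmod z = r" for z
        proof -
          have lk: "Re (P k z) \<le> lognorm z + ln Ka" by (rule Re_P_le_lognorm[OF k])
          have eq: "(4 * n + 3) * \<delta> = cmod (p i m) / 16" unfolding \<delta>_def by (simp add: divide_simps)
          have "\<bar>lognorm z - Re (P j z)\<bar> \<le> cmod (p i m) / 16 * r powr real m + B"
            using B[of z] unfolding eq D1 z .
          moreover have "B \<le> \<bar>B\<bar>" by simp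
          moreover note lk
          ultimately show ?thesis unfolding w_def by linarith
        qed
      qed
      then have "cmod (p k m - p j m) * r powr real m \<le> 4 * (cmod (p i m) / 16 * r powr real m + \<bar>B\<bar> + ln Ka) - 2 * (Re (P k 0) - Re (P j 0))"
        using r by (simp add: p_def w_def powr_realpow)
      then show "cmod (p k m - p j m) * r powr real m \<le> cmod (p i m) / 4 * r powr real m
         + (4 * \<bar>B\<bar> + 4 * ln Ka - 2 * (Re (P k 0) - Re (P j 0))) * r powr 0"
        using r by simp
    qed (use m1 in simp)
    have p0: "p 0 m = 0" using m1 by (simp add: p_def P0 higher_deriv_const)
    have "cmod (p i m) \<le> cmod (p i m - p j m) + cmod (p 0 m - p j m)"
      using norm_triangle_ineq4[of "p i m - p j m" "p 0 m - p j m"] by (simp add: p0)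
    also have "\<dots> \<le> cmod (p i m) / 4 + cmod (p i m) / 4" by (intro add_mono le i n)
    finally show False using i by simp
  qed
  have "\<exists>N l. asymptotic_curve I f e n a b P \<sigma> K N l \<and> (\<forall>j<n. \<sigma> = real N \<longrightarrow> N < d \<longrightarrow> l j = of_nat (N + 1) * p j (N + 1))"
    by (rule asymptotic_curveI[OF n K \<sigma> kap P]) (use top in auto)
  then obtain N l where ac: "asymptotic_curve I f e n a b P \<sigma> K N l" by blast
  obtain j B where j: "j < n" and B: "\<And>z. \<bar>lognorm z - Re (P j z)\<bar> \<le> (4 * n + 3) * c * cmod z powr (\<sigma> + 1) + B"
    using single[OF ac c c0] by auto
  have "char r \<le> (4 * real n + 3) * c * r powr (\<sigma> + 1) + (B + Re (P j 0) - lognorm 0)" if r: "r > 0" for r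
  proof -
    have cp: "continuous_on {0..1} (circlepath 0 r)" unfolding circlepath by (intro continuous_intros)
    have ncp: "cmod (circlepath 0 r x) = r" for x using r by (simp add: circlepath norm_mult)
    have i1: "(\<lambda>x. lognorm (circlepath 0 r x)) integrable_on {0..1}"
      by (intro integrable_continuous_real continuous_on_compose2[OF cont_lognorm[of UNIV] cp]) auto
    have i2: "(\<lambda>x. Re (P j (circlepath 0 r x))) integrable_on {0..1}"
      by (intro integrable_continuous_real continuous_intros
          continuous_on_compose2[OF holomorphic_on_imp_continuous_on[OF P_hol[OF j]] cp]) auto
    define A where "A = (4 * real n + 3) * c * r powr (\<sigma> + 1) + B"
    have "integral {0..1} (\<lambda>x. lognorm (circlepath 0 r x)) \<le> integral {0..1} (\<lambda>x. Re (P j (circlepath 0 r x)) + A)"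
    proof (rule integral_le[OF i1])
      show "(\<lambda>x. Re (P j (circlepath 0 r x)) + A) integrable_on {0..1}"
        by (intro integrable_add i2) auto
      show "lognorm (circlepath 0 r x) \<le> Re (P j (circlepath 0 r x)) + A" for x
        using B[of "circlepath 0 r x"] by (simp add: ncp A_def abs_le_iff)
    qed
    also have "\<dots> = integral {0..1} (\<lambda>x. Re (P j (circlepath 0 r x))) + A"
      by (subst Henstock_Kurzweil_Integration.integral_add[OF i2]) auto
    also have "integral {0..1} (\<lambda>x. Re (P j (circlepath 0 r x))) = Re (P j 0)"
    proof (rule mean_abs_Re(1)[OF P_hol[OF j] r])
      show "continuous_on UNIV (\<lambda>z. \<bar>Re (P j z)\<bar>)"
        by (intro continuous_intros holomorphic_on_imp_continuous_on[OF P_hol[OF j]])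
    qed auto
    finally show ?thesis using char_eq_mean[of r] r by (simp add: A_def)
  qed
  then show ?thesis by blast
qed

end

section \<open>Normalised representations of curves omitting hyperplanes\<close>

lemma linear_form_nonzero_of_omitted:
  assumes rep: "homogeneous_rep n F f" and omit: "range F \<inter> proj_hyperplane n a = {}"
  shows "linear_form n a (\<lambda>j. f j z) \<noteq> 0"
proof
  assume zero: "linear_form n a (\<lambda>j. f j z) = 0"
  have "linear_form n a v = 0" if vz: "v \<in> F z" for v
  proof -
    have "F z = proj_point n (\<lambda>j. f j z)" using rep by (simp add: homogeneous_rep_def)
    then obtain c where v: "v = (\<lambda>j. if j \<le> n then c * f j z else 0)"
      using vz unfolding proj_point_def by blast
    have "linear_form n a v = c * linear_form n a (\<lambda>j. f j z)"
      unfolding linear_form_def sum_distrib_left by (rule sum.cong) (auto simp: v)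
    then show ?thesis by (simp add: zero)
  qed
  then have "F z \<in> proj_hyperplane n a"
    using homogeneous_rep_in_proj_space[OF rep] by (simp add: proj_hyperplane_def)
  then show False using omit by blast
qed

lemma proj_point_divide:
  assumes "s \<noteq> 0"
  shows "proj_point n (\<lambda>j. v j / s) = proj_point n v"
proof -
  have "\<exists>c'. (\<lambda>j. if j \<le> n then c * (v j / s) else 0) = (\<lambda>j. if j \<le> n then c' * v j else 0)" for c
    by (rule exI[of _ "c / s"]) auto
  moreover have "\<exists>c'. (\<lambda>j. if j \<le> n then c * v j else 0) = (\<lambda>j. if j \<le> n then c' * (v j / s) else 0)" for c
    by (rule exI[of _ "c * s"]) (use assms in auto)
  ultimately show ?thesis unfolding proj_point_def by blast
qed

lemma homogeneous_rep_divide: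
  assumes rep: "homogeneous_rep n F f" and g: "g holomorphic_on UNIV" "\<And>z. g z \<noteq> 0"
  shows "homogeneous_rep n F (\<lambda>j z. f j z / g z)"
  unfolding homogeneous_rep_def
proof (intro conjI allI impI)
  show "(\<lambda>z. f j z / g z) holomorphic_on UNIV" if "j \<le> n" for j
    using rep that g by (intro holomorphic_intros) (auto simp: homogeneous_rep_def)
  show "\<exists>j\<le>n. f j z / g z \<noteq> 0" for z
    using rep g by (auto simp: homogeneous_rep_def)
  show "F z = proj_point n (\<lambda>j. f j z / g z)" for z
    using rep proj_point_divide[OF g(2)] by (simp add: homogeneous_rep_def)
qed

text \<open>Along the curve each form is an entire function without zeros. Dividing the
  representation by the first of them turns the forms into zero-free quotients, which have entire
  logarithms.\<close>

lemma omitting_curve_rep: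
  assumes n: "n \<ge> 1" and F: "holomorphic_curve n F" and a: "lin_indep_forms n n a"
    and omit: "\<And>i. i < n \<Longrightarrow> range F \<inter> proj_hyperplane n (a i) = {}"
  obtains f e b P where "homogeneous_rep n F f" "omitting_curve {..n} f e n a b P" "P 0 = (\<lambda>_. 0)"
proof -
  obtain h where h: "homogeneous_rep n F h" using F by (auto simp: holomorphic_curve_def)
  define g where "g = (\<lambda>i z. linear_form n (a i) (\<lambda>j. h j z))"
  have g0: "g i z \<noteq> 0" if "i < n" for i z
    unfolding g_def by (rule linear_form_nonzero_of_omitted[OF h omit[OF that]])
  have gh: "g i holomorphic_on UNIV" for i
    unfolding g_def linear_form_def using h by (intro holomorphic_intros) (auto simp: homogeneous_rep_def)
  define f where "f = (\<lambda>j z. h j z / g 0 z)"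
  have rep: "homogeneous_rep n F f"
    unfolding f_def using n by (intro homogeneous_rep_divide[OF h gh] g0) auto
  have lf: "linear_form n (a i) (\<lambda>j. f j z) = g i z / g 0 z" for i z
    by (simp add: g_def f_def linear_form_def sum_divide_distrib)
  have "\<exists>p. p holomorphic_on UNIV \<and> (\<forall>z. exp (p z) = g i z / g 0 z)" if i: "i < n" for i
  proof -
    have 0: "g 0 z \<noteq> 0" for z using n by (intro g0) auto
    have hq: "(\<lambda>z. g i z / g 0 z) holomorphic_on UNIV" by (intro holomorphic_intros gh) (simp add: 0)
    obtain p where "p holomorphic_on UNIV" "\<And>z. z \<in> UNIV \<Longrightarrow> exp (p z) = g i z / g 0 z"
      using holomorphic_logarithm_exists[OF convex_UNIV open_UNIV hq, of 0] g0[OF i] 0 by auto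
    then show ?thesis by blast
  qed
  then obtain p where p: "\<And>i. i < n \<Longrightarrow> p i holomorphic_on UNIV" "\<And>i z. i < n \<Longrightarrow> exp (p i z) = g i z / g 0 z"
    by metis
  \<comment> \<open>The first quotient is 1, and its logarithm is taken to be exactly 0: comparison
    with the index 0 is what bounds the coefficients of the other exponents.\<close>
  define P where "P = p(0 := (\<lambda>_. 0))"
  have eP: "exp (P i z) = linear_form n (a i) (\<lambda>j. f j z)" if "i < n" for i z
    using p(2)[OF that] g0[of 0 z] n by (simp add: lf P_def)
  obtain e b where e: "(\<Sum>i\<le>n. (cmod (e i))\<^sup>2) = 1" and ae: "\<forall>j<n. linear_form n (a j) e = 0"
    and dec: "\<forall>v i. i \<le> n \<longrightarrow> v i = (\<Sum>k\<le>n. cnj (e k) * v k) * e i + (\<Sum>j<n. b j i * linear_form n (a j) v)"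
    using lin_indep_forms_orthogonal_decomposition[OF a] by blast
  interpret curve "{..n}" f by (rule homogeneous_rep_curve[OF rep])
  have "omitting_curve {..n} f e n a b P"
  proof unfold_locales
    show "P j holomorphic_on UNIV" if "j < n" for j using p(1)[OF that] by (simp add: P_def)
    show "app (a j) z = exp (P j z)" if "j < n" for j z
      by (simp add: eP[OF that] app_def linear_form_def)
    show "(\<Sum>i\<le>n. a j i * e i) = 0" if "j < n" for j
      using ae that by (simp add: linear_form_def)
    show "f i z = app (\<lambda>i. cnj (e i)) z * e i + (\<Sum>j<n. b j i * exp (P j z))" if "i \<in> {..n}" for i z
    proof -
      have "(\<Sum>j<n. b j i * exp (P j z)) = (\<Sum>j<n. b j i * linear_form n (a j) (\<lambda>j. f j z))"
        by (intro sum.cong refl) (simp add: eP)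
      then show ?thesis using dec[rule_format, of i "\<lambda>j. f j z"] that by (simp add: app_def)
    qed
  qed (rule e)
  then show thesis by (rule that[OF rep]) (simp add: P_def)
qed

theorem mainTheorem1:
  shows "\<exists>C :: nat \<Rightarrow> real \<Rightarrow> real.
    \<forall>n \<sigma>. n \<ge> 1 \<longrightarrow> \<sigma> \<ge> 0 \<longrightarrow>
      (\<forall>F a K.
        holomorphic_curve n F \<longrightarrow>
        lin_indep_forms n n a \<longrightarrow>
        (\<forall>i<n. range F \<inter> proj_hyperplane n (a i) = {}) \<longrightarrow>
        0 \<le> K \<longrightarrow>
        Limsup at_infinity (\<lambda>z. ereal (cmod z powr (- \<sigma>) * fs_deriv n F z)) \<le> ereal K \<longrightarrow>
        Limsup at_top (\<lambda>r. ereal (cartan_char n F r / r powr (\<sigma> + 1))) \<le> ereal (K * C n \<sigma>))"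
proof -
  \<comment> \<open>The gap as a property of n and t alone, so that a value \<open>t n\<close> can
    be chosen for every n before any curve is given.\<close>
  define gap where "gap = (\<lambda>(n::nat) t. t > 0 \<and>
    (\<forall>(I :: nat set) f e \<mu> x0. curve I f \<longrightarrow> (\<forall>z. curve.kap I f z \<le> t) \<longrightarrow>
       (\<Sum>i\<in>I. (cmod (e i))\<^sup>2) = 1 \<longrightarrow>
       (\<forall>c. (\<Sum>i\<in>I. c i * e i) = 0 \<longrightarrow> (\<exists>\<beta>. \<forall>z. curve.app I f c z = (\<Sum>j<n. \<beta> j * exp (\<mu> j * z)))) \<longrightarrow>
       (\<forall>z. \<exists>j<n. cmod (curve.conn I f z - \<mu> j) \<le> 1) \<longrightarrow>
       (\<forall>j<n. 1 \<le> cmod (curve.conn I f 0 - \<mu> j)) \<longrightarrow>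
       (cmod (curve.app I f (\<lambda>i. cnj (e i)) x0))\<^sup>2 \<le> curve.S I f x0 / 2 \<longrightarrow> False))"
  have "\<exists>t. gap n t" for n
    by (rule brody_gap[where 'i = nat and n = n]) (unfold gap_def, blast)
  then obtain t where t: "\<And>n. gap n (t n)" by metis
  \<comment> \<open>\<open>C1 n \<sigma> * K\<close> is the threshold that the constant c of
    \<open>char_upper_bound\<close> has to exceed.\<close>
  define C1 where "C1 = (\<lambda>n \<sigma>. 18 * 3 powr (2 * \<sigma> + 1) + 2 + 1 / t n)"
  define C where "C = (\<lambda>n \<sigma>. (4 * real n + 3) * C1 n \<sigma>)"
  have "Limsup at_top (\<lambda>r. ereal (cartan_char n F r / r powr (\<sigma> + 1))) \<le> ereal (K * C n \<sigma>)"
    if n: "n \<ge> 1" and \<sigma>: "\<sigma> \<ge> 0" and F: "holomorphic_curve n F" and a: "lin_indep_forms n n a"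
      and omit: "\<forall>i<n. range F \<inter> proj_hyperplane n (a i) = {}" and K: "0 \<le> K"
      and lim: "Limsup at_infinity (\<lambda>z. ereal (cmod z powr (- \<sigma>) * fs_deriv n F z)) \<le> ereal K"
    for n \<sigma> F a K
  proof -
    obtain f e b P where rep: "homogeneous_rep n F f" and oc: "omitting_curve {..n} f e n a b P"
      and P0: "P 0 = (\<lambda>_. 0)"
      using omitting_curve_rep[OF n F a] omit by blast
    interpret omitting_curve "{..n}" f e n a b P by (rule oc)
    have fs: "fs_deriv n F = kap"
      using fs_deriv_eq_rep[OF rep] fs_deriv_rep_eq_kap[OF homogeneous_rep_curve[OF rep]] by auto
    have ch: "cartan_char n F = char"
      by (rule ext) (simp only: cartan_char_def char_def area_def fs)
    have kap: "\<forall>\<^sub>F z in at_infinity. kap z \<le> (K + \<epsilon>) * cmod z powr \<sigma>" if \<epsilon>: "\<epsilon> > 0" for \<epsilon>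
    proof -
      have "ereal K < ereal (K + \<epsilon>)" using \<epsilon> by simp
      then have "\<forall>\<^sub>F z in at_infinity. ereal (cmod z powr (- \<sigma>) * kap z) < ereal (K + \<epsilon>)"
        using lim unfolding Limsup_le_iff fs by blast
      moreover have "\<forall>\<^sub>F z::complex in at_infinity. z \<noteq> 0"
        unfolding eventually_at_infinity by (intro exI[of _ 1]) auto
      ultimately show ?thesis
      proof eventually_elim
        case (elim z)
        then have "kap z / cmod z powr \<sigma> < K + \<epsilon>" by (simp add: powr_minus_divide)
        then show ?case using elim(2) by (simp add: divide_less_eq)
      qed
    qed
    have bound: "\<exists>B. \<forall>r>0. char r \<le> (4 * real n + 3) * c * r powr (\<sigma> + 1) + B" if c: "c > C1 n \<sigma> * K" for c
    proof (rule char_upper_bound[OF _ P0 \<sigma> K kap, of "t n"])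
      show "t n > 0" using t by (simp add: gap_def)
      show "(18 * 3 powr (2 * \<sigma> + 1) + 2 + 1 / t n) * K < c" using c by (simp add: C1_def)
      fix \<phi> \<mu> x0
      assume "curve {..n} \<phi>" "\<And>z. curve.kap {..n} \<phi> z \<le> t n"
        "\<And>c. (\<Sum>i\<le>n. c i * e i) = 0 \<Longrightarrow> \<exists>\<beta>. \<forall>z. curve.app {..n} \<phi> c z = (\<Sum>j<n. \<beta> j * exp (\<mu> j * z))"
        "\<And>z. \<exists>j<n. cmod (curve.conn {..n} \<phi> z - \<mu> j) \<le> 1"
        "\<And>j. j < n \<Longrightarrow> 1 \<le> cmod (curve.conn {..n} \<phi> 0 - \<mu> j)"
        "(cmod (curve.app {..n} \<phi> (\<lambda>i. cnj (e i)) x0))\<^sup>2 \<le> curve.S {..n} \<phi> x0 / 2"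
      then show False
        using t[of n, unfolded gap_def, THEN conjunct2, rule_format, of "{..n}" \<phi> e \<mu> x0] e_unit by blast
    qed (use n in auto)
    show ?thesis
    proof (rule ereal_le_epsilon2)
      fix \<epsilon> :: real assume \<epsilon>: "\<epsilon> > 0"
      \<comment> \<open>Half of \<epsilon> pays for exceeding the threshold strictly, which matters
        even when K = 0; the other half absorbs the constant B, since r powr (\<sigma> + 1) >= r for
        r >= 1.\<close>
      define \<delta> where "\<delta> = \<epsilon> / (2 * (4 * real n + 3))"
      have \<delta>: "\<delta> > 0" "(4 * real n + 3) * \<delta> = \<epsilon> / 2" using \<epsilon> by (auto simp: \<delta>_def divide_simps)
      obtain B where B: "\<And>r. r > 0 \<Longrightarrow> char r \<le> (4 * real n + 3) * (C1 n \<sigma> * K + \<delta>) * r powr (\<sigma> + 1) + B"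
        using bound[of "C1 n \<sigma> * K + \<delta>"] \<delta> by auto
      have "\<forall>\<^sub>F r in at_top. 2 * \<bar>B\<bar> / \<epsilon> \<le> r" by (rule eventually_ge_at_top)
      then have "\<forall>\<^sub>F r in at_top. ereal (cartan_char n F r / r powr (\<sigma> + 1)) \<le> ereal (K * C n \<sigma> + \<epsilon>)"
        using eventually_ge_at_top[of 1]
      proof eventually_elim
        case (elim r)
        have r: "r powr (\<sigma> + 1) \<ge> r" using elim \<sigma> powr_mono[of 1 "\<sigma> + 1" r] by simp
        have "B \<le> \<epsilon> / 2 * r" using elim \<epsilon> by (simp add: divide_le_eq mult.commute)
        also have "\<dots> \<le> \<epsilon> / 2 * r powr (\<sigma> + 1)" using r \<epsilon> by (intro mult_left_mono) auto
        finally have BR: "B \<le> \<epsilon> / 2 * r powr (\<sigma> + 1)" .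
        have "(4 * real n + 3) * (C1 n \<sigma> * K + \<delta>) = K * C n \<sigma> + \<epsilon> / 2"
          using \<delta>(2) by (simp add: C_def distrib_left mult_ac)
        then have "char r \<le> (K * C n \<sigma> + \<epsilon> / 2) * r powr (\<sigma> + 1) + \<epsilon> / 2 * r powr (\<sigma> + 1)"
          using B[of r] elim BR by simp
        also have "\<dots> = (K * C n \<sigma> + \<epsilon>) * r powr (\<sigma> + 1)" by (simp add: field_simps)
        finally have "char r / r powr (\<sigma> + 1) \<le> K * C n \<sigma> + \<epsilon>"
          using elim by (simp add: divide_le_eq)
        then show ?case by (simp add: ch)
      qed
      from Limsup_bounded[OF this]
      show "Limsup at_top (\<lambda>r. ereal (cartan_char n F r / r powr (\<sigma> + 1))) \<le> ereal (K * C n \<sigma>) + ereal \<epsilon>"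
        by simp
    qed
  qed
  then show ?thesis by (intro exI[of _ C]) blast
qed

end
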